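(* Let $n\ge 1$, let $D$ be a domain in $\mathbb{C}^n$ containing the origin $o$, let $I$ be a proper ideal of $\mathcal{O}_o$, and let $(F,o)\in\mathcal{O}_o$. Then $$B^{\circ}(F,I,D)=B(F,I,D)=C_{F,I}(D),$$ as an equality in $[0,+\infty]$.
   Context: $\mathcal{O}_o$ is the ring of germs at the origin $o\in\mathbb{C}^n$ of holomorphic functions, and $(F,o)$ denotes the germ at $o$ of $F$. For a domain $D\subseteq\mathbb{C}^n$, $\|f\|_D^2=\int_D|f|^2$ (Lebesgue measure) and $A^2(D)=L^2(D)\cap\mathcal{O}(D)$ is the Bergman space of square integrable holomorphic functions on $D$. Sequence spaces: $$\ell_1^{(n)}:=\Big\{(\xi_\alpha)_{\alpha\in\mathbb{N}^n}:\ \xi_\alpha\in\mathbb{C},\ \sum_{\alpha\in\mathbb{N}^n}|\xi_\alpha|\rho^{|\alpha|}<+\infty\ \text{for all }\rho>0\Big\},$$ $$\ell_0^{(n)}:=\Big\{(\xi_\alpha)_{\alpha\in\mathbb{N}^n}:\ \xi_\alpha\in\mathbb{C},\ \exists k\in\mathbb{N}\ \text{such that}\ \xi_\alpha=0\ \text{for all }\alpha\text{ with }|\alpha|>k\Big\}\subseteq\ell_1^{(n)},$$ where $\mathbb{N}$ contains $0$ and $|\alpha|=\alpha_1+\cdots+\alpha_n$. For $\xi=(\xi_\alpha)\in\ell_1^{(n)}$ and a holomorphic germ $f=\sum_\alpha c_\alpha z^\alpha$ at $o$, put $(\xi\cdot f)(o):=\sum_{\alpha}\xi_\alpha\frac{(D^\alpha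 f)(o)}{\alpha!}=\sum_\alpha\xi_\alpha c_\alpha$. The Bergman kernel with respect to $\xi$ at $o\in D$ is $K_{\xi,D}(o):=\sup\{|(\xi\cdot f)(o)|^2:\ f\in A^2(D),\ \|f\|_D\le 1\}$, which is finite. For an ideal $I$ of $\mathcal{O}_o$: $\tilde\ell_I:=\{\xi\in\ell_1^{(n)}:(\xi\cdot f)(o)=0\ \text{for all }(f,o)\in I\}$ and $\ell_I:=\tilde\ell_I\setminus\{0\}$. Define $$B(F,I,D):=\sup_{\xi\in\ell_I}\frac{|(\xi\cdot F)(o)|^2}{K_{\xi,D}(o)},\qquad B^{\circ}(F,I,D):=\sup_{\xi\in\ell_I\cap\ell_0^{(n)}}\frac{|(\xi\cdot F)(o)|^2}{K_{\xi,D}(o)},$$ with the convention that when $K_{\xi,D}(o)=0$ the quotient is $+\infty$ if $(\xi\cdot F)(o)\ne 0$ and $0$ if $(\xi\cdot F)(o)=0$. The minimal $L^2$ integral is $$C_{F,I}(D):=\inf\{\|\tilde F\|_D^2:\ \tilde F\in A^2(D),\ (\tilde F-F,o)\in I\},$$ with $C_{F,I}(D)=+\infty$ if the set is empty. *)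

theory Defs
  imports "HOL-Analysis.Analysis" "HOL-Algebra.Ideal"
begin

text \<open>
  The space of \<open>n\<close> complex variables is \<^typ>\<open>complex ^ 'n\<close> with \<open>n = CARD('n) \<ge> 1\<close>, the origin is
  \<open>0\<close>, and multi-indices are functions \<^typ>\<open>'n \<Rightarrow> nat\<close>. Functions are total; a function on an open
  set or a germ at the origin is a total function whose other values are ignored.
\<close>

section \<open>Holomorphic functions and the ring of germs at the origin\<close>

text \<open>Existence of a complex-linear Frechet derivative at every point; only used for open sets.\<close>

definition holo_on :: "(complex ^ 'n \<Rightarrow> complex) \<Rightarrow> (complex ^ 'n) set \<Rightarrow> bool" where
  "holo_on f D \<longleftrightarrow>
     (\<forall>z\<in>D. \<exists>f'. (f has_derivative f') (at z) \<and> (\<forall>c v. f' (c *s v) = c * f' v))"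

definition germ :: "(complex ^ 'n \<Rightarrow> complex) \<Rightarrow> (complex ^ 'n \<Rightarrow> complex) set" where
  "germ f = {g. \<forall>\<^sub>F z in nhds 0. g z = f z}"

definition germ_ring :: "(complex ^ 'n \<Rightarrow> complex) set ring" where
  "germ_ring =
     \<lparr> carrier = {germ f | f. \<exists>U. open U \<and> 0 \<in> U \<and> holo_on f U},
       mult = (\<lambda>A B. {h. \<exists>f\<in>A. \<exists>g\<in>B. \<forall>\<^sub>F z in nhds 0. h z = f z * g z}),
       one = germ (\<lambda>_. 1),
       zero = germ (\<lambda>_. 0),
       add = (\<lambda>A B. {h. \<exists>f\<in>A. \<exists>g\<in>B. \<forall>\<^sub>F z in nhds 0. h z = f z + g z}) \<rparr>"

lemma holo_on_const: "holo_on (\<lambda>_. c) U"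
  unfolding holo_on_def by (auto intro!: exI[of _ "\<lambda>_. 0"])

lemma holo_on_subset: "holo_on f U \<Longrightarrow> V \<subseteq> U \<Longrightarrow> holo_on f V"
  unfolding holo_on_def by blast

lemma holo_on_add:
  assumes "holo_on f U" "holo_on g U"
  shows "holo_on (\<lambda>z. f z + g z) U"
  unfolding holo_on_def
proof
  fix z assume z: "z \<in> U"
  obtain f' g' where
    "(f has_derivative f') (at z)" "\<forall>c v. f' (c *s v) = c * f' v"
    "(g has_derivative g') (at z)" "\<forall>c v. g' (c *s v) = c * g' v"
    using assms z unfolding holo_on_def by metis
  then show "\<exists>h'. ((\<lambda>z. f z + g z) has_derivative h') (at z) \<and> (\<forall>c v. h' (c *s v) = c * h' v)"
    by (intro exI[of _ "\<lambda>v. f' v + g' v"])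
       (auto intro: has_derivative_add simp: algebra_simps)
qed

lemma holo_on_mult:
  assumes "holo_on f U" "holo_on g U"
  shows "holo_on (\<lambda>z. f z * g z) U"
  unfolding holo_on_def
proof
  fix z assume z: "z \<in> U"
  obtain f' g' where
    "(f has_derivative f') (at z)" "\<forall>c v. f' (c *s v) = c * f' v"
    "(g has_derivative g') (at z)" "\<forall>c v. g' (c *s v) = c * g' v"
    using assms z unfolding holo_on_def by metis
  then show "\<exists>h'. ((\<lambda>z. f z * g z) has_derivative h') (at z) \<and> (\<forall>c v. h' (c *s v) = c * h' v)"
    by (intro exI[of _ "\<lambda>v. f z * g' v + f' v * g z"])
       (auto intro: has_derivative_mult simp: algebra_simps)
qed

lemma germ_eq_iff: "germ f = germ g \<longleftrightarrow> (\<forall>\<^sub>F z in nhds 0. f z = g z)"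
proof
  assume "germ f = germ g"
  moreover have "f \<in> germ f" by (simp add: germ_def)
  ultimately show "\<forall>\<^sub>F z in nhds 0. f z = g z" by (simp add: germ_def)
next
  assume fg: "\<forall>\<^sub>F z in nhds 0. f z = g z"
  show "germ f = germ g"
    unfolding germ_def using fg
    by (auto elim: eventually_elim2)
qed

lemma germ_mult: "germ f \<otimes>\<^bsub>germ_ring\<^esub> germ g = germ (\<lambda>z. f z * g z)"
proof -
  have "h \<in> germ (\<lambda>z. f z * g z)"
    if "f0 \<in> germ f" "g0 \<in> germ g" "\<forall>\<^sub>F z in nhds 0. h z = f0 z * g0 z" for f0 g0 h
    using that unfolding germ_def mem_Collect_eq by eventually_elim simp
  moreover have "\<exists>f0\<in>germ f. \<exists>g0\<in>germ g. \<forall>\<^sub>F z in nhds 0. h z = f0 z * g0 z"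
    if "h \<in> germ (\<lambda>z. f z * g z)" for h
    using that by (intro bexI[of _ f] bexI[of _ g]) (simp_all add: germ_def)
  ultimately show ?thesis unfolding germ_ring_def by (simp, blast)
qed

lemma germ_add: "germ f \<oplus>\<^bsub>germ_ring\<^esub> germ g = germ (\<lambda>z. f z + g z)"
proof -
  have "h \<in> germ (\<lambda>z. f z + g z)"
    if "f0 \<in> germ f" "g0 \<in> germ g" "\<forall>\<^sub>F z in nhds 0. h z = f0 z + g0 z" for f0 g0 h
    using that unfolding germ_def mem_Collect_eq by eventually_elim simp
  moreover have "\<exists>f0\<in>germ f. \<exists>g0\<in>germ g. \<forall>\<^sub>F z in nhds 0. h z = f0 z + g0 z"
    if "h \<in> germ (\<lambda>z. f z + g z)" for h
    using that by (intro bexI[of _ f] bexI[of _ g]) (simp_all add: germ_def)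
  ultimately show ?thesis unfolding germ_ring_def by (simp, blast)
qed

lemma germ_carrierE:
  assumes "A \<in> carrier germ_ring"
  obtains f U where "A = germ f" "open U" "0 \<in> U" "holo_on f U"
  using assms by (auto simp: germ_ring_def)

lemma germ_carrierI: "open U \<Longrightarrow> 0 \<in> U \<Longrightarrow> holo_on f U \<Longrightarrow> germ f \<in> carrier germ_ring"
  by (auto simp: germ_ring_def)

lemma germ_carrier_const: "germ (\<lambda>_. c) \<in> carrier germ_ring"
  by (rule germ_carrierI[of UNIV]) (auto simp: holo_on_const)

lemma germ_carrier_mult:
  assumes "A \<in> carrier germ_ring" "B \<in> carrier germ_ring"
  shows "A \<otimes>\<^bsub>germ_ring\<^esub> B \<in> carrier germ_ring"
proof -
  obtain f U where f: "A = germ f" "open U" "0 \<in> U" "holo_on f U"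
    using assms(1) by (rule germ_carrierE)
  obtain g V where g: "B = germ g" "open V" "0 \<in> V" "holo_on g V"
    using assms(2) by (rule germ_carrierE)
  show ?thesis unfolding f(1) g(1) germ_mult
    by (rule germ_carrierI[of "U \<inter> V"])
       (use f g in \<open>auto intro!: holo_on_mult intro: holo_on_subset\<close>)
qed

lemma germ_carrier_add:
  assumes "A \<in> carrier germ_ring" "B \<in> carrier germ_ring"
  shows "A \<oplus>\<^bsub>germ_ring\<^esub> B \<in> carrier germ_ring"
proof -
  obtain f U where f: "A = germ f" "open U" "0 \<in> U" "holo_on f U"
    using assms(1) by (rule germ_carrierE)
  obtain g V where g: "B = germ g" "open V" "0 \<in> V" "holo_on g V"
    using assms(2) by (rule germ_carrierE)
  show ?thesis unfolding f(1) g(1) germ_add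
    by (rule germ_carrierI[of "U \<inter> V"])
       (use f g in \<open>auto intro!: holo_on_add intro: holo_on_subset\<close>)
qed

lemma germ_one: "\<one>\<^bsub>germ_ring\<^esub> = germ (\<lambda>_. 1)"
  and germ_zero: "\<zero>\<^bsub>germ_ring\<^esub> = germ (\<lambda>_. 0)"
  by (simp_all add: germ_ring_def)

lemma germ_ring_cring: "cring germ_ring"
proof (intro cringI abelian_groupI comm_monoidI)
  fix A :: "(complex ^ 'n \<Rightarrow> complex) set"
  assume A: "A \<in> carrier germ_ring"
  show "\<exists>B\<in>carrier germ_ring. B \<oplus>\<^bsub>germ_ring\<^esub> A = \<zero>\<^bsub>germ_ring\<^esub>"
  proof (rule bexI[of _ "germ (\<lambda>_. - 1) \<otimes>\<^bsub>germ_ring\<^esub> A"])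
    show "germ (\<lambda>_. - 1) \<otimes>\<^bsub>germ_ring\<^esub> A \<oplus>\<^bsub>germ_ring\<^esub> A = \<zero>\<^bsub>germ_ring\<^esub>"
      using A by (elim germ_carrierE) (simp add: germ_mult germ_add germ_zero)
    show "germ (\<lambda>_. - 1) \<otimes>\<^bsub>germ_ring\<^esub> A \<in> carrier germ_ring"
      by (rule germ_carrier_mult[OF germ_carrier_const A])
  qed
qed (auto intro: germ_carrier_mult germ_carrier_add simp: germ_carrier_const germ_one germ_zero,
     (elim germ_carrierE; simp add: germ_mult germ_add algebra_simps)+)

section \<open>Multi-index derivatives and sequence spaces\<close>

definition pderiv_at :: "'n::finite \<Rightarrow> (complex ^ 'n \<Rightarrow> complex) \<Rightarrow> complex ^ 'n \<Rightarrow> complex" where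
  "pderiv_at i f = (\<lambda>z. deriv (\<lambda>w. f (z + axis i w)) 0)"

text \<open>
  The index type carries no order, so the variables are differentiated in an arbitrary but fixed
  order; for holomorphic functions the partial derivatives commute.
\<close>

definition index_list :: "'n::finite list" where
  "index_list = (SOME is. distinct is \<and> set is = UNIV)"

definition mderiv ::
    "('n::finite \<Rightarrow> nat) \<Rightarrow> (complex ^ 'n \<Rightarrow> complex) \<Rightarrow> complex ^ 'n \<Rightarrow> complex" where
  "mderiv \<alpha> f = foldr (\<lambda>i g. (pderiv_at i ^^ \<alpha> i) g) index_list f"

definition mdeg :: "('n::finite \<Rightarrow> nat) \<Rightarrow> nat" where
  "mdeg \<alpha> = (\<Sum>i\<in>UNIV. \<alpha> i)"

definition mfact :: "('n::finite \<Rightarrow> nat) \<Rightarrow> nat" where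
  "mfact \<alpha> = (\<Prod>i\<in>UNIV. fact (\<alpha> i))"

definition ell1 :: "(('n::finite \<Rightarrow> nat) \<Rightarrow> complex) set" where
  "ell1 = {\<xi>. \<forall>\<rho>::real. \<rho> > 0 \<longrightarrow> (\<lambda>\<alpha>. norm (\<xi> \<alpha>) * \<rho> ^ mdeg \<alpha>) summable_on UNIV}"

definition ell0 :: "(('n::finite \<Rightarrow> nat) \<Rightarrow> complex) set" where
  "ell0 = {\<xi>. \<exists>k. \<forall>\<alpha>. mdeg \<alpha> > k \<longrightarrow> \<xi> \<alpha> = 0}"

definition pairing ::
    "(('n::finite \<Rightarrow> nat) \<Rightarrow> complex) \<Rightarrow> (complex ^ 'n \<Rightarrow> complex) \<Rightarrow> complex" where
  "pairing \<xi> f = (\<Sum>\<^sub>\<infinity>\<alpha>. \<xi> \<alpha> * (mderiv \<alpha> f 0 / of_nat (mfact \<alpha>)))"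

definition ell_tilde ::
    "(complex ^ 'n::finite \<Rightarrow> complex) set set \<Rightarrow> (('n \<Rightarrow> nat) \<Rightarrow> complex) set" where
  "ell_tilde I = {\<xi> \<in> ell1. \<forall>f. germ f \<in> I \<longrightarrow> pairing \<xi> f = 0}"

definition ell ::
    "(complex ^ 'n::finite \<Rightarrow> complex) set set \<Rightarrow> (('n \<Rightarrow> nat) \<Rightarrow> complex) set" where
  "ell I = ell_tilde I - {\<lambda>_. 0}"

section \<open>Bergman space and the three quantities\<close>

definition sqnorm :: "(complex ^ 'n::finite) set \<Rightarrow> (complex ^ 'n \<Rightarrow> complex) \<Rightarrow> ennreal" where
  "sqnorm D f = (\<integral>\<^sup>+z\<in>D. ennreal ((norm (f z))\<^sup>2) \<partial>lborel)"

definition bergman_space :: "(complex ^ 'n::finite) set \<Rightarrow> (complex ^ 'n \<Rightarrow> complex) set" where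
  "bergman_space D = {f. holo_on f D \<and> sqnorm D f < \<infinity>}"

definition bergman_kernel ::
    "(('n::finite \<Rightarrow> nat) \<Rightarrow> complex) \<Rightarrow> (complex ^ 'n) set \<Rightarrow> ennreal" where
  "bergman_kernel \<xi> D =
     (SUP f\<in>{f \<in> bergman_space D. sqnorm D f \<le> 1}. ennreal ((norm (pairing \<xi> f))\<^sup>2))"

text \<open>
  Division on \<^typ>\<open>ennreal\<close> satisfies \<open>a / 0 = \<infinity>\<close> for \<open>a \<noteq> 0\<close> and \<open>0 / 0 = 0\<close>, which is the
  convention wanted for a vanishing kernel.
\<close>

definition B_full ::
    "(complex ^ 'n::finite \<Rightarrow> complex) \<Rightarrow> (complex ^ 'n \<Rightarrow> complex) set set \<Rightarrow>
     (complex ^ 'n) set \<Rightarrow> ennreal" where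
  "B_full F I D =
     (SUP \<xi>\<in>ell I. ennreal ((norm (pairing \<xi> F))\<^sup>2) / bergman_kernel \<xi> D)"

definition B_fin ::
    "(complex ^ 'n::finite \<Rightarrow> complex) \<Rightarrow> (complex ^ 'n \<Rightarrow> complex) set set \<Rightarrow>
     (complex ^ 'n) set \<Rightarrow> ennreal" where
  "B_fin F I D =
     (SUP \<xi>\<in>ell I \<inter> ell0. ennreal ((norm (pairing \<xi> F))\<^sup>2) / bergman_kernel \<xi> D)"

definition min_L2 ::
    "(complex ^ 'n::finite \<Rightarrow> complex) \<Rightarrow> (complex ^ 'n \<Rightarrow> complex) set set \<Rightarrow>
     (complex ^ 'n) set \<Rightarrow> ennreal" where
  "min_L2 F I D =
     (INF G\<in>{G \<in> bergman_space D. germ (\<lambda>z. G z - F z) \<in> I}. sqnorm D G)"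

lemma ennreal_quotient_convention:
  fixes a :: ennreal
  shows "a / 0 = (if a = 0 then 0 else \<infinity>)"
  by (simp add: divide_ennreal_def ennreal_mult_top)

end

theory Submission
  imports Defs "HOL-Complex_Analysis.Cauchy_Integral_Formula" "HOL-Computational_Algebra.Primes"
    "HOL-Library.Infinite_Set"
begin

text \<open>
  The inequalities from left to right are immediate. For the remaining one, fix \<open>k\<close>, minimise
  \<open>\<parallel>G\<parallel>\<^sup>2 + (k + 1) \<Sum> |c\<^sub>\<alpha>(G - F - v)|\<^sup>2\<close> (sum over \<open>|\<alpha>| \<le> k\<close>) over \<open>G\<close> in the Bergman space and \<open>v\<close> in
  the ideal, and let \<open>\<eta>\<close> be the conjugated limit residual of a minimising sequence. The first
  variations say that the finitely supported \<open>\<eta>\<close> annihilates the ideal, bound its kernel, and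
  evaluate it at \<open>F\<close>; together they bound the minimum by the supremum over finitely supported
  functionals. As \<open>k\<close> grows, near-minimisers form a Cauchy sequence by the parallelogram law, so they
  converge to some \<open>G\<close> for which \<open>G - F\<close> is a coefficientwise limit of germs in the ideal.

  Such limits stay in the ideal by division with remainder by a standard basis. Monomials are
  ordered by the integer \<open>\<Prod> p\<^sub>i ^ \<alpha>\<^sub>i\<close> for distinct primes \<open>p\<^sub>i\<close>; in the weighted norms
  \<open>\<Sum> |c\<^sub>\<alpha>| (\<Prod> p\<^sub>i ^ \<alpha>\<^sub>i) ^ (- s)\<close> the leading terms of the finitely many basis elements dominate for
  large \<open>s\<close>, so the formal division converges, and the remainder of a series depends on
  finitely many coefficients at a time.
\<close>

section \<open>Separately holomorphic functions and Cauchy estimates\<close>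

text \<open>Functionals see finitely many coefficients, membership in the ideal involves all of
  them; the factor \<open>k + 1\<close> bridges the two. As the minimum stays below the supremum,
  each fixed squared residual coefficient is O(1 / (k + 1)) and tends to 0. Attainment of the
  minimum is never asked for: only the residuals, the norms and the coefficients of \<open>G\<close>
  converge, and the first variations involve nothing else. With t = k + 1, g the limit of the
  squared norms and R that of the summed squared residuals, the minimum is g + t R = - t Re
  \<eta>(F), and t^2 |\<eta>(H)|^2 \<le> g on the unit ball. So (g + t R)^2 \<le> b g \<le> b (g + t
  R) for every finite bound b on the quotients. An order by integers has finite initial segments, so
  division is recursive and continuous in each coefficient; multiplicativity lets one estimate for a
  basis element serve all its monomial multiples. Multi-index derivatives are iterated one-variable
  derivatives. Hence functions are treated by slices, as continuous and holomorphic in each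
  variable, until the Taylor expansion returns full differentiability.\<close>

definition sep_holo :: "(complex ^ 'n::finite \<Rightarrow> complex) \<Rightarrow> (complex ^ 'n) set \<Rightarrow> bool" where
  "sep_holo f U \<longleftrightarrow> continuous_on U f \<and>
     (\<forall>z\<in>U. \<forall>i. (\<lambda>w. f (z + axis i w)) field_differentiable at 0)"

lemma axis_add: "axis i (v + w) = axis i v + (axis i w :: complex ^ 'n::finite)"
  by (simp add: axis_def vec_eq_iff)

lemma axis_zero [simp]: "axis i 0 = (0 :: complex ^ 'n::finite)"
  by (simp add: axis_def vec_eq_iff)

lemma axis_scale: "axis i (c * w) = c *s (axis i w :: complex ^ 'n::finite)"
  by (simp add: axis_def vec_eq_iff)

lemma bounded_linear_axis: "bounded_linear (\<lambda>w. axis i w :: complex ^ 'n::finite)"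
proof (rule bounded_linear_intro[where K=1])
  show "norm (axis i w :: complex ^ 'n) \<le> norm w * 1" for w :: complex
    by (simp add: norm_vec_def L2_set_def axis_def if_distrib[of norm] if_distrib[of "\<lambda>x. x\<^sup>2"] cong: if_cong)
qed (simp_all add: axis_def vec_eq_iff)

lemma continuous_on_axis [continuous_intros]: "continuous_on S (\<lambda>w. axis i w :: complex ^ 'n::finite)"
  by (rule linear_continuous_on[OF bounded_linear_axis])

lemma open_slice: "open U \<Longrightarrow> open {w. z + axis i w \<in> (U :: (complex ^ 'n::finite) set)}"
  using open_vimage[of U "\<lambda>w. z + axis i w"]
  by (simp add: vimage_def continuous_intros)

lemma sep_holo_subset: "sep_holo f U \<Longrightarrow> V \<subseteq> U \<Longrightarrow> sep_holo f V"
  unfolding sep_holo_def by (blast intro: continuous_on_subset)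

lemma sep_holo_open_cover:
  assumes "\<And>z. z \<in> U \<Longrightarrow> \<exists>V. open V \<and> z \<in> V \<and> sep_holo f V"
  shows "sep_holo f U"
proof -
  have "isCont f z" if "z \<in> U" for z
    using assms[OF that] by (auto simp: sep_holo_def continuous_on_eq_continuous_at)
  then have "continuous_on U f" by (simp add: continuous_at_imp_continuous_on)
  moreover have "(\<lambda>w. f (z + axis i w)) field_differentiable at 0" if "z \<in> U" for z i
    using assms[OF that] by (auto simp: sep_holo_def)
  ultimately show ?thesis by (simp add: sep_holo_def)
qed

lemma slice_differentiable:
  assumes "sep_holo f U" "z + axis i w \<in> U"
  shows "(\<lambda>w. f (z + axis i w)) field_differentiable at w"
proof -
  have "(\<lambda>v. f (z + axis i w + axis i v)) field_differentiable at 0"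
    using assms by (auto simp: sep_holo_def)
  then obtain D where "((\<lambda>v. f (z + axis i w + axis i v)) has_field_derivative D) (at 0)"
    by (auto simp: field_differentiable_def)
  then have "((\<lambda>v. f (z + axis i (v + w))) has_field_derivative D) (at 0)"
    by (simp add: axis_add algebra_simps)
  then have "((\<lambda>v. f (z + axis i v)) has_field_derivative D) (at w)"
    using DERIV_shift[of "\<lambda>v. f (z + axis i v)" D 0 w] by simp
  then show ?thesis by (auto simp: field_differentiable_def)
qed

lemma slice_holomorphic:
  assumes "sep_holo f U"
  shows "(\<lambda>w. f (z + axis i w)) holomorphic_on {w. z + axis i w \<in> U}"
  using slice_differentiable[OF assms]
  by (auto simp: holomorphic_on_def field_differentiable_at_within)

lemma holo_on_imp_sep_holo:
  assumes "holo_on f U"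
  shows "sep_holo f U"
proof -
  have c: "isCont f z" if "z \<in> U" for z
    using that assms has_derivative_continuous by (fastforce simp: holo_on_def)
  have "(\<lambda>w. f (z + axis i w)) field_differentiable at 0" if z: "z \<in> U" for z i
  proof -
    obtain f' where f': "(f has_derivative f') (at z)" "\<And>c v. f' (c *s v) = c * f' v"
      using assms z by (auto simp: holo_on_def)
    have g: "((\<lambda>w. z + axis i w) has_derivative (\<lambda>w. axis i w)) (at 0)"
      by (auto intro!: derivative_eq_intros bounded_linear.has_derivative[OF bounded_linear_axis])
    have "((\<lambda>w. f (z + axis i w)) has_derivative (\<lambda>w. f' (axis i w))) (at 0)"
      using diff_chain_at[OF g, of f f'] f' by (simp add: o_def)
    moreover have "(\<lambda>w. f' (axis i w)) = (*) (f' (axis i 1))"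
    proof
      show "f' (axis i w) = f' (axis i 1) * w" for w
        using f'(2)[of w "axis i 1"] axis_scale[of i w 1] by simp
    qed
    ultimately show ?thesis
      by (auto simp: field_differentiable_def has_field_derivative_def)
  qed
  with c show ?thesis
    by (simp add: sep_holo_def continuous_at_imp_continuous_on)
qed

lemma sep_holo_diff:
  assumes "sep_holo f U" "sep_holo g U"
  shows "sep_holo (\<lambda>z. f z - g z) U"
  using assms by (auto simp: sep_holo_def intro!: continuous_on_diff field_differentiable_diff)

text \<open>Restricted to a slice, locally uniform convergence is the one-variable notion, under
  which holomorphy passes to the limit; continuity in all variables passes to it as well.\<close>

lemma sep_holo_uniform_limit:
  assumes U: "open U" and f: "\<And>n. sep_holo (f n) U"
    and lim: "\<And>z. z \<in> U \<Longrightarrow> \<exists>V. open V \<and> z \<in> V \<and> uniform_limit V f g sequentially"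
  shows "sep_holo g U"
  unfolding sep_holo_def
proof (intro conjI ballI allI)
  show "continuous_on U g"
  proof (rule continuous_at_imp_continuous_on, rule ballI)
    fix z assume "z \<in> U"
    then obtain V where V: "open V" "z \<in> V" "uniform_limit V f g sequentially" using lim by blast
    have "uniform_limit (V \<inter> U) f g sequentially"
      by (rule uniform_limit_on_subset[OF V(3)]) auto
    moreover have "continuous_on (V \<inter> U) (f n)" for n
      using f[of n] by (auto simp: sep_holo_def intro: continuous_on_subset)
    ultimately have "continuous_on (V \<inter> U) g"
      using uniform_limit_theorem[OF always_eventually _ sequentially_bot, of "V \<inter> U" f g] by simp
    then show "isCont g z"
      using V U \<open>z \<in> U\<close> by (metis IntI continuous_on_eq_continuous_at open_Int)
  qed
next
  fix z i assume z: "z \<in> U"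
  let ?S = "{w. z + axis i w \<in> U}"
  have oS: "open ?S" using open_slice[OF U] .
  have "(\<lambda>w. g (z + axis i w)) holomorphic_on ?S"
  proof (rule holomorphic_uniform_sequence[OF oS, where f = "\<lambda>n w. f n (z + axis i w)"])
    show "(\<lambda>w. f n (z + axis i w)) holomorphic_on ?S" for n by (rule slice_holomorphic[OF f])
  next
    fix x assume x: "x \<in> ?S"
    then obtain V where V: "open V" "z + axis i x \<in> V" "uniform_limit V f g sequentially"
      using lim by blast
    have "open ({w. z + axis i w \<in> V} \<inter> ?S)" using open_slice[OF V(1)] oS by blast
    then obtain d where d: "d > 0" "cball x d \<subseteq> {w. z + axis i w \<in> V} \<inter> ?S"
      using V(2) x by (metis IntI mem_Collect_eq open_contains_cball)
    have "uniform_limit (cball x d) (\<lambda>n w. f n (z + axis i w)) (\<lambda>w. g (z + axis i w)) sequentially"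
      by (rule uniform_limit_compose'[OF V(3)]) (use d in auto)
    with d show "\<exists>d>0. cball x d \<subseteq> ?S \<and>
        uniform_limit (cball x d) (\<lambda>n w. f n (z + axis i w)) (\<lambda>w. g (z + axis i w)) sequentially"
      by blast
  qed
  then show "(\<lambda>w. g (z + axis i w)) field_differentiable at 0"
    using oS z by (auto simp: holomorphic_on_open field_differentiable_def)
qed

text \<open>Each variable has its own radius because the Cauchy estimates shrink the radii one
  variable at a time.\<close>

definition polydisc :: "('n::finite \<Rightarrow> real) \<Rightarrow> (complex ^ 'n) set" where
  "polydisc r = {z. \<forall>i. norm (z $ i) < r i}"

abbreviation cpolydisc :: "real \<Rightarrow> (complex ^ 'n::finite) set" where
  "cpolydisc r \<equiv> polydisc (\<lambda>_. r)"

lemma open_polydisc: "open (polydisc r :: (complex ^ 'n::finite) set)"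
proof -
  have "(polydisc r :: (complex ^ 'n) set) = (\<Inter>i. {z. norm (z $ i) < r i})" by (auto simp: polydisc_def)
  moreover have "open {z :: complex ^ 'n. norm (z $ i) < r i}" for i
    by (intro open_Collect_less continuous_intros)
  ultimately show ?thesis by auto
qed

section \<open>Iterated partial derivatives along slices\<close>

lemma deriv_shift: "deriv (\<lambda>v. f (w + v)) 0 = deriv f w"
  for f :: "complex \<Rightarrow> complex"
  using DERIV_shift[of f _ 0 w] by (simp add: deriv_def add.commute)

lemma pderiv_slice: "pderiv_at i f (z + axis i w) = deriv (\<lambda>w. f (z + axis i w)) w"
  unfolding pderiv_at_def deriv_shift[of "\<lambda>w. f (z + axis i w)" w, symmetric]
  by (simp add: axis_add algebra_simps)

lemma pderiv_funpow_slice: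
  "(pderiv_at i ^^ k) f (z + axis i w) = (deriv ^^ k) (\<lambda>w. f (z + axis i w)) w"
proof (induction k arbitrary: w)
  case (Suc k)
  have "(pderiv_at i ^^ Suc k) f (z + axis i w) = deriv (\<lambda>w. (pderiv_at i ^^ k) f (z + axis i w)) w"
    by (simp add: pderiv_slice)
  also have "\<dots> = (deriv ^^ Suc k) (\<lambda>w. f (z + axis i w)) w"
    by (simp add: Suc.IH)
  finally show ?case .
qed simp

lemma pderiv_funpow_eq:
  "(pderiv_at i ^^ k) f z = (deriv ^^ k) (\<lambda>w. f (z + axis i w)) 0"
  using pderiv_funpow_slice[where i = i and k = k and w = 0] by simp


text \<open>The second-order Taylor remainder, with the second derivative bounded by Cauchy's
  inequality on discs of radius \<open>R\<close>. The bound involves \<open>g\<close> only through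
  \<open>M\<close> and \<open>R\<close>; for slices of one function it is therefore uniform in the
  base point.\<close>

lemma difference_quotient_bound:
  fixes g :: "complex \<Rightarrow> complex"
  assumes S: "open S" "g holomorphic_on S" "cball 0 (2 * R) \<subseteq> S" and R: "R > 0"
    and M: "\<And>w. w \<in> cball 0 (2 * R) \<Longrightarrow> norm (g w) \<le> M"
    and h: "norm h \<le> R" "h \<noteq> 0"
  shows "norm ((g h - g 0) / h - deriv g 0) \<le> 2 * M / R ^ 2 * norm h"
proof -
  let ?T = "cball (0::complex) R"
  have T: "?T \<subseteq> S" using S(3) R by (auto simp: subset_iff)
  have "cmod (g h - (\<Sum>j\<le>1. (deriv ^^ j) g 0 * (h - 0) ^ j / fact j))
     \<le> 2 * M / R ^ 2 * cmod (h - 0) ^ Suc 1 / fact 1"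
  proof (rule complex_Taylor[of ?T 1 "\<lambda>j. (deriv ^^ j) g", simplified funpow.simps(1) id_apply])
    fix j x assume x: "x \<in> ?T"
    have "(deriv ^^ j) g holomorphic_on S" by (rule holomorphic_higher_deriv[OF S(2,1)])
    then show "((deriv ^^ j) g has_field_derivative (deriv ^^ Suc j) g x) (at x within ?T)"
      using holomorphic_derivI[OF _ S(1)] x T by (auto intro: has_field_derivative_at_within)
  next
    fix x assume x: "x \<in> ?T"
    have sub: "cball x R \<subseteq> cball 0 (2 * R)"
    proof
      fix y assume "y \<in> cball x R"
      then show "y \<in> cball 0 (2 * R)"
        using x norm_triangle_ineq[of "y - x" x] by (simp add: dist_norm norm_minus_commute)
    qed
    have "cmod ((deriv ^^ 2) g x) \<le> fact 2 * M / R ^ 2"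
    proof (rule Cauchy_inequality)
      show "g holomorphic_on ball x R"
        by (rule holomorphic_on_subset[OF S(2)]) (use sub S(3) ball_subset_cball in blast)
      show "continuous_on (cball x R) g"
        by (rule holomorphic_on_imp_continuous_on, rule holomorphic_on_subset[OF S(2)])
           (use sub S(3) in blast)
      show "cmod (g y) \<le> M" if "cmod (x - y) = R" for y
        by (rule M) (use sub that in \<open>auto simp: dist_norm subset_iff\<close>)
    qed (use R in auto)
    then show "cmod ((deriv ^^ Suc 1) g x) \<le> 2 * M / R ^ 2"
      by (simp add: numeral_2_eq_2)
  qed (use h R in auto)
  then have *: "norm (g h - g 0 - deriv g 0 * h) \<le> 2 * M / R ^ 2 * norm h ^ 2"
    by (simp add: numeral_2_eq_2 algebra_simps)
  have "(g h - g 0) / h - deriv g 0 = (g h - g 0 - deriv g 0 * h) / h"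
    using h by (simp add: field_simps)
  also have "norm \<dots> \<le> (2 * M / R ^ 2 * norm h ^ 2) / norm h"
    unfolding norm_divide using * by (intro divide_right_mono) auto
  also have "\<dots> = 2 * M / R ^ 2 * norm h"
    using h by (simp add: power2_eq_square)
  finally show ?thesis .
qed

lemma norm_axis_le: "norm (axis i w :: complex ^ 'n::finite) \<le> norm w"
  by (simp add: norm_vec_def L2_set_def axis_def if_distrib[of norm]
      if_distrib[of "\<lambda>x. x\<^sup>2"] cong: if_cong)

lemma sep_holo_translate:
  assumes "sep_holo f U"
  shows "sep_holo (\<lambda>z. f (a + z)) {z. a + z \<in> U}"
  unfolding sep_holo_def
proof (intro conjI ballI allI)
  show "continuous_on {z. a + z \<in> U} (\<lambda>z. f (a + z))"
    by (rule continuous_on_compose2[of U f]) (use assms in \<open>auto simp: sep_holo_def intro!: continuous_intros\<close>)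
qed (use assms in \<open>auto simp: sep_holo_def add.assoc[symmetric]\<close>)

lemma sep_holo_cmult: "sep_holo f U \<Longrightarrow> sep_holo (\<lambda>z. c * f z) U"
  by (auto simp: sep_holo_def intro!: continuous_intros
      intro: field_differentiable_mult field_differentiable_const)

text \<open>The point is that a derivative in one variable is continuous in all variables and
  holomorphic in the others. It is a locally uniform limit of difference quotients, each of which is
  separately holomorphic as a combination of translates of \<open>f\<close>.\<close>

lemma sep_holo_pderiv:
  assumes U: "open U" and f: "sep_holo f U"
  shows "sep_holo (pderiv_at i f) U"
proof (rule sep_holo_open_cover)
  fix z0 assume z0: "z0 \<in> U"
  obtain e where e: "e > 0" "cball z0 e \<subseteq> U" using U z0 by (meson open_contains_cball)
  \<comment> \<open>A point of \<open>ball z0 R\<close> moved along an axis by at most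
    \<open>2 * R\<close> stays in \<open>cball z0 e\<close>.\<close>
  define R where "R = e / 3"
  have R: "R > 0" using e by (simp add: R_def)
  have "compact (f ` cball z0 e)"
    using f e by (intro compact_continuous_image) (auto simp: sep_holo_def intro: continuous_on_subset)
  then obtain M where M: "\<And>z. z \<in> cball z0 e \<Longrightarrow> norm (f z) \<le> M"
    by (meson bounded_iff compact_imp_bounded imageI)
  have inb: "z + axis i w \<in> cball z0 e" if "z \<in> ball z0 R" "norm w \<le> 2 * R" for z w
  proof -
    have "norm (z - z0 + axis i w) \<le> norm (z - z0) + norm w"
      using norm_triangle_ineq[of "z - z0" "axis i w"] norm_axis_le[of i w] by linarith
    then show ?thesis using that by (simp add: dist_norm norm_minus_commute R_def algebra_simps)
  qed
  define h where "h n = complex_of_real (R / real (Suc n))" for n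
  have h: "h n \<noteq> 0" "norm (h n) \<le> R" for n
  proof -
    have "R / real (Suc n) \<le> R" "R / real (Suc n) > 0" using R by (simp_all add: field_simps)
    then show "h n \<noteq> 0" "norm (h n) \<le> R" by (simp_all add: h_def del: of_real_divide)
  qed
  define q where "q n z = inverse (h n) * (f (axis i (h n) + z) - f z)" for n z
  have "sep_holo (pderiv_at i f) (ball z0 R)"
  proof (rule sep_holo_uniform_limit)
    show "sep_holo (q n) (ball z0 R)" for n
      unfolding q_def
    proof (intro sep_holo_cmult sep_holo_diff)
      show "sep_holo (\<lambda>z. f (axis i (h n) + z)) (ball z0 R)"
      proof (rule sep_holo_subset[OF sep_holo_translate[OF f]], rule subsetI)
        fix z assume "z \<in> ball z0 R"
        then have "z + axis i (h n) \<in> cball z0 e" using h(2)[of n] R by (intro inb) auto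
        then show "z \<in> {z. axis i (h n) + z \<in> U}" using e by (auto simp: add.commute)
      qed
      show "sep_holo f (ball z0 R)"
        by (rule sep_holo_subset[OF f]) (use e R_def in auto)
    qed
  next
    fix z assume z: "z \<in> ball z0 R"
    have bound: "norm (q n z - pderiv_at i f z) \<le> 2 * M / R ^ 2 * norm (h n)" if z: "z \<in> ball z0 R" for n z
    proof -
      have "norm ((f (z + axis i (h n)) - f (z + axis i 0)) / h n - deriv (\<lambda>w. f (z + axis i w)) 0)
         \<le> 2 * M / R ^ 2 * norm (h n)"
      proof (rule difference_quotient_bound[OF open_slice[OF U] slice_holomorphic[OF f]])
        show "cball 0 (2 * R) \<subseteq> {w. z + axis i w \<in> U}"
          using inb[OF z] e by auto
        show "cmod (f (z + axis i w)) \<le> M" if "w \<in> cball 0 (2 * R)" for w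
          using M inb[OF z] that by auto
      qed (use R h in auto)
      then show ?thesis by (simp add: q_def pderiv_at_def field_simps)
    qed
    have "(\<lambda>n. 2 * M / R ^ 2 * norm (h n)) \<longlonglongrightarrow> 0"
    proof -
      have "(\<lambda>n. R / real (Suc n)) \<longlonglongrightarrow> 0"
        using LIMSEQ_Suc[OF lim_const_over_n[of R]] by simp
      then have "h \<longlonglongrightarrow> 0" unfolding h_def using tendsto_of_real[where 'a=complex] by fastforce
      then have "(\<lambda>n. norm (h n)) \<longlonglongrightarrow> 0" by (rule tendsto_norm_zero)
      then show ?thesis by (rule tendsto_mult_right_zero)
    qed
    then have "uniform_limit (ball z0 R) q (pderiv_at i f) sequentially"
      unfolding uniform_limit_iff
    proof (intro allI impI)
      fix e' :: real assume "e' > 0"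
      with \<open>(\<lambda>n. 2 * M / R ^ 2 * norm (h n)) \<longlonglongrightarrow> 0\<close>
      have "\<forall>\<^sub>F n in sequentially. 2 * M / R ^ 2 * norm (h n) < e'"
        by (rule order_tendstoD)
      then show "\<forall>\<^sub>F n in sequentially. \<forall>x\<in>ball z0 R. dist (q n x) (pderiv_at i f x) < e'"
      proof eventually_elim
        case (elim n)
        then show ?case unfolding dist_norm using le_less_trans[OF bound] by blast
      qed
    qed
    with z show "\<exists>V. open V \<and> z \<in> V \<and> uniform_limit V q (pderiv_at i f) sequentially"
      by blast
  qed simp
  then show "\<exists>V. open V \<and> z0 \<in> V \<and> sep_holo (pderiv_at i f) V"
    using R by (intro exI[of _ "ball z0 R"]) auto
qed

lemma sep_holo_pderiv_funpow: "open U \<Longrightarrow> sep_holo f U \<Longrightarrow> sep_holo ((pderiv_at i ^^ k) f) U"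
  by (induction k) (auto intro: sep_holo_pderiv)

abbreviation pderivs :: "('n::finite \<Rightarrow> nat) \<Rightarrow> 'n list \<Rightarrow> (complex ^ 'n \<Rightarrow> complex) \<Rightarrow> complex ^ 'n \<Rightarrow> complex" where
  "pderivs \<alpha> \<equiv> foldr (\<lambda>i g. (pderiv_at i ^^ \<alpha> i) g)"

lemma sep_holo_pderivs:
  "open U \<Longrightarrow> sep_holo f U \<Longrightarrow> sep_holo (pderivs \<alpha> is f) U"
  by (induction "is") (auto intro: sep_holo_pderiv_funpow)

text \<open>All derivatives in the variable \<open>i\<close> are estimated at once by Cauchy's
  inequality on a slice, at the cost of shrinking the \<open>i\<close>-th radius alone.\<close>

lemma pderiv_funpow_bound:
  assumes f: "sep_holo f U" and U: "open U" "polydisc r \<subseteq> U" and d: "0 < d" "d \<le> r i"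
    and M: "\<And>z. z \<in> polydisc r \<Longrightarrow> norm (f z) \<le> M" and z: "z \<in> polydisc (r(i := r i - d))"
  shows "norm ((pderiv_at i ^^ k) f z) \<le> fact k * M / d ^ k"
proof -
  have "norm (z $ j) < r j" for j
  proof -
    have "norm (z $ j) < (r(i := r i - d)) j" using z by (simp add: polydisc_def del: fun_upd_apply)
    then show ?thesis using d by (cases "j = i") auto
  qed
  then have zr: "z \<in> polydisc r" by (simp add: polydisc_def)
  obtain d' where d': "d < d'" "norm (z $ i) + d' < r i"
  proof -
    have "norm (z $ i) < (r(i := r i - d)) i" using z by (simp add: polydisc_def del: fun_upd_apply)
    then have "norm (z $ i) + d < r i" by simp
    then obtain e where "norm (z $ i) + d < e" "e < r i"
      using dense by blast
    then show ?thesis using that[of "e - norm (z $ i)"] by simp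
  qed
  have sub: "cball 0 d' \<subseteq> {w. z + axis i w \<in> polydisc r}"
  proof
    fix w :: complex assume "w \<in> cball 0 d'"
    then have "norm (z $ i + w) < r i" using norm_triangle_ineq[of "z $ i" w] d'(2) by simp
    then have "norm ((z + axis i w) $ j) < r j" for j
      using zr by (cases "j = i") (auto simp: polydisc_def axis_def)
    then show "w \<in> {w. z + axis i w \<in> polydisc r}"
      by (simp add: polydisc_def)
  qed
  have hol: "(\<lambda>w. f (z + axis i w)) holomorphic_on {w. z + axis i w \<in> polydisc r}"
    by (rule slice_holomorphic[OF sep_holo_subset[OF f U(2)]])
  have "norm ((deriv ^^ k) (\<lambda>w. f (z + axis i w)) 0) \<le> fact k * M / d' ^ k"
  proof (rule Cauchy_inequality)
    show "(\<lambda>w. f (z + axis i w)) holomorphic_on ball 0 d'"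
      by (rule holomorphic_on_subset[OF hol]) (use sub ball_subset_cball in blast)
    show "continuous_on (cball 0 d') (\<lambda>w. f (z + axis i w))"
      by (rule holomorphic_on_imp_continuous_on, rule holomorphic_on_subset[OF hol sub])
    show "cmod (f (z + axis i x)) \<le> M" if "cmod (0 - x) = d'" for x
      by (rule M) (use that sub in auto)
  qed (use d d' in auto)
  also have "\<dots> \<le> fact k * M / d ^ k"
  proof -
    have "M \<ge> 0" using M[OF zr] norm_ge_zero order_trans by blast
    then show ?thesis using d d' by (intro divide_left_mono) (auto intro!: power_mono mult_pos_pos)
  qed
  finally show ?thesis by (simp add: pderiv_funpow_eq)
qed

text \<open>Each radius is halved exactly once, since \<open>is\<close> is distinct and all
  derivatives in one variable are taken together. The one-variable constants therefore simply
  multiply, and the polydisc does not shrink with the order of differentiation.\<close>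

lemma pderivs_bound:
  assumes f: "sep_holo f (cpolydisc (2 * r))" and r: "r > 0" and "distinct is"
    and M: "\<And>z. z \<in> cpolydisc (2 * r) \<Longrightarrow> norm (f z) \<le> M"
    and z: "z \<in> polydisc (\<lambda>i. if i \<in> set is then r else 2 * r)"
  shows "norm (pderivs \<alpha> is f z)
    \<le> M * (\<Prod>i\<in>set is. fact (\<alpha> i) / r ^ \<alpha> i)"
  using assms(3) z
proof (induction "is" arbitrary: z)
  case Nil
  then show ?case using M by simp
next
  case (Cons i "is")
  let ?r = "\<lambda>j. if j \<in> set is then r else 2 * r"
  let ?B = "M * (\<Prod>i\<in>set is. fact (\<alpha> i) / r ^ \<alpha> i)"
  have "norm ((pderiv_at i ^^ \<alpha> i) (pderivs \<alpha> is f) z)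
      \<le> fact (\<alpha> i) * ?B / r ^ \<alpha> i"
  proof (rule pderiv_funpow_bound[where r = ?r])
    show "sep_holo (pderivs \<alpha> is f) (cpolydisc (2 * r))"
      by (rule sep_holo_pderivs[OF open_polydisc f])
    show "polydisc ?r \<subseteq> cpolydisc (2 * r)"
    proof
      fix x assume x: "x \<in> polydisc ?r"
      have "norm (x $ j) < 2 * r" for j
        using x r by (cases "j \<in> set is") (auto simp: polydisc_def dest!: spec[of _ j])
      then show "x \<in> cpolydisc (2 * r)" by (simp add: polydisc_def)
    qed
    show "z \<in> polydisc (?r(i := ?r i - r))"
      unfolding polydisc_def
    proof (intro CollectI allI)
      fix j
      have "cmod (z $ j) < (if j \<in> set (i # is) then r else 2 * r)"
        using Cons.prems(2) by (simp add: polydisc_def)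
      then show "cmod (z $ j) < (?r(i := ?r i - r)) j"
        using Cons.prems(1) by (auto split: if_splits)
    qed
    show "norm (pderivs \<alpha> is f z) \<le> ?B" if "z \<in> polydisc ?r" for z
      using Cons.IH[OF _ that] Cons.prems(1) by simp
    show "r \<le> ?r i" using Cons.prems(1) r by simp
  qed (rule r open_polydisc)+
  also have "fact (\<alpha> i) * ?B / r ^ \<alpha> i = M * (\<Prod>i\<in>set (i # is). fact (\<alpha> i) / r ^ \<alpha> i)"
    using Cons.prems(1) by simp
  finally show ?case by simp
qed

section \<open>Taylor coefficients at the origin and uniqueness\<close>

definition coef :: "(complex ^ 'n::finite \<Rightarrow> complex) \<Rightarrow> ('n \<Rightarrow> nat) \<Rightarrow> complex" where
  "coef f \<alpha> = mderiv \<alpha> f 0 / of_nat (mfact \<alpha>)"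

lemma index_list: "distinct (index_list :: 'n::finite list)" "set (index_list :: 'n list) = UNIV"
proof -
  have "\<exists>is :: 'n list. distinct is \<and> set is = UNIV"
    using finite_distinct_list[of "UNIV :: 'n set"] by auto
  from someI_ex[OF this] show "distinct (index_list :: 'n::finite list)" "set (index_list :: 'n list) = UNIV"
    by (simp_all add: index_list_def)
qed

lemma mfact_pos: "mfact \<alpha> > 0"
  by (simp add: mfact_def prod_pos)

lemma Cauchy_estimate:
  assumes f: "sep_holo f (cpolydisc (2 * r))" and r: "r > 0"
    and M: "\<And>z. z \<in> cpolydisc (2 * r) \<Longrightarrow> norm (f z) \<le> M"
  shows "norm (coef f \<alpha>) \<le> M / r ^ mdeg \<alpha>"
proof -
  have "norm (mderiv \<alpha> f 0) \<le> M * (\<Prod>i\<in>UNIV. fact (\<alpha> i) / r ^ \<alpha> i)"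
    using pderivs_bound[OF f r index_list(1) M, of 0 \<alpha>] r
    by (simp add: mderiv_def index_list(2) polydisc_def)
  also have "\<dots> = M * (real (mfact \<alpha>) / r ^ mdeg \<alpha>)"
    by (simp add: prod_dividef mfact_def mdeg_def power_sum of_nat_prod)
  finally show ?thesis
    using mfact_pos[of \<alpha>] by (simp add: coef_def norm_divide field_simps)
qed

lemma pderivs_diff:
  assumes U: "open U" and f: "sep_holo f U" and g: "sep_holo g U" and z: "z \<in> U"
  shows "pderivs \<alpha> is (\<lambda>z. f z - g z) z =
    pderivs \<alpha> is f z - pderivs \<alpha> is g z"
  using z
proof (induction "is" arbitrary: z)
  case (Cons i "is")
  let ?H = "\<lambda>f. pderivs \<alpha> is f"
  have *: "(pderiv_at i ^^ k) (?H (\<lambda>z. f z - g z)) z = (pderiv_at i ^^ k) (?H f) z - (pderiv_at i ^^ k) (?H g) z"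
    if "z \<in> U" for k z
    using that
  proof (induction k arbitrary: z)
    case (Suc k)
    let ?S = "{w. z + axis i w \<in> U}"
    have d: "(\<lambda>w. (pderiv_at i ^^ k) (?H f) (z + axis i w)) field_differentiable at 0"
      if "sep_holo f U" for f
      using sep_holo_pderiv_funpow[OF U sep_holo_pderivs[OF U that]] Suc.prems by (auto simp: sep_holo_def)
    have "\<forall>\<^sub>F w in nhds 0. w \<in> ?S"
      using open_slice[OF U, of z i] Suc.prems by (intro eventually_nhds_in_open) auto
    then have "\<forall>\<^sub>F w in nhds 0. (pderiv_at i ^^ k) (?H (\<lambda>z. f z - g z)) (z + axis i w) =
        (pderiv_at i ^^ k) (?H f) (z + axis i w) - (pderiv_at i ^^ k) (?H g) (z + axis i w)"
      by eventually_elim (use Suc.IH in auto)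
    then have "pderiv_at i ((pderiv_at i ^^ k) (?H (\<lambda>z. f z - g z))) z =
      deriv (\<lambda>w. (pderiv_at i ^^ k) (?H f) (z + axis i w) - (pderiv_at i ^^ k) (?H g) (z + axis i w)) 0"
      unfolding pderiv_at_def by (intro deriv_cong_ev) auto
    also have "\<dots> = pderiv_at i ((pderiv_at i ^^ k) (?H f)) z - pderiv_at i ((pderiv_at i ^^ k) (?H g)) z"
      using d[OF f] d[OF g] by (simp add: pderiv_at_def)
    finally show ?case by simp
  qed (use Cons.IH in auto)
  show ?case using *[OF Cons.prems] by simp
qed simp

lemma pderivs_cong:
  assumes "open U" "\<And>z. z \<in> U \<Longrightarrow> f z = g z" "z \<in> U"
  shows "pderivs \<alpha> is f z = pderivs \<alpha> is g z"
  using assms(3)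
proof (induction "is" arbitrary: z)
  case Nil
  then show ?case using assms by simp
next
  case (Cons i "is")
  let ?H = "\<lambda>f. pderivs \<alpha> is f"
  have *: "(pderiv_at i ^^ k) (?H f) z = (pderiv_at i ^^ k) (?H g) z" if "z \<in> U" for k z
    using that
  proof (induction k arbitrary: z)
    case (Suc k)
    have "\<forall>\<^sub>F w in nhds 0. w \<in> {w. z + axis i w \<in> U}"
      using open_slice[OF assms(1), of z i] Suc.prems by (intro eventually_nhds_in_open) auto
    then have "\<forall>\<^sub>F w in nhds 0. (pderiv_at i ^^ k) (?H f) (z + axis i w) =
        (pderiv_at i ^^ k) (?H g) (z + axis i w)"
      by eventually_elim (use Suc.IH in auto)
    then have "pderiv_at i ((pderiv_at i ^^ k) (?H f)) z = pderiv_at i ((pderiv_at i ^^ k) (?H g)) z"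
      unfolding pderiv_at_def by (intro deriv_cong_ev) auto
    then show ?case by simp
  qed (use Cons.IH in auto)
  show ?case using *[OF Cons.prems] by simp
qed

lemma coef_cong:
  assumes "\<forall>\<^sub>F z in nhds 0. f z = g z"
  shows "coef f = coef g"
proof -
  obtain U where U: "open U" "0 \<in> U" "\<And>z. z \<in> U \<Longrightarrow> f z = g z"
    using assms by (auto simp: eventually_nhds)
  show ?thesis
    by (rule ext) (simp only: coef_def mderiv_def pderivs_cong[OF U(1,3,2)])
qed

lemma coef_diff:
  assumes "open U" "sep_holo f U" "sep_holo g U" "0 \<in> U"
  shows "coef (\<lambda>z. f z - g z) \<alpha> = coef f \<alpha> - coef g \<alpha>"
  using pderivs_diff[OF assms] by (simp add: coef_def mderiv_def diff_divide_distrib)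

text \<open>The identity theorem, one variable at a time. \<open>T\<close> collects the variables
  already released: derivatives in the remaining ones vanish on the coordinate subspace of
  \<open>T\<close>. The head of the list is differentiated last, so the function under its
  derivatives has a zero one-variable Taylor series along that axis, vanishes there, and the head
  joins \<open>T\<close>.\<close>

lemma vanishing_slices:
  assumes f: "sep_holo f (cpolydisc r)" and r: "r > 0"
    and van: "\<And>\<alpha> z. z \<in> cpolydisc r \<Longrightarrow> (\<And>i. i \<notin> T \<Longrightarrow> z $ i = 0) \<Longrightarrow>
      pderivs \<alpha> is f z = 0"
    and z: "z \<in> cpolydisc r" "\<And>i. i \<notin> T \<union> set is \<Longrightarrow> z $ i = 0" and "distinct is"
  shows "f z = 0"
  using van z \<open>distinct is\<close>
proof (induction "is" arbitrary: T)
  case Nil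
  then show ?case by simp
next
  case (Cons i "is")
  show ?case
  proof (rule Cons.IH[where T = "insert i T"])
    fix \<alpha> z assume z: "z \<in> cpolydisc r" "\<And>j. j \<notin> insert i T \<Longrightarrow> z $ j = 0"
    let ?h = "pderivs \<alpha> is f"
    define z' where "z' = z - axis i (z $ i)"
    have z'nth: "z' $ j = (if j = i then 0 else z $ j)" for j by (simp add: z'_def axis_def)
    have sub: "ball 0 r \<subseteq> {w. z' + axis i w \<in> cpolydisc r}"
      using z(1) by (auto simp: polydisc_def z'nth axis_def)
    have z'z: "z' \<in> cpolydisc r" using z(1) r by (auto simp: polydisc_def z'nth)
    have hol: "(\<lambda>w. ?h (z' + axis i w)) holomorphic_on ball 0 r"
      by (rule holomorphic_on_subset[OF slice_holomorphic[OF sep_holo_pderivs[OF open_polydisc f]] sub])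
    have "(deriv ^^ k) (\<lambda>w. ?h (z' + axis i w)) 0 = 0" for k
    proof -
      \<comment> \<open>As \<open>i\<close> does not occur in \<open>is\<close>, changing
        \<open>\<alpha>\<close> at \<open>i\<close> prescribes only the order of the outermost
        derivative.\<close>
      have "foldr (\<lambda>j g. (pderiv_at j ^^ (\<alpha>(i := k)) j) g) (i # is) f z' = 0"
        by (rule Cons.prems(1)) (use z'z z in \<open>auto simp: z'nth\<close>)
      moreover have "foldr (\<lambda>j g. (pderiv_at j ^^ (\<alpha>(i := k)) j) g) is f = ?h"
        using Cons.prems(4) by (intro foldr_cong) auto
      ultimately show ?thesis by (simp add: pderiv_funpow_eq)
    qed
    then have "?h (z' + axis i (z $ i)) = 0"
      by (intro holomorphic_fun_eq_0_on_connected[OF hol open_ball connected_ball])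
         (use z(1) r in \<open>auto simp: polydisc_def\<close>)
    then show "?h z = 0" by (simp add: z'_def)
  qed (use Cons.prems in auto)
qed

lemma eq_0_if_coef_eq_0:
  fixes f :: "complex ^ 'n::finite \<Rightarrow> complex"
  assumes "sep_holo f (cpolydisc r)" "r > 0" "\<And>\<alpha>. coef f \<alpha> = 0" "z \<in> cpolydisc r"
  shows "f z = 0"
proof (rule vanishing_slices[OF assms(1,2), of "{}" index_list])
  fix \<alpha> and z :: "complex ^ 'n" assume "\<And>i. i \<notin> {} \<Longrightarrow> z $ i = 0"
  then have "z = 0" by (simp add: vec_eq_iff)
  then show "pderivs \<alpha> index_list f z = 0"
    using assms(3)[of \<alpha>] mfact_pos[of \<alpha>] by (simp add: coef_def mderiv_def)
qed (use assms index_list in auto)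

section \<open>Multivariate power series\<close>

definition mpow :: "complex ^ 'n::finite \<Rightarrow> ('n \<Rightarrow> nat) \<Rightarrow> complex" where
  "mpow z \<alpha> = (\<Prod>i\<in>UNIV. (z $ i) ^ \<alpha> i)"

definition pseries :: "(('n::finite \<Rightarrow> nat) \<Rightarrow> complex) \<Rightarrow> complex ^ 'n \<Rightarrow> complex" where
  "pseries c z = (\<Sum>\<^sub>\<infinity>\<alpha>. c \<alpha> * mpow z \<alpha>)"

text \<open>Absolute convergence on every smaller closed polydisc. The strict \<open>r < R\<close>
  leaves room to enlarge \<open>r\<close>, so termwise differentiation keeps the same
  \<open>R\<close>.\<close>

definition converges :: "real \<Rightarrow> (('n::finite \<Rightarrow> nat) \<Rightarrow> complex) \<Rightarrow> bool" where
  "converges R c \<longleftrightarrow> (\<forall>r. 0 < r \<and> r < R \<longrightarrow> (\<lambda>\<alpha>. norm (c \<alpha>) * r ^ mdeg \<alpha>) summable_on UNIV)"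

definition coef_pderiv :: "'n::finite \<Rightarrow> (('n \<Rightarrow> nat) \<Rightarrow> complex) \<Rightarrow> ('n \<Rightarrow> nat) \<Rightarrow> complex" where
  "coef_pderiv i c \<beta> = of_nat (\<beta> i + 1) * c (\<beta>(i := \<beta> i + 1))"

lemma norm_mpow_le:
  assumes "\<And>i. norm (z $ i) \<le> r"
  shows "norm (mpow z \<alpha>) \<le> r ^ mdeg \<alpha>"
  unfolding mpow_def mdeg_def power_sum prod_norm[symmetric] norm_power
  by (intro prod_mono conjI power_mono assms) auto

lemma mdeg_upd: "mdeg (\<alpha>(i := k)) + \<alpha> i = mdeg \<alpha> + k"
  by (simp add: mdeg_def sum.remove[of UNIV i])

lemma mpow_upd: "mpow z (\<alpha>(i := k)) = (z $ i) ^ k * (\<Prod>j\<in>UNIV - {i}. (z $ j) ^ \<alpha> j)"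
  by (simp add: mpow_def prod.remove[of UNIV i])

lemma polydisc_inside:
  assumes "z \<in> polydisc (\<lambda>_. R :: real)" "R > 0"
  obtains r where "0 < r" "r < R" "z \<in> cpolydisc r"
proof -
  define m where "m = Max (insert 0 (range (\<lambda>i. norm (z $ i))))"
  have "m < R" using assms by (auto simp: m_def polydisc_def)
  moreover have m: "m \<ge> 0" "norm (z $ i) \<le> m" for i
    unfolding m_def by (rule Max_ge; simp)+
  have "norm (z $ i) < (m + R) / 2" for i using m(2)[of i] \<open>m < R\<close> by simp
  moreover have "0 < (m + R) / 2" using m(1) assms(2) by simp
  ultimately show ?thesis
    using that[of "(m + R) / 2"] by (simp add: polydisc_def)
qed

lemma abs_summable_pseries:
  assumes "converges R c" "z \<in> cpolydisc R" "R > 0"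
  shows "(\<lambda>\<alpha>. norm (c \<alpha> * mpow z \<alpha>)) summable_on UNIV"
proof -
  obtain r where r: "0 < r" "r < R" "z \<in> cpolydisc r" using polydisc_inside assms by metis
  show ?thesis
  proof (rule summable_on_comparison_test)
    show "(\<lambda>\<alpha>. norm (c \<alpha>) * r ^ mdeg \<alpha>) summable_on UNIV" using assms r by (auto simp: converges_def)
    show "norm (c \<alpha> * mpow z \<alpha>) \<le> norm (c \<alpha>) * r ^ mdeg \<alpha>" for \<alpha>
      unfolding norm_mult using r by (intro mult_left_mono norm_mpow_le) (auto simp: polydisc_def less_imp_le)
  qed auto
qed

text \<open>A passage from unordered sums over multi-indices to series over the naturals, in which
  differentiation theorems are phrased; numbers that encode no multi-index get the term 0.\<close>

lemma enum_sums:
  fixes F :: "('n::finite \<Rightarrow> nat) \<Rightarrow> 'b::banach"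
  assumes "(\<lambda>\<alpha>. norm (F \<alpha>)) summable_on UNIV"
  shows "(\<lambda>n. if n \<in> range (to_nat :: ('n \<Rightarrow> nat) \<Rightarrow> nat) then F (from_nat n) else 0) sums (\<Sum>\<^sub>\<infinity>\<alpha>. F \<alpha>)"
proof -
  have "(F has_sum (\<Sum>\<^sub>\<infinity>\<alpha>. F \<alpha>)) UNIV"
    using abs_summable_summable[OF assms] by simp
  then have "((\<lambda>n. F (from_nat n)) has_sum (\<Sum>\<^sub>\<infinity>\<alpha>. F \<alpha>)) (range (to_nat :: ('n \<Rightarrow> nat) \<Rightarrow> nat))"
    by (subst has_sum_reindex) (auto simp: o_def)
  then have "((\<lambda>n. if n \<in> range (to_nat :: ('n \<Rightarrow> nat) \<Rightarrow> nat) then F (from_nat n) else 0) has_sum (\<Sum>\<^sub>\<infinity>\<alpha>. F \<alpha>)) UNIV"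
    by (subst (asm) has_sum_cong_neutral[where T = UNIV and
        g = "\<lambda>n. if n \<in> range (to_nat :: ('n \<Rightarrow> nat) \<Rightarrow> nat) then F (from_nat n) else 0"]) auto
  then show ?thesis by (rule has_sum_imp_sums)
qed

section \<open>Termwise differentiation of power series\<close>

lemma has_derivative_mpow:
  "((\<lambda>z. mpow z \<alpha>) has_derivative
    (\<lambda>h. \<Sum>i\<in>UNIV. h $ i * (of_nat (\<alpha> i) * mpow z (\<alpha>(i := \<alpha> i - 1))))) (at z)"
proof -
  have "((\<lambda>z. \<Prod>i\<in>UNIV. (z $ i) ^ \<alpha> i) has_derivative
    (\<lambda>h. \<Sum>i\<in>UNIV. (of_nat (\<alpha> i) * h $ i * (z $ i) ^ (\<alpha> i - 1)) * (\<Prod>j\<in>UNIV - {i}. (z $ j) ^ \<alpha> j))) (at z)"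
    by (rule has_derivative_prod)
       (auto intro!: derivative_eq_intros bounded_linear.has_derivative[OF bounded_linear_vec_nth])
  then show ?thesis
    unfolding mpow_upd by (simp add: mpow_def[abs_def] mult_ac)
qed

text \<open>The factor \<open>k\<close> produced by differentiation is absorbed by a larger radius,
  because \<open>k * q ^ k\<close> is bounded for 0 < q < 1.\<close>

lemma degree_weight_bound:
  assumes "0 < r" "r < R"
  obtains C where "C \<ge> 0" "\<And>k. real k * r ^ (k - 1) \<le> C * R ^ k"
proof -
  have "(\<lambda>n. real n * (r / R) ^ n) \<longlonglongrightarrow> 0"
    using powser_times_n_limit_0[of "r / R"] assms by simp
  then obtain B where B: "B > 0" "\<And>k. norm (real k * (r / R) ^ k) \<le> B"
    by (meson Bseq_def convergentI convergent_imp_Bseq)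
  have "real k * r ^ (k - 1) \<le> B / r * R ^ k" for k
  proof (cases k)
    case (Suc m)
    have "real k * (r / R) ^ k \<le> B" using B(2)[of k] by simp
    then have "real k * r ^ k \<le> B * R ^ k"
      using assms by (simp add: power_divide field_simps)
    then show ?thesis using Suc assms by (simp add: field_simps)
  qed (use B assms in simp)
  then show ?thesis using that[of "B / r"] B assms by simp
qed

lemma norm_pderiv_mpow_le:
  assumes "\<And>i. norm (z $ i) \<le> r" "r > 0"
  shows "norm (of_nat (\<alpha> i) * mpow z (\<alpha>(i := \<alpha> i - 1))) \<le> real (mdeg \<alpha>) * r ^ (mdeg \<alpha> - 1)"
proof (cases "\<alpha> i = 0")
  case True
  then show ?thesis using assms by simp
next
  case False
  then have d: "mdeg (\<alpha>(i := \<alpha> i - 1)) = mdeg \<alpha> - 1" using mdeg_upd[of \<alpha> i "\<alpha> i - 1"] by simp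
  have "\<alpha> i \<le> mdeg \<alpha>" by (simp add: mdeg_def member_le_sum)
  moreover have "norm (mpow z (\<alpha>(i := \<alpha> i - 1))) \<le> r ^ (mdeg \<alpha> - 1)"
    using norm_mpow_le[of z r "\<alpha>(i := \<alpha> i - 1)"] assms d by simp
  ultimately show ?thesis unfolding norm_mult by (intro mult_mono) auto
qed

lemma summable_degree_weight:
  fixes c :: "('n::finite \<Rightarrow> nat) \<Rightarrow> complex"
  assumes "converges R c" "0 < r" "r < R"
  shows "(\<lambda>\<alpha>. norm (c \<alpha>) * (real (mdeg \<alpha>) * r ^ (mdeg \<alpha> - 1))) summable_on UNIV"
proof -
  obtain s where s: "r < s" "s < R" using assms dense by blast
  obtain C where C: "C \<ge> 0" "\<And>k. real k * r ^ (k - 1) \<le> C * s ^ k"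
    using degree_weight_bound[OF assms(2) s(1)] by blast
  show ?thesis
  proof (rule summable_on_comparison_test)
    have "(\<lambda>\<alpha>. norm (c \<alpha>) * s ^ mdeg \<alpha>) summable_on UNIV"
      using assms s by (auto simp: converges_def)
    then show "(\<lambda>\<alpha>. C * (norm (c \<alpha>) * s ^ mdeg \<alpha>)) summable_on UNIV"
      by (rule summable_on_cmult_right)
    show "norm (c \<alpha>) * (real (mdeg \<alpha>) * r ^ (mdeg \<alpha> - 1)) \<le> C * (norm (c \<alpha>) * s ^ mdeg \<alpha>)" for \<alpha>
      using mult_left_mono[OF C(2)[of "mdeg \<alpha>"], of "norm (c \<alpha>)"] by (simp add: mult_ac)
  qed (use assms in auto)
qed

text \<open>A Weierstrass test for the differentiated series: on the convex polydisc of radius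
  \<open>r\<close> its terms in direction \<open>h\<close> are at most
  \<open>norm h * W \<alpha>\<close> with \<open>W\<close> summable. The tails are thus small
  uniformly in the point and relative to \<open>norm h\<close>.\<close>

lemma has_derivative_pseries:
  fixes c :: "('n::finite \<Rightarrow> nat) \<Rightarrow> complex"
  assumes c: "converges R c" and z: "z \<in> cpolydisc R" and R: "R > 0"
  shows "(pseries c has_derivative
    (\<lambda>h. \<Sum>\<^sub>\<infinity>\<alpha>. c \<alpha> * (\<Sum>i\<in>UNIV. h $ i * (of_nat (\<alpha> i) * mpow z (\<alpha>(i := \<alpha> i - 1)))))) (at z)"
    and "(\<lambda>\<alpha>. norm (c \<alpha> * (\<Sum>i\<in>UNIV. h $ i * (of_nat (\<alpha> i) * mpow z (\<alpha>(i := \<alpha> i - 1)))))) summable_on UNIV"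
proof -
  obtain r where r: "0 < r" "r < R" and zr: "z \<in> cpolydisc r" using polydisc_inside[OF z R] by metis
  define D where "D x h \<alpha> = c \<alpha> * (\<Sum>i\<in>UNIV. h $ i * (of_nat (\<alpha> i) * mpow x (\<alpha>(i := \<alpha> i - 1))))"
    for x h :: "complex ^ 'n" and \<alpha>
  define W where "W \<alpha> = real CARD('n) * (norm (c \<alpha>) * (real (mdeg \<alpha>) * r ^ (mdeg \<alpha> - 1)))" for \<alpha>
  have W: "W summable_on UNIV"
    unfolding W_def by (rule summable_on_cmult_right[OF summable_degree_weight[OF c r]])
  have W0: "W \<alpha> \<ge> 0" for \<alpha> using r by (simp add: W_def)
  have DW: "norm (D x h \<alpha>) \<le> norm h * W \<alpha>" if "x \<in> cpolydisc r" for x h \<alpha>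
  proof -
    have x: "norm (x $ i) \<le> r" for i using that by (auto simp: polydisc_def less_imp_le)
    have "norm (\<Sum>i\<in>UNIV. h $ i * (of_nat (\<alpha> i) * mpow x (\<alpha>(i := \<alpha> i - 1))))
        \<le> (\<Sum>i\<in>(UNIV :: 'n set). norm h * (real (mdeg \<alpha>) * r ^ (mdeg \<alpha> - 1)))"
      by (rule sum_norm_le, subst norm_mult, intro mult_mono norm_pderiv_mpow_le x r)
         (auto simp: Finite_Cartesian_Product.norm_nth_le)
    then have "norm (D x h \<alpha>) \<le> norm (c \<alpha>) * (\<Sum>i\<in>(UNIV :: 'n set). norm h * (real (mdeg \<alpha>) * r ^ (mdeg \<alpha> - 1)))"
      unfolding D_def norm_mult by (intro mult_left_mono) auto
    then show ?thesis by (simp add: W_def mult_ac)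
  qed
  have Dsum: "(\<lambda>\<alpha>. norm (D x h \<alpha>)) summable_on UNIV" if "x \<in> cpolydisc r" for x h
    by (rule summable_on_comparison_test[OF summable_on_cmult_right[OF W] DW[OF that]]) auto
  let ?e = "\<lambda>F n. if n \<in> range (to_nat :: ('n \<Rightarrow> nat) \<Rightarrow> nat) then F (from_nat n) else 0"
  let ?S = "polydisc (\<lambda>_ :: 'n. r)"
  have cs: "convex ?S"
    unfolding convex_alt
  proof (intro ballI allI impI)
    fix x y :: "complex ^ 'n" and u :: real assume *: "x \<in> ?S" "y \<in> ?S" "0 \<le> u \<and> u \<le> 1"
    have "norm (((1 - u) *\<^sub>R x + u *\<^sub>R y) $ i) < r" for i
    proof -
      have "x $ i \<in> ball 0 r" "y $ i \<in> ball 0 r" using * by (auto simp: polydisc_def)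
      then have "(1 - u) *\<^sub>R (x $ i) + u *\<^sub>R (y $ i) \<in> ball 0 r"
        using * convex_ball[of 0 r, unfolded convex_alt] by blast
      then show ?thesis by simp
    qed
    then show "(1 - u) *\<^sub>R x + u *\<^sub>R y \<in> ?S" by (simp add: polydisc_def)
  qed
  have psum: "(\<lambda>n. ?e (\<lambda>\<alpha>. c \<alpha> * mpow x \<alpha>) n) sums pseries c x" if "x \<in> ?S" for x
    unfolding pseries_def
    by (rule enum_sums, rule abs_summable_pseries[OF c _ R]) (use that r in \<open>auto simp: polydisc_def dest: less_trans\<close>)
  have "\<exists>g. \<forall>x\<in>?S. (\<lambda>n. ?e (\<lambda>\<alpha>. c \<alpha> * mpow x \<alpha>) n) sums g x \<and>
      (g has_derivative (\<lambda>h. \<Sum>\<^sub>\<infinity>\<alpha>. D x h \<alpha>)) (at x within ?S)"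
  proof (rule has_derivative_series[OF cs, where f' = "\<lambda>n x h. ?e (D x h) n"])
    fix n x assume "x \<in> ?S"
    show "((\<lambda>x. ?e (\<lambda>\<alpha>. c \<alpha> * mpow x \<alpha>) n) has_derivative (\<lambda>h. ?e (D x h) n)) (at x within ?S)"
      unfolding D_def
      by (cases "n \<in> range (to_nat :: ('n \<Rightarrow> nat) \<Rightarrow> nat)")
         (auto simp del: One_nat_def intro!: has_derivative_mult_right has_derivative_at_withinI[OF has_derivative_mpow])
  next
    fix e :: real assume e: "e > 0"
    have Ws: "?e W sums infsum W UNIV" using enum_sums[of W] W W0 by simp
    then have "(\<lambda>n. \<Sum>i<n. ?e W i) \<longlonglongrightarrow> infsum W UNIV" by (simp only: sums_def)
    then have "\<forall>\<^sub>F n in sequentially. dist (\<Sum>i<n. ?e W i) (infsum W UNIV) < e" using e by (rule tendstoD)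
    then show "\<forall>\<^sub>F n in sequentially. \<forall>x\<in>?S. \<forall>h. norm ((\<Sum>i<n. ?e (D x h) i) - (\<Sum>\<^sub>\<infinity>\<alpha>. D x h \<alpha>)) \<le> e * norm h"
    proof eventually_elim
      case (elim n)
      show ?case
      proof (intro ballI allI)
        fix x h assume x: "x \<in> ?S"
        have Ds: "?e (D x h) sums infsum (D x h) UNIV" by (rule enum_sums[OF Dsum[OF x]])
        have t1: "(\<lambda>i. ?e (D x h) (i + n)) sums (infsum (D x h) UNIV - (\<Sum>i<n. ?e (D x h) i))"
          by (rule sums_split_initial_segment[OF Ds])
        have t2: "(\<lambda>i. ?e W (i + n)) sums (infsum W UNIV - (\<Sum>i<n. ?e W i))"
          by (rule sums_split_initial_segment[OF Ws])
        have "norm (infsum (D x h) UNIV - (\<Sum>i<n. ?e (D x h) i)) \<le> norm h * (infsum W UNIV - (\<Sum>i<n. ?e W i))"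
          unfolding sums_unique[OF t1] sums_unique[OF t2]
          by (subst suminf_mult[symmetric])
             (use t2 DW[OF x] in \<open>auto simp: sums_iff intro!: norm_suminf_le summable_mult\<close>)
        also have "\<dots> \<le> norm h * e"
          using elim by (intro mult_left_mono) (auto simp: dist_real_def)
        finally show "norm ((\<Sum>i<n. ?e (D x h) i) - (\<Sum>\<^sub>\<infinity>\<alpha>. D x h \<alpha>)) \<le> e * norm h"
          by (simp add: norm_minus_commute mult.commute)
      qed
    qed
  qed (use zr psum in auto)
  then obtain g where g: "\<And>x. x \<in> ?S \<Longrightarrow> (\<lambda>n. ?e (\<lambda>\<alpha>. c \<alpha> * mpow x \<alpha>) n) sums g x"
      "\<And>x. x \<in> ?S \<Longrightarrow> (g has_derivative (\<lambda>h. \<Sum>\<^sub>\<infinity>\<alpha>. D x h \<alpha>)) (at x within ?S)" by blast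
  have gp: "g x = pseries c x" if "x \<in> ?S" for x using sums_unique2[OF g(1)[OF that] psum[OF that]] .
  have "(g has_derivative (\<lambda>h. \<Sum>\<^sub>\<infinity>\<alpha>. D z h \<alpha>)) (at z)"
    using g(2)[OF zr] at_within_open[OF zr open_polydisc] by simp
  then have "(pseries c has_derivative (\<lambda>h. \<Sum>\<^sub>\<infinity>\<alpha>. D z h \<alpha>)) (at z)"
    by (rule has_derivative_transform_within_open[OF _ open_polydisc zr gp])
  then show "(pseries c has_derivative (\<lambda>h. \<Sum>\<^sub>\<infinity>\<alpha>. c \<alpha> * (\<Sum>i\<in>UNIV. h $ i * (of_nat (\<alpha> i) * mpow z (\<alpha>(i := \<alpha> i - 1)))))) (at z)"
    by (simp add: D_def)
  show "(\<lambda>\<alpha>. norm (c \<alpha> * (\<Sum>i\<in>UNIV. h $ i * (of_nat (\<alpha> i) * mpow z (\<alpha>(i := \<alpha> i - 1)))))) summable_on UNIV"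
    using Dsum[OF zr, of h] by (simp add: D_def)
qed


lemma holo_on_pseries:
  assumes c: "converges R c" and R: "R > 0"
  shows "holo_on (pseries c) (cpolydisc R)"
  unfolding holo_on_def
proof (intro ballI exI conjI allI)
  fix z :: "complex ^ 'a" assume z: "z \<in> cpolydisc R"
  let ?D = "\<lambda>h. \<Sum>\<^sub>\<infinity>\<alpha>. c \<alpha> * (\<Sum>i\<in>UNIV. h $ i * (of_nat (\<alpha> i) * mpow z (\<alpha>(i := \<alpha> i - 1))))"
  show "(pseries c has_derivative ?D) (at z)" by (rule has_derivative_pseries(1)[OF c z R])
  show "?D (a *s h) = a * ?D h" for a h
    by (subst infsum_cmult_right'[symmetric]) (simp add: sum_distrib_left mult_ac)
qed

lemma bij_betw_raise: "bij_betw (\<lambda>\<beta>. \<beta>(i := Suc (\<beta> i))) UNIV {\<alpha> :: 'n \<Rightarrow> nat. \<alpha> i \<noteq> 0}"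
  by (rule bij_betwI[where g = "\<lambda>\<alpha>. \<alpha>(i := \<alpha> i - 1)"]) auto

lemma converges_coef_pderiv:
  assumes "converges R c"
  shows "converges R (coef_pderiv i c)"
  unfolding converges_def
proof (intro allI impI)
  fix r assume r: "0 < r \<and> r < R"
  let ?F = "\<lambda>\<alpha>. norm (c \<alpha>) * (real (mdeg \<alpha>) * r ^ (mdeg \<alpha> - 1))"
  have "?F summable_on UNIV" using summable_degree_weight[OF assms] r by blast
  then have "?F summable_on {\<alpha>. \<alpha> i \<noteq> 0}" by (rule summable_on_subset_banach) auto
  then have "(\<lambda>\<beta>. ?F (\<beta>(i := Suc (\<beta> i)))) summable_on UNIV"
    by (rule summable_on_reindex_bij_betw[OF bij_betw_raise, THEN iffD2])
  then show "(\<lambda>\<beta>. norm (coef_pderiv i c \<beta>) * r ^ mdeg \<beta>) summable_on UNIV"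
  proof (rule summable_on_comparison_test)
    fix \<beta>
    have d: "mdeg (\<beta>(i := Suc (\<beta> i))) = Suc (mdeg \<beta>)" using mdeg_upd[of \<beta> i "Suc (\<beta> i)"] by simp
    have "\<beta> i \<le> mdeg \<beta>" by (simp add: mdeg_def member_le_sum)
    then have "real (\<beta> i + 1) * (norm (c (\<beta>(i := Suc (\<beta> i)))) * r ^ mdeg \<beta>)
        \<le> real (Suc (mdeg \<beta>)) * (norm (c (\<beta>(i := Suc (\<beta> i)))) * r ^ mdeg \<beta>)"
      using r by (intro mult_right_mono) auto
    then show "norm (coef_pderiv i c \<beta>) * r ^ mdeg \<beta> \<le> ?F (\<beta>(i := Suc (\<beta> i)))"
      unfolding d by (simp add: coef_pderiv_def norm_mult mult_ac del: of_nat_add of_nat_Suc)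
  qed (use r in auto)
qed

lemma pderiv_pseries:
  fixes c :: "('n::finite \<Rightarrow> nat) \<Rightarrow> complex"
  assumes c: "converges R c" and z: "z \<in> cpolydisc R" and R: "R > 0"
  shows "pderiv_at i (pseries c) z = pseries (coef_pderiv i c) z"
proof -
  let ?D = "\<lambda>h :: complex ^ 'n. \<Sum>\<^sub>\<infinity>\<alpha>. c \<alpha> * (\<Sum>i\<in>UNIV. h $ i * (of_nat (\<alpha> i) * mpow z (\<alpha>(i := \<alpha> i - 1))))"
  have ax: "(\<Sum>j\<in>UNIV. axis i w $ j * X j) = w * X i" for w and X :: "'n \<Rightarrow> complex"
    by (simp add: axis_def if_distrib[of "\<lambda>x. x * _"] cong: if_cong)
  have lin: "?D (axis i w) = ?D (axis i 1) * w" for w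
    unfolding ax by (subst infsum_cmult_left'[symmetric]) (simp add: mult_ac)
  have g: "((\<lambda>w. z + axis i w) has_derivative (\<lambda>w. axis i w)) (at 0)"
    by (auto intro!: derivative_eq_intros bounded_linear.has_derivative[OF bounded_linear_axis])
  have "((\<lambda>w. pseries c (z + axis i w)) has_derivative (\<lambda>w. ?D (axis i w))) (at 0)"
    using diff_chain_at[OF g, of "pseries c" ?D] has_derivative_pseries(1)[OF c z R] by (simp add: o_def)
  moreover have "(\<lambda>w. ?D (axis i w)) = (*) (?D (axis i 1))"
    by (rule ext) (rule lin)
  ultimately have "((\<lambda>w. pseries c (z + axis i w)) has_field_derivative ?D (axis i 1)) (at 0)"
    by (simp only: has_field_derivative_def)
  then have "pderiv_at i (pseries c) z = ?D (axis i 1)"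
    unfolding pderiv_at_def by (rule DERIV_imp_deriv)
  also have "\<dots> = (\<Sum>\<^sub>\<infinity>\<alpha>. c \<alpha> * (of_nat (\<alpha> i) * mpow z (\<alpha>(i := \<alpha> i - 1))))"
    by (simp only: ax mult_1_left)
  \<comment> \<open>Exponents with \<open>\<alpha> i = 0\<close> contribute nothing; without them
    the index set is the range of the map that raises the \<open>i\<close>-th exponent.\<close>
  also have "\<dots> = (\<Sum>\<^sub>\<infinity>\<alpha>\<in>{\<alpha>. \<alpha> i \<noteq> 0}. c \<alpha> * (of_nat (\<alpha> i) * mpow z (\<alpha>(i := \<alpha> i - 1))))"
  proof (rule infsum_cong_neutral)
    fix \<alpha> :: "'n \<Rightarrow> nat" assume "\<alpha> \<in> UNIV - {\<alpha>. \<alpha> i \<noteq> 0}"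
    then have "\<alpha> i = 0" by simp
    then show "c \<alpha> * (of_nat (\<alpha> i) * mpow z (\<alpha>(i := \<alpha> i - 1))) = 0"
      by (simp only: of_nat_0 mult_zero_left mult_zero_right)
  qed simp_all
  also have "\<dots> = (\<Sum>\<^sub>\<infinity>\<beta>. c (\<beta>(i := Suc (\<beta> i))) * (of_nat (Suc (\<beta> i)) * mpow z \<beta>))"
    by (subst infsum_reindex_bij_betw[OF bij_betw_raise[of i], symmetric])
       (simp only: fun_upd_same fun_upd_upd diff_Suc_1 fun_upd_triv)
  also have "\<dots> = pseries (coef_pderiv i c) z"
    by (simp add: pseries_def coef_pderiv_def mult_ac)
  finally show ?thesis .
qed

lemma pderiv_cong:
  assumes "open U" "\<And>z. z \<in> U \<Longrightarrow> f z = g z" "z \<in> U"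
  shows "pderiv_at i f z = pderiv_at i g z"
  using pderivs_cong[of U f g z "\<lambda>_. 1" "[i]", OF assms] by simp

lemma pderiv_funpow_cong:
  assumes "open U" "\<And>z. z \<in> U \<Longrightarrow> f z = g z" "z \<in> U"
  shows "(pderiv_at i ^^ k) f z = (pderiv_at i ^^ k) g z"
  using pderivs_cong[of U f g z "\<lambda>_. k" "[i]", OF assms] by simp

lemma pderiv_funpow_pseries:
  fixes c :: "('n::finite \<Rightarrow> nat) \<Rightarrow> complex"
  assumes c: "converges R c" and R: "R > 0"
  shows "converges R ((coef_pderiv i ^^ k) c) \<and> (\<forall>z\<in>cpolydisc R. (pderiv_at i ^^ k) (pseries c) z = pseries ((coef_pderiv i ^^ k) c) z)"
proof (induction k)
  case (Suc k)
  then have "pderiv_at i ((pderiv_at i ^^ k) (pseries c)) z = pseries (coef_pderiv i ((coef_pderiv i ^^ k) c)) z"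
    if "z \<in> cpolydisc R" for z
    using pderiv_cong[OF open_polydisc, of "\<lambda>_. R" "(pderiv_at i ^^ k) (pseries c)" "pseries ((coef_pderiv i ^^ k) c)" z i]
      pderiv_pseries[of R "(coef_pderiv i ^^ k) c" z i] R that by simp
  then show ?case using Suc converges_coef_pderiv[of R "(coef_pderiv i ^^ k) c" i] by simp
qed (use c in simp)

lemma pderivs_pseries:
  fixes c :: "('n::finite \<Rightarrow> nat) \<Rightarrow> complex"
  assumes c: "converges R c" and R: "R > 0"
  shows "converges R (foldr (\<lambda>i c. (coef_pderiv i ^^ \<alpha> i) c) is c) \<and> (\<forall>z\<in>cpolydisc R.
    pderivs \<alpha> is (pseries c) z = pseries (foldr (\<lambda>i c. (coef_pderiv i ^^ \<alpha> i) c) is c) z)"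
proof (induction "is")
  case (Cons i "is")
  let ?c = "foldr (\<lambda>i c. (coef_pderiv i ^^ \<alpha> i) c) is c"
  have "(pderiv_at i ^^ \<alpha> i) (pderivs \<alpha> is (pseries c)) z
      = (pderiv_at i ^^ \<alpha> i) (pseries ?c) z" if "z \<in> cpolydisc R" for z
    by (rule pderiv_funpow_cong[OF open_polydisc]) (use Cons.IH that in auto)
  then show ?case using pderiv_funpow_pseries[where R = R and c = ?c and i = i and k = "\<alpha> i"] Cons.IH R by simp
qed (use c in simp)

section \<open>Coefficients of a power series and the Taylor expansion\<close>

lemma coef_pderiv_funpow: "fact (\<beta> i) * (coef_pderiv i ^^ k) c \<beta> = fact (\<beta> i + k) * c (\<beta>(i := \<beta> i + k))"
proof (induction k arbitrary: \<beta>)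
  case (Suc k)
  have "fact (\<beta> i) * (coef_pderiv i ^^ Suc k) c \<beta> = fact (Suc (\<beta> i)) * (coef_pderiv i ^^ k) c (\<beta>(i := Suc (\<beta> i)))"
    by (simp add: coef_pderiv_def)
  also have "\<dots> = fact (\<beta> i + Suc k) * c (\<beta>(i := \<beta> i + Suc k))"
    using Suc[of "\<beta>(i := Suc (\<beta> i))"] by (simp del: fact_Suc fun_upd_apply add: fun_upd_same)
  finally show ?case .
qed simp

text \<open>Since \<open>\<beta>\<close> vanishes at the variables being differentiated, each
  quotient (\<beta> i + \<alpha> i)! / (\<beta> i)! collapses to (\<alpha> i)!.\<close>

lemma foldr_coef_pderiv:
  assumes "distinct is" "\<And>i. i \<in> set is \<Longrightarrow> \<beta> i = 0"
  shows "foldr (\<lambda>i c. (coef_pderiv i ^^ \<alpha> i) c) is c \<beta> =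
    (\<Prod>i\<in>set is. fact (\<alpha> i)) * c (\<lambda>j. if j \<in> set is then \<alpha> j else \<beta> j)"
  using assms
proof (induction "is" arbitrary: \<beta>)
  case (Cons i "is")
  let ?c = "foldr (\<lambda>i c. (coef_pderiv i ^^ \<alpha> i) c) is c"
  have "(coef_pderiv i ^^ \<alpha> i) ?c \<beta> = fact (\<alpha> i) * ?c (\<beta>(i := \<alpha> i))"
    using coef_pderiv_funpow[of \<beta> i "\<alpha> i" ?c] Cons.prems by simp
  also have "?c (\<beta>(i := \<alpha> i)) = (\<Prod>i\<in>set is. fact (\<alpha> i)) *
      c (\<lambda>j. if j \<in> set is then \<alpha> j else (\<beta>(i := \<alpha> i)) j)"
    by (rule Cons.IH) (use Cons.prems in auto)
  also have "(\<lambda>j. if j \<in> set is then \<alpha> j else (\<beta>(i := \<alpha> i)) j) = (\<lambda>j. if j \<in> set (i # is) then \<alpha> j else \<beta> j)"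
    by auto
  finally show ?case using Cons.prems by (simp add: mult_ac)
qed simp

lemma pseries_0: "pseries c 0 = c (\<lambda>_. 0)"
proof -
  have "mpow 0 \<alpha> = (if \<alpha> = (\<lambda>_. 0) then 1 else 0)" for \<alpha> :: "'a \<Rightarrow> nat"
    by (auto simp: mpow_def power_0_left fun_eq_iff)
  then have "pseries c 0 = (\<Sum>\<^sub>\<infinity>\<alpha>\<in>{\<lambda>_. 0}. c \<alpha>)"
    unfolding pseries_def by (intro infsum_cong_neutral) auto
  then show ?thesis by simp
qed

lemma coef_pseries:
  assumes "converges R c" "R > 0"
  shows "coef (pseries c) = c"
proof
  fix \<alpha>
  have 0: "0 \<in> polydisc (\<lambda>_ :: 'a. R)" using assms by (simp add: polydisc_def)
  have "mderiv \<alpha> (pseries c) 0 = foldr (\<lambda>i c. (coef_pderiv i ^^ \<alpha> i) c) index_list c (\<lambda>_. 0)"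
    using pderivs_pseries[OF assms, of \<alpha> index_list] 0 by (simp add: mderiv_def pseries_0)
  also have "\<dots> = of_nat (mfact \<alpha>) * c \<alpha>"
    by (subst foldr_coef_pderiv) (simp_all add: index_list mfact_def of_nat_prod)
  finally show "coef (pseries c) \<alpha> = c \<alpha>" using mfact_pos[of \<alpha>] by (simp add: coef_def)
qed

text \<open>A finite set of multi-indices lies in a cube, and over a cube the sum factors into
  one-variable geometric sums.\<close>

lemma summable_geometric_multi:
  fixes q :: real
  assumes "0 < q" "q < 1"
  shows "(\<lambda>\<alpha> :: 'n::finite \<Rightarrow> nat. q ^ mdeg \<alpha>) summable_on UNIV"
proof (rule nonneg_bdd_above_summable_on)
  show "bdd_above (sum (\<lambda>\<alpha> :: 'n \<Rightarrow> nat. q ^ mdeg \<alpha>) ` {F. F \<subseteq> UNIV \<and> finite F})"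
  proof (rule bdd_aboveI2)
    fix F :: "('n \<Rightarrow> nat) set" assume "F \<in> {F. F \<subseteq> UNIV \<and> finite F}"
    then have F: "finite F" by simp
    define m where "m = Suc (\<Sum>\<alpha>\<in>F. mdeg \<alpha>)"
    have "\<alpha> i < m" if "\<alpha> \<in> F" for \<alpha> i
    proof -
      have "\<alpha> i \<le> mdeg \<alpha>" by (simp add: mdeg_def member_le_sum)
      also have "\<dots> \<le> (\<Sum>\<alpha>\<in>F. mdeg \<alpha>)" using F that by (simp add: member_le_sum)
      finally show ?thesis by (simp add: m_def)
    qed
    then have "F \<subseteq> PiE UNIV (\<lambda>_. {..<m})" by auto
    then have "(\<Sum>\<alpha>\<in>F. q ^ mdeg \<alpha>) \<le> (\<Sum>\<alpha>\<in>PiE (UNIV :: 'n set) (\<lambda>_. {..<m}). q ^ mdeg \<alpha>)"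
      using assms by (intro sum_mono2 finite_PiE) auto
    also have "\<dots> = (\<Prod>i\<in>(UNIV :: 'n set). \<Sum>k<m. q ^ k)"
      by (subst prod_sum_PiE) (auto simp: mdeg_def power_sum)
    also have "\<dots> \<le> (\<Prod>i\<in>(UNIV :: 'n set). 1 / (1 - q))"
    proof (intro prod_mono conjI sum_nonneg)
      show "(\<Sum>k<m. q ^ k) \<le> 1 / (1 - q)"
        using assms by (simp add: sum_gp_strict divide_right_mono)
    qed (use assms in auto)
    finally show "(\<Sum>\<alpha>\<in>F. q ^ mdeg \<alpha>) \<le> (\<Prod>i\<in>(UNIV :: 'n set). 1 / (1 - q))" .
  qed
qed (use assms in auto)

lemma converges_coef:
  assumes f: "sep_holo f (cpolydisc (2 * r))" and r: "r > 0"
    and M: "\<And>z. z \<in> cpolydisc (2 * r) \<Longrightarrow> norm (f z) \<le> M"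
  shows "converges r (coef f)"
  unfolding converges_def
proof (intro allI impI)
  fix s assume s: "0 < s \<and> s < r"
  show "(\<lambda>\<alpha>. norm (coef f \<alpha>) * s ^ mdeg \<alpha>) summable_on UNIV"
  proof (rule summable_on_comparison_test)
    show "(\<lambda>\<alpha>. M * (s / r) ^ mdeg \<alpha>) summable_on UNIV"
      by (intro summable_on_cmult_right summable_geometric_multi) (use s r in auto)
    show "norm (coef f \<alpha>) * s ^ mdeg \<alpha> \<le> M * (s / r) ^ mdeg \<alpha>" for \<alpha>
      using mult_right_mono[OF Cauchy_estimate[OF f r M], of "s ^ mdeg \<alpha>" \<alpha>] s
      by (simp add: power_divide)
  qed (use s in auto)
qed

text \<open>Cauchy's estimates make the Taylor series converge; its sum is holomorphic with the same
  coefficients as \<open>f\<close>, so uniqueness applies to the difference. No iterated Cauchy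
  integral enters.\<close>

theorem taylor_expansion:
  assumes f: "sep_holo f (cpolydisc (2 * r))" and r: "r > 0"
    and M: "\<And>z. z \<in> cpolydisc (2 * r) \<Longrightarrow> norm (f z) \<le> M"
    and z: "z \<in> cpolydisc r"
  shows "f z = pseries (coef f) z"
proof -
  have c: "converges r (coef f)" by (rule converges_coef[OF f r M])
  have "cpolydisc r \<subseteq> cpolydisc (2 * r)" using r by (auto simp: polydisc_def intro: less_trans)
  then have f': "sep_holo f (cpolydisc r)" by (rule sep_holo_subset[OF f])
  have g: "sep_holo (pseries (coef f)) (cpolydisc r)"
    by (rule holo_on_imp_sep_holo[OF holo_on_pseries[OF c r]])
  have "f z - pseries (coef f) z = 0"
  proof (rule eq_0_if_coef_eq_0[OF sep_holo_diff[OF f' g] r _ z])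
    show "coef (\<lambda>z. f z - pseries (coef f) z) \<alpha> = 0" for \<alpha>
      by (subst coef_diff[OF open_polydisc f' g]) (use r in \<open>auto simp: polydisc_def coef_pseries[OF c]\<close>)
  qed
  then show ?thesis by simp
qed

section \<open>Local expansions and joint differentiability\<close>

lemma polydisc_subset_ball: "cpolydisc r \<subseteq> cball (0 :: complex ^ 'n::finite) (real CARD('n) * r)"
proof
  fix z :: "complex ^ 'n" assume "z \<in> cpolydisc r"
  then have "(\<Sum>i\<in>UNIV. norm (z $ i)) \<le> (\<Sum>i\<in>(UNIV :: 'n set). r)"
    by (intro sum_mono) (auto simp: polydisc_def less_imp_le)
  moreover have "norm z \<le> (\<Sum>i\<in>UNIV. norm (z $ i))"
    unfolding norm_vec_def by (rule L2_set_le_sum) auto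
  ultimately show "z \<in> cball 0 (real CARD('n) * r)" by simp
qed

text \<open>The compact set in between supplies the bound on a continuous function that Cauchy's
  estimate asks for.\<close>

lemma bounded_polydisc_subset:
  fixes U :: "(complex ^ 'n::finite) set"
  assumes "open U" "0 \<in> U"
  obtains r K where "r > 0" "cpolydisc (2 * r) \<subseteq> K" "compact K" "K \<subseteq> U"
proof -
  obtain e where e: "e > 0" "cball 0 e \<subseteq> U" using assms by (meson open_contains_cball)
  define r where "r = e / (2 * real CARD('n))"
  have "real CARD('n) * (2 * r) = e" by (simp add: r_def)
  then have "cpolydisc (2 * r) \<subseteq> cball (0 :: complex ^ 'n) e" using polydisc_subset_ball[of "2 * r", where 'n = 'n] by simp
  moreover have "r > 0" using e by (simp add: r_def)
  ultimately show ?thesis using that e(2) compact_cball by blast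
qed

lemma sep_holo_local:
  assumes "sep_holo f U" "open U" "0 \<in> U"
  obtains r M where "r > 0" "cpolydisc (2 * r) \<subseteq> U" "sep_holo f (cpolydisc (2 * r))"
    "\<And>z. z \<in> cpolydisc (2 * r) \<Longrightarrow> norm (f z) \<le> M"
proof -
  obtain r K where rK: "r > 0" "cpolydisc (2 * r) \<subseteq> K" "compact K" "K \<subseteq> U"
    using bounded_polydisc_subset assms by metis
  have "compact (f ` K)"
    using assms rK by (intro compact_continuous_image) (auto simp: sep_holo_def intro: continuous_on_subset)
  then obtain M where M: "\<And>z. z \<in> K \<Longrightarrow> norm (f z) \<le> M"
    by (meson bounded_iff compact_imp_bounded imageI)
  show ?thesis
  proof (rule that)
    show "cpolydisc (2 * r) \<subseteq> U" using rK by blast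
    then show "sep_holo f (cpolydisc (2 * r))" by (rule sep_holo_subset[OF assms(1)])
    show "norm (f z) \<le> M" if "z \<in> cpolydisc (2 * r)" for z using M rK that by blast
  qed (rule rK)
qed

text \<open>Osgood's lemma: near each point the function is the sum of its Taylor series, and such
  sums have a complex-linear derivative. Limits can thus be formed for \<open>sep_holo\<close> and
  returned to \<open>holo_on\<close>.\<close>

lemma sep_holo_imp_holo_on:
  assumes "open U" "sep_holo f U"
  shows "holo_on f U"
  unfolding holo_on_def
proof
  fix z assume z: "z \<in> U"
  let ?g = "\<lambda>w. f (z + w)"
  have 1: "sep_holo ?g {w. z + w \<in> U}" by (rule sep_holo_translate[OF assms(2)])
  have 2: "open {w. z + w \<in> U}"
    using open_vimage[OF assms(1), of "\<lambda>w. z + w"] by (simp add: vimage_def continuous_intros)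
  obtain r M where r: "r > 0" "sep_holo ?g (cpolydisc (2 * r))"
    "\<And>w. w \<in> cpolydisc (2 * r) \<Longrightarrow> norm (?g w) \<le> M"
    by (rule sep_holo_local[OF 1 2]) (use z in auto)
  have 0: "0 \<in> cpolydisc r" using r by (simp add: polydisc_def)
  obtain f' where f': "(pseries (coef ?g) has_derivative f') (at 0)" "\<And>c v. f' (c *s v) = c * f' v"
    using holo_on_pseries[OF converges_coef[OF r(2,1,3)] r(1)] 0 by (auto simp: holo_on_def)
  have "(?g has_derivative f') (at 0)"
    by (rule has_derivative_transform_within_open[OF f'(1) open_polydisc 0])
       (simp add: taylor_expansion[OF r(2,1,3)])
  moreover have "((\<lambda>w. w - z) has_derivative (\<lambda>w. w)) (at z)"
    by (auto intro!: derivative_eq_intros)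
  ultimately have "(f has_derivative f') (at z)"
    using diff_chain_at[of "\<lambda>w. w - z" "\<lambda>w. w" z ?g f'] by (simp add: o_def)
  then show "\<exists>f'. (f has_derivative f') (at z) \<and> (\<forall>c v. f' (c *s v) = c * f' v)" using f' by blast
qed

section \<open>The ring of germs in terms of coefficients\<close>

definition holo0 :: "(complex ^ 'n::finite \<Rightarrow> complex) \<Rightarrow> bool" where
  "holo0 f \<longleftrightarrow> (\<exists>U. open U \<and> 0 \<in> U \<and> holo_on f U)"

lemma zero_in_polydisc [simp]: "0 \<in> cpolydisc r \<longleftrightarrow> r > 0"
  by (simp add: polydisc_def)

lemma eventually_polydisc: "r > 0 \<Longrightarrow> \<forall>\<^sub>F z in nhds 0. z \<in> cpolydisc r"
  by (rule eventually_nhds_in_open) (simp_all add: open_polydisc)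

lemma polydisc_mono: "r \<le> s \<Longrightarrow> cpolydisc r \<subseteq> cpolydisc s"
  by (auto simp: polydisc_def intro: less_le_trans)

lemma converges_mono: "converges R c \<Longrightarrow> r \<le> R \<Longrightarrow> converges r c"
  by (auto simp: converges_def)

lemma holo0_pseries: "converges R c \<Longrightarrow> R > 0 \<Longrightarrow> holo0 (pseries c)"
  using holo_on_pseries open_polydisc zero_in_polydisc unfolding holo0_def by blast

lemma holo0_expand:
  assumes "holo0 f"
  obtains r where "r > 0" "converges r (coef f)" "\<And>z. z \<in> cpolydisc r \<Longrightarrow> f z = pseries (coef f) z"
proof -
  obtain U where "open U" "0 \<in> U" "holo_on f U" using assms by (auto simp: holo0_def)
  then obtain r M where "r > 0" "sep_holo f (cpolydisc (2 * r))" "\<And>z. z \<in> cpolydisc (2 * r) \<Longrightarrow> norm (f z) \<le> M"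
    using sep_holo_local[OF holo_on_imp_sep_holo] by metis
  then show ?thesis using that converges_coef taylor_expansion by metis
qed

lemma holo0_cong:
  assumes "holo0 f" "\<forall>\<^sub>F z in nhds 0. f z = g z"
  shows "holo0 g"
proof -
  obtain U where U: "open U" "0 \<in> U" "holo_on f U" using assms by (auto simp: holo0_def)
  obtain V where V: "open V" "0 \<in> V" "\<And>z. z \<in> V \<Longrightarrow> f z = g z"
    using assms(2) by (auto simp: eventually_nhds)
  have "holo_on g (U \<inter> V)"
    unfolding holo_on_def
  proof
    fix z assume z: "z \<in> U \<inter> V"
    then obtain f' where f': "(f has_derivative f') (at z)" "\<forall>c v. f' (c *s v) = c * f' v"
      using U by (auto simp: holo_on_def)
    have "(g has_derivative f') (at z)"
      by (rule has_derivative_transform_within_open[OF f'(1) V(1)]) (use z V in auto)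
    then show "\<exists>f'. (g has_derivative f') (at z) \<and> (\<forall>c v. f' (c *s v) = c * f' v)" using f' by blast
  qed
  then show ?thesis using U V by (auto simp: holo0_def intro!: exI[of _ "U \<inter> V"])
qed

lemma germ_in_carrier_iff: "germ f \<in> carrier germ_ring \<longleftrightarrow> holo0 f"
proof
  assume "germ f \<in> carrier germ_ring"
  then obtain g where "holo0 g" "germ f = germ g" by (auto simp: holo0_def elim!: germ_carrierE)
  then show "holo0 f" using holo0_cong[of g f] by (simp add: germ_eq_iff eq_commute)
qed (auto simp: holo0_def intro: germ_carrierI)

lemma holo0_const: "holo0 (\<lambda>_. c)"
  using germ_carrier_const germ_in_carrier_iff by blast

lemma holo0_add: "holo0 f \<Longrightarrow> holo0 g \<Longrightarrow> holo0 (\<lambda>z. f z + g z)"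
  using germ_carrier_add[of "germ f" "germ g"] by (simp add: germ_in_carrier_iff germ_add)

lemma holo0_mult: "holo0 f \<Longrightarrow> holo0 g \<Longrightarrow> holo0 (\<lambda>z. f z * g z)"
  using germ_carrier_mult[of "germ f" "germ g"] by (simp add: germ_in_carrier_iff germ_mult)

lemma holo0_diff:
  assumes "holo0 f" "holo0 g"
  shows "holo0 (\<lambda>z. f z - g z)"
  using holo0_add[OF assms(1) holo0_mult[OF holo0_const[of "-1"] assms(2)]] by simp

lemma germ_eq_if_coef_eq:
  assumes "holo0 f" "holo0 g" "coef f = coef g"
  shows "germ f = germ g"
proof -
  obtain r where r: "r > 0" "\<And>z. z \<in> cpolydisc r \<Longrightarrow> f z = pseries (coef f) z"
    using holo0_expand[OF assms(1)] by metis
  obtain s where s: "s > 0" "\<And>z. z \<in> cpolydisc s \<Longrightarrow> g z = pseries (coef g) z"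
    using holo0_expand[OF assms(2)] by metis
  show ?thesis
    unfolding germ_eq_iff using eventually_polydisc[OF r(1)] eventually_polydisc[OF s(1)]
    by eventually_elim (simp add: r s assms)
qed

section \<open>Germ operations on coefficients\<close>

definition convolve :: "(('n::finite \<Rightarrow> nat) \<Rightarrow> 'a::comm_ring) \<Rightarrow> (('n \<Rightarrow> nat) \<Rightarrow> 'a) \<Rightarrow> ('n \<Rightarrow> nat) \<Rightarrow> 'a" where
  "convolve c d \<alpha> = (\<Sum>\<beta>\<in>{..\<alpha>}. c \<beta> * d (\<lambda>i. \<alpha> i - \<beta> i))"

lemma finite_atMost_multi [simp]: "finite {..\<alpha> :: 'n::finite \<Rightarrow> nat}"
proof (rule finite_subset)
  show "{..\<alpha>} \<subseteq> PiE UNIV (\<lambda>i. {..\<alpha> i})" by (auto simp: le_fun_def)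
qed (simp add: finite_PiE)

lemma bij_betw_convolve:
  "bij_betw (\<lambda>(\<alpha>, \<beta>). (\<beta>, \<lambda>i. \<alpha> i - \<beta> i)) (SIGMA \<alpha>:UNIV. {..\<alpha> :: 'n::finite \<Rightarrow> nat}) (UNIV \<times> UNIV)"
  by (rule bij_betwI[where g = "\<lambda>(\<beta>, \<gamma>). (\<lambda>i. \<beta> i + \<gamma> i, \<beta>)"]) (auto simp: le_fun_def)

lemma mpow_add: "mpow z (\<lambda>i. \<alpha> i + \<beta> i) = mpow z \<alpha> * mpow z \<beta>"
  by (simp add: mpow_def power_add prod.distrib)

text \<open>The Cauchy product theorem. The product family over pairs is absolutely summable;
  regrouping pairs by their sum \<open>\<alpha>\<close> turns the fibres into the finite boxes
  \<open>{..\<alpha>}\<close> of the componentwise order.\<close>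

lemma convolve_summable:
  fixes F G :: "('n::finite \<Rightarrow> nat) \<Rightarrow> complex"
  assumes F: "(\<lambda>\<alpha>. norm (F \<alpha>)) summable_on UNIV" and G: "(\<lambda>\<alpha>. norm (G \<alpha>)) summable_on UNIV"
  shows "(convolve F G has_sum (infsum F UNIV * infsum G UNIV)) UNIV"
    and "(\<lambda>\<alpha>. norm (convolve F G \<alpha>)) summable_on UNIV"
proof -
  let ?P = "\<lambda>(\<beta>, \<gamma>). F \<beta> * G \<gamma>"
  let ?S = "SIGMA \<alpha>:UNIV. {..\<alpha> :: 'n \<Rightarrow> nat}"
  have abs: "(\<lambda>x. norm (?P x)) summable_on UNIV \<times> UNIV"
  proof (rule Infinite_Sum.abs_summable_on_Sigma_iff[THEN iffD2, OF conjI])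
    show "\<forall>x\<in>UNIV. (\<lambda>y. norm (?P (x, y))) summable_on UNIV"
      using summable_on_cmult_right[OF G] by (simp add: norm_mult)
    have "(\<lambda>x. norm (F x) * infsum (\<lambda>y. norm (G y)) UNIV) summable_on UNIV"
      by (rule summable_on_cmult_left[OF F])
    then show "(\<lambda>x. norm (infsum (\<lambda>y. norm (?P (x, y))) UNIV)) summable_on UNIV"
      by (simp add: norm_mult infsum_cmult_right' infsum_nonneg abs_mult)
  qed
  then have "?P summable_on UNIV \<times> UNIV" by (rule abs_summable_summable)
  moreover have "infsum ?P (UNIV \<times> UNIV) = infsum F UNIV * infsum G UNIV"
    using infsum_Sigma_banach[OF calculation]
    by (simp add: infsum_cmult_right' infsum_cmult_left')
  ultimately have "(?P has_sum (infsum F UNIV * infsum G UNIV)) (UNIV \<times> UNIV)"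
    by (metis has_sum_infsum)
  then have "((\<lambda>x. ?P (case x of (\<alpha>, \<beta>) \<Rightarrow> (\<beta>, \<lambda>i. \<alpha> i - \<beta> i))) has_sum (infsum F UNIV * infsum G UNIV)) ?S"
    by (subst has_sum_reindex_bij_betw[OF bij_betw_convolve])
  then have h: "((\<lambda>(\<alpha>, \<beta>). F \<beta> * G (\<lambda>i. \<alpha> i - \<beta> i)) has_sum (infsum F UNIV * infsum G UNIV)) ?S"
    by (simp add: case_prod_unfold)
  show "(convolve F G has_sum (infsum F UNIV * infsum G UNIV)) UNIV"
    by (rule has_sum_SigmaD[OF h]) (auto simp: convolve_def intro!: has_sum_finiteI)
  have "(\<lambda>x. norm (?P (case x of (\<alpha>, \<beta>) \<Rightarrow> (\<beta>, \<lambda>i. \<alpha> i - \<beta> i)))) summable_on ?S"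
    by (subst summable_on_reindex_bij_betw[OF bij_betw_convolve]) (rule abs)
  then have "(\<lambda>x. norm (case x of (\<alpha>, \<beta>) \<Rightarrow> F \<beta> * G (\<lambda>i. \<alpha> i - \<beta> i))) summable_on ?S"
    by (simp add: case_prod_unfold)
  then have "(\<lambda>\<alpha>. norm (\<Sum>\<^sub>\<infinity>\<beta>\<in>{..\<alpha>}. norm (F \<beta> * G (\<lambda>i. \<alpha> i - \<beta> i)))) summable_on UNIV"
    by (subst (asm) Infinite_Sum.abs_summable_on_Sigma_iff) simp
  then show "(\<lambda>\<alpha>. norm (convolve F G \<alpha>)) summable_on UNIV"
    by (rule summable_on_comparison_test) (auto simp: convolve_def intro: order_trans[OF norm_sum])
qed

lemma convolve_pseries_terms:
  "convolve (\<lambda>\<alpha>. c \<alpha> * mpow z \<alpha>) (\<lambda>\<alpha>. d \<alpha> * mpow z \<alpha>) = (\<lambda>\<alpha>. convolve c d \<alpha> * mpow z \<alpha>)"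
  unfolding convolve_def sum_distrib_right
proof (intro ext sum.cong)
  fix \<alpha> \<beta> :: "'a \<Rightarrow> nat" assume "\<beta> \<in> {..\<alpha>}"
  then have "(\<lambda>i. \<beta> i + (\<alpha> i - \<beta> i)) = \<alpha>" by (auto simp: le_fun_def)
  then have "mpow z \<alpha> = mpow z \<beta> * mpow z (\<lambda>i. \<alpha> i - \<beta> i)" by (metis mpow_add)
  then show "c \<beta> * mpow z \<beta> * (d (\<lambda>i. \<alpha> i - \<beta> i) * mpow z (\<lambda>i. \<alpha> i - \<beta> i)) =
      c \<beta> * d (\<lambda>i. \<alpha> i - \<beta> i) * mpow z \<alpha>" by simp
qed simp

lemma pseries_mult:
  assumes "converges R c" "converges R d" "z \<in> cpolydisc R" "R > 0"
  shows "pseries c z * pseries d z = pseries (convolve c d) z"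
  using convolve_summable(1)[OF abs_summable_pseries[OF assms(1,3,4)] abs_summable_pseries[OF assms(2,3,4)]]
  by (simp add: pseries_def convolve_pseries_terms infsumI)

lemma converges_convolve:
  assumes "converges R c" "converges R d"
  shows "converges R (convolve c d)"
  unfolding converges_def
proof (intro allI impI)
  fix r assume r: "0 < r \<and> r < R"
  \<comment> \<open>At the point with all coordinates \<open>r\<close> every monomial has modulus
    exactly \<open>r ^ mdeg \<alpha>\<close>, so absolute summability there is the weighted
    summability sought.\<close>
  define z where "z = ((\<chi> i. complex_of_real r) :: complex ^ 'a)"
  have m: "norm (mpow z \<alpha>) = r ^ mdeg \<alpha>" for \<alpha> :: "'a \<Rightarrow> nat"
    using r by (simp add: mpow_def z_def mdeg_def power_sum prod_norm[symmetric] norm_power)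
  have z: "z \<in> cpolydisc R" using r by (simp add: polydisc_def z_def)
  show "(\<lambda>\<alpha>. norm (convolve c d \<alpha>) * r ^ mdeg \<alpha>) summable_on UNIV"
    using convolve_summable(2)[OF abs_summable_pseries[OF assms(1) z] abs_summable_pseries[OF assms(2) z]] r
    by (simp add: convolve_pseries_terms norm_mult m)
qed

lemma converges_add:
  assumes "converges R c" "converges R d"
  shows "converges R (\<lambda>\<alpha>. c \<alpha> + d \<alpha>)"
  unfolding converges_def
proof (intro allI impI)
  fix r assume r: "0 < r \<and> r < R"
  then have "(\<lambda>\<alpha>. norm (c \<alpha>) * r ^ mdeg \<alpha> + norm (d \<alpha>) * r ^ mdeg \<alpha>) summable_on UNIV"
    using assms by (intro summable_on_add) (auto simp: converges_def)
  then show "(\<lambda>\<alpha>. norm (c \<alpha> + d \<alpha>) * r ^ mdeg \<alpha>) summable_on UNIV"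
  proof (rule summable_on_comparison_test)
    show "norm (c \<alpha> + d \<alpha>) * r ^ mdeg \<alpha> \<le> norm (c \<alpha>) * r ^ mdeg \<alpha> + norm (d \<alpha>) * r ^ mdeg \<alpha>" for \<alpha>
      using mult_right_mono[OF norm_triangle_ineq[of "c \<alpha>" "d \<alpha>"], of "r ^ mdeg \<alpha>"] r
      by (simp add: distrib_right)
  qed (use r in auto)
qed

lemma holo0_expand2:
  fixes f g :: "complex ^ 'n::finite \<Rightarrow> complex"
  assumes "holo0 f" "holo0 g"
  obtains r where "r > 0" "converges r (coef f)" "converges r (coef g)"
    "\<And>z. z \<in> cpolydisc r \<Longrightarrow> f z = pseries (coef f) z"
    "\<And>z. z \<in> cpolydisc r \<Longrightarrow> g z = pseries (coef g) z"
proof -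
  obtain r where r: "r > 0" "converges r (coef f)" "\<And>z. z \<in> cpolydisc r \<Longrightarrow> f z = pseries (coef f) z"
    using holo0_expand[OF assms(1)] by metis
  obtain s where s: "s > 0" "converges s (coef g)" "\<And>z. z \<in> cpolydisc s \<Longrightarrow> g z = pseries (coef g) z"
    using holo0_expand[OF assms(2)] by metis
  show ?thesis
  proof (rule that[of "min r s"])
    show "f z = pseries (coef f) z" "g z = pseries (coef g) z" if "z \<in> cpolydisc (min r s)" for z
      using that polydisc_mono[of "min r s" r] polydisc_mono[of "min r s" s] r(3) s(3) by auto
    show "converges (min r s) (coef f)" "converges (min r s) (coef g)"
      by (rule converges_mono[OF r(2)], simp, rule converges_mono[OF s(2)], simp)
  qed (use r s in auto)
qed

lemma coef_mult:
  assumes "holo0 f" "holo0 g"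
  shows "coef (\<lambda>z. f z * g z) = convolve (coef f) (coef g)"
proof -
  obtain r where r: "r > 0" "converges r (coef f)" "converges r (coef g)"
    "\<And>z. z \<in> cpolydisc r \<Longrightarrow> f z = pseries (coef f) z"
    "\<And>z. z \<in> cpolydisc r \<Longrightarrow> g z = pseries (coef g) z"
    using holo0_expand2[OF assms] by metis
  have "coef (\<lambda>z. f z * g z) = coef (pseries (convolve (coef f) (coef g)))"
    by (rule coef_cong, rule eventually_mono[OF eventually_polydisc[OF r(1)]])
       (simp add: r(4,5) pseries_mult[OF r(2,3) _ r(1)])
  also have "\<dots> = convolve (coef f) (coef g)"
    by (rule coef_pseries[OF converges_convolve[OF r(2,3)] r(1)])
  finally show ?thesis .
qed

lemma coef_add:
  assumes "holo0 f" "holo0 g"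
  shows "coef (\<lambda>z. f z + g z) \<alpha> = coef f \<alpha> + coef g \<alpha>"
proof -
  obtain r where r: "r > 0" "converges r (coef f)" "converges r (coef g)"
    "\<And>z. z \<in> cpolydisc r \<Longrightarrow> f z = pseries (coef f) z"
    "\<And>z. z \<in> cpolydisc r \<Longrightarrow> g z = pseries (coef g) z"
    using holo0_expand2[OF assms] by metis
  have add: "pseries (coef f) z + pseries (coef g) z = pseries (\<lambda>\<alpha>. coef f \<alpha> + coef g \<alpha>) z" if "z \<in> cpolydisc r" for z
    unfolding pseries_def distrib_right
    by (rule infsum_add[symmetric])
       (use r that in \<open>auto intro!: abs_summable_summable[OF abs_summable_pseries]\<close>)
  have "coef (\<lambda>z. f z + g z) = coef (pseries (\<lambda>\<alpha>. coef f \<alpha> + coef g \<alpha>))"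
    by (rule coef_cong, rule eventually_mono[OF eventually_polydisc[OF r(1)]])
       (simp add: r(4,5) add)
  also have "\<dots> = (\<lambda>\<alpha>. coef f \<alpha> + coef g \<alpha>)"
    by (rule coef_pseries[OF converges_add[OF r(2,3)] r(1)])
  finally show ?thesis by simp
qed

lemma coef_const: "coef (\<lambda>_ :: complex ^ 'n::finite. a) = (\<lambda>\<alpha>. if \<alpha> = (\<lambda>_. 0) then a else 0)"
proof -
  let ?c = "\<lambda>\<alpha> :: 'n \<Rightarrow> nat. if \<alpha> = (\<lambda>_. 0) then a else 0"
  have "converges 1 ?c"
    unfolding converges_def
  proof (intro allI impI)
    fix r :: real assume "0 < r \<and> r < 1"
    show "(\<lambda>\<alpha>. norm (?c \<alpha>) * r ^ mdeg \<alpha>) summable_on UNIV"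
      by (rule finite_nonzero_values_imp_summable_on)
         (rule finite_subset[of _ "{\<lambda>_. 0}"], auto)
  qed
  moreover have "pseries ?c = (\<lambda>_. a)"
  proof
    fix z :: "complex ^ 'n"
    have "pseries ?c z = (\<Sum>\<^sub>\<infinity>\<alpha>\<in>{\<lambda>_. 0}. a * mpow z \<alpha>)"
      unfolding pseries_def by (rule infsum_cong_neutral) auto
    then show "pseries ?c z = a" by (simp add: mpow_def)
  qed
  ultimately show ?thesis using coef_pseries[of 1 ?c] by simp
qed

lemma coef_cmult:
  assumes "holo0 f"
  shows "coef (\<lambda>z. a * f z) \<alpha> = a * coef f \<alpha>"
proof -
  have "coef (\<lambda>z. a * f z) \<alpha> = convolve (\<lambda>\<alpha>. if \<alpha> = (\<lambda>_. 0) then a else 0) (coef f) \<alpha>"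
    using coef_mult[OF holo0_const assms, of a] by (simp add: coef_const)
  also have "\<dots> = (\<Sum>\<beta>\<in>{..\<alpha>}. if \<beta> = (\<lambda>_. 0) then a * coef f \<alpha> else 0)"
    unfolding convolve_def by (rule sum.cong) auto
  finally show ?thesis by (simp add: le_fun_def)
qed

lemma coef_diff0:
  assumes "holo0 f" "holo0 g"
  shows "coef (\<lambda>z. f z - g z) \<alpha> = coef f \<alpha> - coef g \<alpha>"
  using coef_add[OF assms(1) holo0_mult[OF holo0_const[of "-1"] assms(2)], of \<alpha>] coef_cmult[OF assms(2), of "-1" \<alpha>]
  by simp

lemma coef_sum:
  assumes "\<And>e. e \<in> E \<Longrightarrow> holo0 (f e)"
  shows "holo0 (\<lambda>z. \<Sum>e\<in>E. f e z) \<and> coef (\<lambda>z. \<Sum>e\<in>E. f e z) \<alpha> = (\<Sum>e\<in>E. coef (f e) \<alpha>)"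
  using assms by (induction E rule: infinite_finite_induct) (simp_all add: holo0_const coef_const holo0_add coef_add)

section \<open>Ideal operations on representatives\<close>

lemma ideal_holo0: "ideal I germ_ring \<Longrightarrow> germ f \<in> I \<Longrightarrow> holo0 f"
  using germ_in_carrier_iff additive_subgroup.a_subset ideal.axioms(1) by blast

lemma ideal_add: "ideal I germ_ring \<Longrightarrow> germ f \<in> I \<Longrightarrow> germ g \<in> I \<Longrightarrow> germ (\<lambda>z. f z + g z) \<in> I"
  using additive_subgroup.a_closed[OF ideal.axioms(1), of I germ_ring "germ f" "germ g"] by (simp add: germ_add)

lemma ideal_mult: "ideal I germ_ring \<Longrightarrow> holo0 q \<Longrightarrow> germ f \<in> I \<Longrightarrow> germ (\<lambda>z. q z * f z) \<in> I"
  using ideal.I_l_closed[of I germ_ring "germ f" "germ q"] by (simp add: germ_mult germ_in_carrier_iff)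

lemma ideal_diff:
  assumes "ideal I germ_ring" "germ f \<in> I" "germ g \<in> I"
  shows "germ (\<lambda>z. f z - g z) \<in> I"
  using ideal_add[OF assms(1,2) ideal_mult[OF assms(1) holo0_const[of "-1"] assms(3)]] by simp

lemma ideal_zero: "ideal I germ_ring \<Longrightarrow> germ (\<lambda>_. 0) \<in> I"
  using additive_subgroup.zero_closed[OF ideal.axioms(1), of I germ_ring] by (simp add: germ_zero)

lemma ideal_sum:
  assumes "ideal I germ_ring" "\<And>e. e \<in> E \<Longrightarrow> germ (f e) \<in> I"
  shows "germ (\<lambda>z. \<Sum>e\<in>E. f e z) \<in> I"
  using assms by (induction E rule: infinite_finite_induct) (simp_all add: ideal_zero ideal_add)

section \<open>A monomial order and weighted norms\<close>

definition var_prime :: "'n::finite \<Rightarrow> nat" where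
  "var_prime = (SOME p. inj p \<and> (\<forall>i. prime (p i)))"

lemma var_prime: "inj (var_prime :: 'n::finite \<Rightarrow> nat)" "prime (var_prime (i :: 'n))"
proof -
  obtain e :: "'n \<Rightarrow> nat" where e: "inj e"
    using finite_imp_inj_to_nat_seg[OF finite_class.finite_UNIV] by metis
  let ?p = "\<lambda>i. enumerate {p :: nat. prime p} (e i)"
  have "inj ?p" using inj_compose[OF inj_enumerate[OF primes_infinite] e] by (simp add: o_def)
  moreover have "prime (?p i)" for i using enumerate_in_set[OF primes_infinite] by simp
  ultimately have "inj (var_prime :: 'n \<Rightarrow> nat) \<and> (\<forall>i :: 'n. prime (var_prime i))"
    unfolding var_prime_def by (intro someI[where P = "\<lambda>p. inj p \<and> (\<forall>i. prime (p i))"]) auto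
  then show "inj (var_prime :: 'n::finite \<Rightarrow> nat)" "prime (var_prime (i :: 'n))" by auto
qed

text \<open>Comparing these integers gives a monomial order that refines the componentwise one and
  has finite initial segments. Recursion and minima along it are those of the natural
  numbers.\<close>

definition mono_num :: "('n::finite \<Rightarrow> nat) \<Rightarrow> nat" where
  "mono_num \<alpha> = (\<Prod>i\<in>UNIV. var_prime i ^ \<alpha> i)"

lemma mono_num_pos [simp]: "mono_num \<alpha> > 0"
  unfolding mono_num_def using prime_gt_0_nat[OF var_prime(2)] by (intro prod_pos ballI zero_less_power)

lemma mono_num_add: "mono_num (\<lambda>i. \<alpha> i + \<beta> i) = mono_num \<alpha> * mono_num \<beta>"
  by (simp add: mono_num_def power_add prod.distrib)

lemma inj_mono_num: "inj (mono_num :: ('n::finite \<Rightarrow> nat) \<Rightarrow> nat)"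
proof (rule injI, rule ext)
  fix \<alpha> \<beta> :: "'n \<Rightarrow> nat" and i assume eq: "mono_num \<alpha> = mono_num \<beta>"
  have mult: "multiplicity (var_prime i) (mono_num \<alpha>) = \<alpha> i" for \<alpha> :: "'n \<Rightarrow> nat"
  proof -
    \<comment> \<open>The multiplicity rule concerns products indexed by the primes themselves,
      hence the inverse of the numbering.\<close>
    let ?v = "inv_into UNIV (var_prime :: 'n \<Rightarrow> nat)"
    have v: "?v (var_prime j) = j" for j by (rule inv_into_f_f[OF var_prime(1)]) simp
    have "mono_num \<alpha> = (\<Prod>p\<in>range (var_prime :: 'n \<Rightarrow> nat). p ^ \<alpha> (?v p))"
      unfolding mono_num_def by (subst prod.reindex[OF var_prime(1)]) (simp add: v)
    moreover have "multiplicity (var_prime i) (\<Prod>p\<in>range (var_prime :: 'n \<Rightarrow> nat). p ^ \<alpha> (?v p)) = \<alpha> (?v (var_prime i))"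
      using var_prime(2) by (subst multiplicity_prod_prime_powers) auto
    ultimately show ?thesis by (simp only: v)
  qed
  show "\<alpha> i = \<beta> i" using mult[of \<alpha>] mult[of \<beta>] eq by simp
qed

lemma mono_num_eq_iff [simp]: "mono_num \<alpha> = mono_num \<beta> \<longleftrightarrow> \<alpha> = \<beta>"
  using inj_mono_num by (auto dest: injD)

lemma finite_mono_num [simp]: "finite {\<alpha>. mono_num \<alpha> < m}" "finite {\<alpha>. mono_num \<alpha> \<le> m}"
  using finite_vimageI[OF finite_lessThan inj_mono_num, of m] finite_vimageI[OF finite_atMost inj_mono_num, of m]
  by (simp_all add: vimage_def)

text \<open>The comparison of integers with total degrees; it makes summability for some weight
  equivalent to convergence on some polydisc.\<close>

lemma mono_num_bounds:
  obtains P where "P > 0" "\<And>\<alpha> :: 'n::finite \<Rightarrow> nat. 2 ^ mdeg \<alpha> \<le> mono_num \<alpha>" "\<And>\<alpha> :: 'n \<Rightarrow> nat. mono_num \<alpha> \<le> P ^ mdeg \<alpha>"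
proof -
  let ?P = "\<Sum>i\<in>(UNIV :: 'n set). var_prime i"
  have "2 \<le> var_prime i" "var_prime i \<le> ?P" for i :: 'n
    using prime_ge_2_nat[OF var_prime(2)] by (auto intro: member_le_sum)
  then have "2 ^ mdeg \<alpha> \<le> mono_num \<alpha>" "mono_num \<alpha> \<le> ?P ^ mdeg \<alpha>" "?P > 0" for \<alpha> :: "'n \<Rightarrow> nat"
    unfolding mono_num_def mdeg_def power_sum by (auto intro!: prod_mono power_mono) (metis gr0I le_zero_eq zero_neq_numeral)
  then show ?thesis using that by blast
qed

text \<open>With p_i the prime of the variable i, this is the modulus of the monomial at the point
  with coordinates p_i ^ (- s). The weighted norm is the absolute sum of the series on a polydisc
  whose radii shrink at different rates as \<open>s\<close> grows, and this is what separates the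
  monomials.\<close>

definition weight :: "nat \<Rightarrow> ('n::finite \<Rightarrow> nat) \<Rightarrow> real" where
  "weight s \<alpha> = 1 / real (mono_num \<alpha>) ^ s"

lemma weight_pos [simp]: "weight s \<alpha> > 0"
  by (simp add: weight_def)

lemma weight_nonneg [simp]: "weight s \<alpha> \<ge> 0"
  by (simp add: weight_def)

lemma weight_add: "weight s (\<lambda>i. \<alpha> i + \<beta> i) = weight s \<alpha> * weight s \<beta>"
  by (simp add: weight_def mono_num_add power_mult_distrib)

lemma weight_antimono: "s \<le> t \<Longrightarrow> weight t \<alpha> \<le> weight s \<alpha>"
  using mono_num_pos[of \<alpha>] unfolding weight_def
  by (intro divide_left_mono power_increasing mult_pos_pos zero_less_power) (auto simp del: mono_num_pos)

definition wsummable :: "nat \<Rightarrow> (('n::finite \<Rightarrow> nat) \<Rightarrow> complex) \<Rightarrow> bool" where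
  "wsummable s c \<longleftrightarrow> (\<lambda>\<alpha>. norm (c \<alpha>) * weight s \<alpha>) summable_on UNIV"

lemma wsummable_mono:
  assumes "wsummable s c" "s \<le> t"
  shows "wsummable t c"
  using assms(1) unfolding wsummable_def
  by (rule summable_on_comparison_test) (auto intro: mult_left_mono weight_antimono[OF assms(2)])

text \<open>All primes are at least 2, so all radii are at most \<open>(1 / 2) ^ s\<close>, which
  drops below \<open>R\<close>.\<close>

lemma converges_imp_wsummable:
  fixes c :: "('n::finite \<Rightarrow> nat) \<Rightarrow> complex"
  assumes "converges R c" "R > 0"
  obtains s where "wsummable s c"
proof -
  obtain P where P: "\<And>\<alpha> :: 'n \<Rightarrow> nat. 2 ^ mdeg \<alpha> \<le> mono_num \<alpha>" using mono_num_bounds by metis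
  obtain s where s: "(1 / 2 :: real) ^ s < R" using real_arch_pow_inv[of R "1/2"] assms(2) by auto
  have "(\<lambda>\<alpha>. norm (c \<alpha>) * ((1 / 2) ^ s) ^ mdeg \<alpha>) summable_on UNIV"
    using assms(1) s by (auto simp: converges_def)
  then have "wsummable s c"
    unfolding wsummable_def
  proof (rule summable_on_comparison_test)
    show "norm (c \<alpha>) * weight s \<alpha> \<le> norm (c \<alpha>) * ((1 / 2) ^ s) ^ mdeg \<alpha>" for \<alpha>
    proof (rule mult_left_mono)
      have "(2 ^ mdeg \<alpha>) ^ s \<le> real (mono_num \<alpha>) ^ s"
        using P[of \<alpha>] by (intro power_mono) (auto simp flip: of_nat_le_iff)
      then have "weight s \<alpha> \<le> 1 / (2 ^ mdeg \<alpha>) ^ s"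
        unfolding weight_def by (intro divide_left_mono) auto
      also have "\<dots> = ((1 / 2) ^ s) ^ mdeg \<alpha>"
        by (simp add: power_divide power_mult[symmetric] mult.commute)
      finally show "weight s \<alpha> \<le> ((1 / 2) ^ s) ^ mdeg \<alpha>" .
    qed simp
  qed auto
  then show ?thesis using that by blast
qed

text \<open>In the other direction, the weight of \<alpha> is at least
  \<open>(1 / P ^ s) ^ mdeg \<alpha>\<close>, so the polydisc with all radii
  \<open>1 / P ^ s\<close> works.\<close>

lemma wsummable_imp_converges:
  fixes c :: "('n::finite \<Rightarrow> nat) \<Rightarrow> complex"
  assumes "wsummable s c"
  obtains R where "R > 0" "converges R c"
proof -
  obtain P where P: "P > 0" "\<And>\<alpha> :: 'n \<Rightarrow> nat. mono_num \<alpha> \<le> P ^ mdeg \<alpha>" using mono_num_bounds by metis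
  let ?R = "1 / real P ^ s"
  have "converges ?R c"
    unfolding converges_def
  proof (intro allI impI)
    fix r assume r: "0 < r \<and> r < ?R"
    show "(\<lambda>\<alpha>. norm (c \<alpha>) * r ^ mdeg \<alpha>) summable_on UNIV"
    proof (rule summable_on_comparison_test[OF assms[unfolded wsummable_def]])
      show "norm (c \<alpha>) * r ^ mdeg \<alpha> \<le> norm (c \<alpha>) * weight s \<alpha>" for \<alpha>
      proof (rule mult_left_mono)
        have "r ^ mdeg \<alpha> \<le> ?R ^ mdeg \<alpha>" using r by (intro power_mono) auto
        also have "\<dots> = 1 / (real (P ^ mdeg \<alpha>)) ^ s"
          by (simp add: power_divide power_mult[symmetric] mult.commute)
        also have "\<dots> \<le> weight s \<alpha>"
          unfolding weight_def using P(2)[of \<alpha>] P(1)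
          by (intro divide_left_mono power_mono) (auto simp del: of_nat_power)
        finally show "r ^ mdeg \<alpha> \<le> weight s \<alpha>" .
      qed simp
    qed (use r in auto)
  qed
  then show ?thesis using that[of ?R] P(1) by simp
qed

text \<open>Let \<open>m\<close> be the integer of \<open>e\<close>. Every other exponent with
  nonzero coefficient has an integer of at least \<open>m + 1\<close>. Raising \<open>s0\<close> by
  \<open>k\<close> thus multiplies its weight by at most 1 / (m + 1)^k, while the weight of
  \<open>e\<close> is multiplied by 1 / m^k; the ratio (m / (m + 1))^k tends to 0. The constant
  \<open>A * m ^ s0\<close> is the norm at \<open>s0\<close> relative to the weight of
  \<open>e\<close>.\<close>

lemma tail_bound:
  assumes c: "wsummable s0 c" and lead: "\<And>\<beta>. mono_num \<beta> < mono_num e \<Longrightarrow> c \<beta> = 0" and "\<epsilon> > 0"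
  obtains s1 where "\<And>s T. s1 \<le> s \<Longrightarrow> finite T \<Longrightarrow> e \<notin> T \<Longrightarrow> (\<Sum>\<alpha>\<in>T. norm (c \<alpha>) * weight s \<alpha>) \<le> \<epsilon> * weight s e"
proof -
  define A where "A = (\<Sum>\<^sub>\<infinity>\<alpha>. norm (c \<alpha>) * weight s0 \<alpha>)"
  define m where "m = real (mono_num e)"
  have m: "m > 0" by (simp add: m_def)
  have "(\<lambda>k. A * m ^ s0 * (m / (m + 1)) ^ k) \<longlonglongrightarrow> A * m ^ s0 * 0"
    using m by (intro tendsto_mult_left LIMSEQ_realpow_zero) auto
  then have "\<forall>\<^sub>F k in sequentially. A * m ^ s0 * (m / (m + 1)) ^ k < \<epsilon>"
    using order_tendstoD(2) assms(3) by simp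
  then obtain K where K: "\<And>k. k \<ge> K \<Longrightarrow> A * m ^ s0 * (m / (m + 1)) ^ k < \<epsilon>"
    by (auto simp: eventually_sequentially)
  have "(\<Sum>\<alpha>\<in>T. norm (c \<alpha>) * weight s \<alpha>) \<le> \<epsilon> * weight s e" if s: "s0 + K \<le> s" and T: "finite T" "e \<notin> T" for s T
  proof -
    define k where "k = s - s0"
    have sk: "s = s0 + k" "k \<ge> K" using s by (auto simp: k_def)
    have "(\<Sum>\<alpha>\<in>T. norm (c \<alpha>) * weight s \<alpha>) \<le> (\<Sum>\<alpha>\<in>T. norm (c \<alpha>) * weight s0 \<alpha> * (1 / (m + 1) ^ k))"
    proof (rule sum_mono)
      fix \<alpha> assume "\<alpha> \<in> T"
      show "norm (c \<alpha>) * weight s \<alpha> \<le> norm (c \<alpha>) * weight s0 \<alpha> * (1 / (m + 1) ^ k)"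
      proof (cases "mono_num \<alpha> < mono_num e")
        case False
        moreover have "mono_num \<alpha> \<noteq> mono_num e" using T \<open>\<alpha> \<in> T\<close> by auto
        ultimately have "m + 1 \<le> real (mono_num \<alpha>)" unfolding m_def by linarith
        then have "1 / real (mono_num \<alpha>) ^ k \<le> 1 / (m + 1) ^ k"
          using m by (intro divide_left_mono power_mono) auto
        then have "weight s0 \<alpha> * (1 / real (mono_num \<alpha>) ^ k) \<le> weight s0 \<alpha> * (1 / (m + 1) ^ k)"
          by (rule mult_left_mono) simp
        then have "weight s \<alpha> \<le> weight s0 \<alpha> * (1 / (m + 1) ^ k)"
          by (simp add: weight_def sk(1) power_add)
        then show ?thesis by (simp only: mult.assoc mult_left_mono norm_ge_zero)
      qed (use lead in simp)
    qed
    also have "\<dots> = (\<Sum>\<alpha>\<in>T. norm (c \<alpha>) * weight s0 \<alpha>) * (1 / (m + 1) ^ k)"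
      by (simp only: sum_distrib_right)
    also have "\<dots> \<le> A * (1 / (m + 1) ^ k)"
      unfolding A_def
      by (rule mult_right_mono, rule finite_sum_le_infsum)
         (use c T m in \<open>auto simp: wsummable_def\<close>)
    also have "\<dots> = (A * m ^ s0 * (m / (m + 1)) ^ k) * weight s e"
      using m by (simp add: weight_def sk(1) m_def[symmetric] power_add power_divide)
    also have "\<dots> \<le> \<epsilon> * weight s e"
      by (rule mult_right_mono) (use K[OF sk(2)] in auto)
    finally show ?thesis .
  qed
  then show ?thesis using that by blast
qed

section \<open>Dickson's lemma\<close>

lemma incseq_subsequence:
  fixes x :: "nat \<Rightarrow> nat"
  obtains \<phi> :: "nat \<Rightarrow> nat" where "strict_mono \<phi>" "incseq (x \<circ> \<phi>)"
proof -
  obtain \<psi> :: "nat \<Rightarrow> nat" where \<psi>: "strict_mono \<psi>" "monoseq (\<lambda>n. x (\<psi> n))" using seq_monosub by metis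
  show ?thesis
  proof (cases "incseq (\<lambda>n. x (\<psi> n))")
    case True
    then show ?thesis using that \<psi> by (auto simp: o_def)
  next
    case False
    then have dec: "decseq (\<lambda>n. x (\<psi> n))" using \<psi>(2) by (auto simp: monoseq_iff)
    \<comment> \<open>A decreasing sequence of naturals is constant from any index of its least
      value on.\<close>
    define n0 where "n0 = (ARG_MIN (\<lambda>n. x (\<psi> n)) n. True)"
    have n0: "x (\<psi> n0) \<le> x (\<psi> n)" for n
      unfolding n0_def by (rule arg_min_nat_le) simp
    have "x (\<psi> (k + n0)) = x (\<psi> n0)" for k
      using n0[of "k + n0"] decseqD[OF dec, of n0 "k + n0"] by simp
    then have "incseq (x \<circ> (\<lambda>k. \<psi> (k + n0)))" by (simp add: incseq_def)
    moreover have "strict_mono (\<lambda>k. \<psi> (k + n0))" using \<psi>(1) by (simp add: strict_mono_def)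
    ultimately show ?thesis using that by blast
  qed
qed

lemma incseq_subsequence_multi:
  fixes x :: "nat \<Rightarrow> 'n \<Rightarrow> nat"
  assumes "finite J"
  shows "\<exists>\<phi> :: nat \<Rightarrow> nat. strict_mono \<phi> \<and> (\<forall>j\<in>J. incseq (\<lambda>k. x (\<phi> k) j))"
  using assms
proof (induction J)
  case empty
  then show ?case by (intro exI[of _ id]) (auto simp: strict_mono_def)
next
  case (insert j J)
  then obtain \<phi> :: "nat \<Rightarrow> nat" where \<phi>: "strict_mono \<phi>" "\<forall>j\<in>J. incseq (\<lambda>k. x (\<phi> k) j)" by blast
  obtain \<psi> where \<psi>: "strict_mono \<psi>" "incseq ((\<lambda>k. x (\<phi> k) j) \<circ> \<psi>)"
    using incseq_subsequence by blast
  have "incseq (\<lambda>k. x (\<phi> (\<psi> k)) i)" if "i \<in> J" for i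
    using \<phi>(2) that strict_mono_mono[OF \<psi>(1)] by (auto simp: incseq_def monoD)
  then show ?case
    using \<psi> \<phi>(1) by (intro exI[of _ "\<lambda>k. \<phi> (\<psi> k)"]) (auto simp: strict_mono_def o_def)
qed

text \<open>\<open>E\<close> consists of the componentwise minimal elements. Infinitely many of them
  would yield a sequence with a componentwise increasing subsequence, whose first two terms
  contradict minimality.\<close>

lemma dickson:
  fixes S :: "('n::finite \<Rightarrow> nat) set"
  obtains E where "finite E" "E \<subseteq> S" "\<And>\<gamma>. \<gamma> \<in> S \<Longrightarrow> \<exists>e\<in>E. e \<le> \<gamma>"
proof -
  define E where "E = {e\<in>S. \<forall>s\<in>S. s \<le> e \<longrightarrow> s = e}"
  have "finite E"
  proof (rule ccontr)
    assume "infinite E"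
    then obtain x :: "nat \<Rightarrow> 'n \<Rightarrow> nat" where x: "inj x" "range x \<subseteq> E"
      using infinite_countable_subset by blast
    obtain \<phi> where \<phi>: "strict_mono \<phi>" "\<forall>j\<in>UNIV. incseq (\<lambda>k. x (\<phi> k) j)"
      using incseq_subsequence_multi[OF finite_class.finite_UNIV] by blast
    have "x (\<phi> 0) \<le> x (\<phi> 1)" using \<phi>(2) by (auto simp: le_fun_def incseq_def)
    then have "x (\<phi> 0) = x (\<phi> 1)" using x(2) unfolding E_def by blast
    moreover have "\<phi> 0 \<noteq> \<phi> 1" using strict_monoD[OF \<phi>(1), of 0 1] by simp
    ultimately show False using x(1) by (auto dest: injD)
  qed
  moreover have "\<exists>e\<in>E. e \<le> \<gamma>" if "\<gamma> \<in> S" for \<gamma>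
    using that
  proof (induction "mdeg \<gamma>" arbitrary: \<gamma> rule: less_induct)
    case less
    show ?case
    proof (cases "\<gamma> \<in> E")
      case False
      then obtain s where s: "s \<in> S" "s \<le> \<gamma>" "s \<noteq> \<gamma>" using less.prems by (auto simp: E_def)
      then have "s < \<gamma>" by simp
      then obtain i where "s i < \<gamma> i" by (auto simp: less_fun_def le_fun_def not_le)
      then have "mdeg s < mdeg \<gamma>"
        unfolding mdeg_def using s(2) by (intro sum_strict_mono_ex1) (auto simp: le_fun_def)
      then show ?thesis using less.hyps s order_trans by blast
    qed auto
  qed
  ultimately show ?thesis using that E_def by blast
qed

text \<open>Forward substitution for a unitriangular system: write \<open>f\<close> as a combination
  of the rows \<open>h \<gamma>\<close> for \<gamma> in \<open>S\<close> and of unit vectors at the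
  exponents outside \<open>S\<close>. The values on \<open>S\<close> are the coefficients of the
  rows, those outside \<open>S\<close> are the remainder.\<close>

function solve :: "('n::finite \<Rightarrow> nat) set \<Rightarrow> (('n \<Rightarrow> nat) \<Rightarrow> ('n \<Rightarrow> nat) \<Rightarrow> complex) \<Rightarrow>
    (('n \<Rightarrow> nat) \<Rightarrow> complex) \<Rightarrow> ('n \<Rightarrow> nat) \<Rightarrow> complex" where
  "solve S h f \<alpha> = f \<alpha> - (\<Sum>\<gamma>\<in>{\<gamma>\<in>S. mono_num \<gamma> < mono_num \<alpha>}. solve S h f \<gamma> * h \<gamma> \<alpha>)"
  by pat_completeness auto
termination by (relation "Wellfounded.measure (\<lambda>(S, h, f, \<alpha>). mono_num \<alpha>)") auto

declare solve.simps [simp del]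

text \<open>Initial segments being finite, each value is a finite linear expression in finitely many
  entries of \<open>f\<close>; coefficientwise convergence therefore passes through.\<close>

lemma solve_tendsto:
  assumes "\<And>\<alpha>. (\<lambda>m. f m \<alpha>) \<longlonglongrightarrow> f0 \<alpha>"
  shows "(\<lambda>m. solve S h (f m) \<alpha>) \<longlonglongrightarrow> solve S h f0 \<alpha>"
proof (induction "mono_num \<alpha>" arbitrary: \<alpha> rule: less_induct)
  case less
  show ?case
    unfolding solve.simps[of S h _ \<alpha>]
    by (intro tendsto_diff assms tendsto_sum tendsto_mult_right less) simp
qed

lemma solve_eq:
  assumes "\<And>\<gamma>. \<gamma> \<in> S \<Longrightarrow> h \<gamma> \<gamma> = 1"
  shows "f \<alpha> = (\<Sum>\<gamma>\<in>{\<gamma>\<in>S. mono_num \<gamma> \<le> mono_num \<alpha>}. solve S h f \<gamma> * h \<gamma> \<alpha>) + (if \<alpha> \<in> S then 0 else solve S h f \<alpha>)"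
proof -
  have fin: "finite {\<gamma>\<in>S. mono_num \<gamma> < mono_num \<alpha>}" by (rule finite_subset[OF _ finite_mono_num(1)[of "mono_num \<alpha>"]]) auto
  have "{\<gamma>\<in>S. mono_num \<gamma> \<le> mono_num \<alpha>} = (if \<alpha> \<in> S then insert \<alpha> {\<gamma>\<in>S. mono_num \<gamma> < mono_num \<alpha>} else {\<gamma>\<in>S. mono_num \<gamma> < mono_num \<alpha>})"
    by (auto simp: le_less)
  then show ?thesis
    using fin assms[of \<alpha>] solve.simps[of S h f \<alpha>] by auto
qed

text \<open>Let X be the weighted sum of the solution over an initial segment and A the norm of
  \<open>f\<close>. Exchanging sums and using that each row is at most half its diagonal weight off
  the diagonal gives X \<le> A + X / 2. As X is a finite sum, X \<le> 2 A follows, uniformly in the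
  segment.\<close>

lemma solve_wsummable:
  fixes f :: "('n::finite \<Rightarrow> nat) \<Rightarrow> complex"
  assumes f: "wsummable s f"
    and h: "\<And>\<gamma> T. \<gamma> \<in> S \<Longrightarrow> finite T \<Longrightarrow> \<gamma> \<notin> T \<Longrightarrow> (\<Sum>\<alpha>\<in>T. norm (h \<gamma> \<alpha>) * weight s \<alpha>) \<le> 1 / 2 * weight s \<gamma>"
  shows "wsummable s (solve S h f)"
  unfolding wsummable_def
proof (rule nonneg_bdd_above_summable_on)
  let ?u = "solve S h f"
  let ?A = "\<Sum>\<^sub>\<infinity>\<alpha>. norm (f \<alpha>) * weight s \<alpha>"
  have bound: "(\<Sum>\<alpha>\<in>{\<alpha> :: 'n \<Rightarrow> nat. mono_num \<alpha> \<le> M}. norm (?u \<alpha>) * weight s \<alpha>) \<le> 2 * ?A" for M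
  proof -
    let ?T = "{\<alpha> :: 'n \<Rightarrow> nat. mono_num \<alpha> \<le> M}"
    have "(\<Sum>\<alpha>\<in>?T. norm (?u \<alpha>) * weight s \<alpha>) \<le> (\<Sum>\<alpha>\<in>?T. norm (f \<alpha>) * weight s \<alpha> +
        (\<Sum>\<gamma>\<in>{\<gamma>\<in>{\<gamma>\<in>?T. \<gamma> \<in> S}. mono_num \<gamma> < mono_num \<alpha>}. norm (?u \<gamma>) * norm (h \<gamma> \<alpha>) * weight s \<alpha>))"
    proof (rule sum_mono)
      fix \<alpha> assume "\<alpha> \<in> ?T"
      then have eq: "{\<gamma>\<in>{\<gamma>\<in>?T. \<gamma> \<in> S}. mono_num \<gamma> < mono_num \<alpha>} = {\<gamma>\<in>S. mono_num \<gamma> < mono_num \<alpha>}" by auto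
      have "norm (?u \<alpha>) \<le> norm (f \<alpha>) + (\<Sum>\<gamma>\<in>{\<gamma>\<in>S. mono_num \<gamma> < mono_num \<alpha>}. norm (?u \<gamma>) * norm (h \<gamma> \<alpha>))"
        unfolding solve.simps[of S h f \<alpha>]
        by (rule order_trans[OF norm_triangle_ineq4])
           (intro add_left_mono order_trans[OF norm_sum] eq_refl sum.cong refl norm_mult)
      then have "norm (?u \<alpha>) * weight s \<alpha> \<le> (norm (f \<alpha>) + (\<Sum>\<gamma>\<in>{\<gamma>\<in>S. mono_num \<gamma> < mono_num \<alpha>}. norm (?u \<gamma>) * norm (h \<gamma> \<alpha>))) * weight s \<alpha>"
        by (rule mult_right_mono) simp
      then show "norm (?u \<alpha>) * weight s \<alpha> \<le> norm (f \<alpha>) * weight s \<alpha> +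
        (\<Sum>\<gamma>\<in>{\<gamma>\<in>{\<gamma>\<in>?T. \<gamma> \<in> S}. mono_num \<gamma> < mono_num \<alpha>}. norm (?u \<gamma>) * norm (h \<gamma> \<alpha>) * weight s \<alpha>)"
        unfolding eq by (simp only: distrib_right sum_distrib_right)
    qed
    also have "\<dots> = (\<Sum>\<alpha>\<in>?T. norm (f \<alpha>) * weight s \<alpha>) +
        (\<Sum>\<gamma>\<in>{\<gamma>\<in>?T. \<gamma> \<in> S}. \<Sum>\<alpha>\<in>{\<alpha>\<in>?T. mono_num \<gamma> < mono_num \<alpha>}. norm (?u \<gamma>) * norm (h \<gamma> \<alpha>) * weight s \<alpha>)"
      unfolding sum.distrib by (subst sum.swap_restrict) auto
    also have "\<dots> \<le> ?A + (\<Sum>\<gamma>\<in>{\<gamma>\<in>?T. \<gamma> \<in> S}. norm (?u \<gamma>) * (1 / 2 * weight s \<gamma>))"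
    proof (intro add_mono sum_mono)
      show "(\<Sum>\<alpha>\<in>?T. norm (f \<alpha>) * weight s \<alpha>) \<le> ?A"
        by (rule finite_sum_le_infsum) (use f in \<open>auto simp: wsummable_def\<close>)
      fix \<gamma> assume \<gamma>: "\<gamma> \<in> {\<gamma>\<in>?T. \<gamma> \<in> S}"
      have "(\<Sum>\<alpha>\<in>{\<alpha>\<in>?T. mono_num \<gamma> < mono_num \<alpha>}. norm (h \<gamma> \<alpha>) * weight s \<alpha>) \<le> 1 / 2 * weight s \<gamma>"
        by (rule h) (use \<gamma> in auto)
      then show "(\<Sum>\<alpha>\<in>{\<alpha>\<in>?T. mono_num \<gamma> < mono_num \<alpha>}. norm (?u \<gamma>) * norm (h \<gamma> \<alpha>) * weight s \<alpha>) \<le> norm (?u \<gamma>) * (1 / 2 * weight s \<gamma>)"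
        by (simp only: mult.assoc sum_distrib_left[symmetric]) (rule mult_left_mono, auto)
    qed
    also have "(\<Sum>\<gamma>\<in>{\<gamma>\<in>?T. \<gamma> \<in> S}. norm (?u \<gamma>) * (1 / 2 * weight s \<gamma>)) \<le> (\<Sum>\<gamma>\<in>?T. norm (?u \<gamma>) * (1 / 2 * weight s \<gamma>))"
      by (rule sum_mono2) auto
    also have "\<dots> = 1 / 2 * (\<Sum>\<gamma>\<in>?T. norm (?u \<gamma>) * weight s \<gamma>)"
      by (simp add: sum_distrib_left)
    finally show ?thesis by simp
  qed
  show "bdd_above (sum (\<lambda>\<alpha>. norm (?u \<alpha>) * weight s \<alpha>) ` {F. F \<subseteq> UNIV \<and> finite F})"
  proof (rule bdd_aboveI2)
    fix F :: "('n \<Rightarrow> nat) set" assume "F \<in> {F. F \<subseteq> UNIV \<and> finite F}"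
    then have F: "finite F" by simp
    have "F \<subseteq> {\<alpha>. mono_num \<alpha> \<le> Max (mono_num ` F)}" using F by auto
    then have "(\<Sum>\<alpha>\<in>F. norm (?u \<alpha>) * weight s \<alpha>) \<le> (\<Sum>\<alpha>\<in>{\<alpha>. mono_num \<alpha> \<le> Max (mono_num ` F)}. norm (?u \<alpha>) * weight s \<alpha>)"
      by (intro sum_mono2) auto
    also have "\<dots> \<le> 2 * ?A" by (rule bound)
    finally show "(\<Sum>\<alpha>\<in>F. norm (?u \<alpha>) * weight s \<alpha>) \<le> 2 * ?A" .
  qed
qed simp

section \<open>Ideals are closed under coefficientwise limits\<close>

text \<open>In the instance below, \<open>S\<close> is the set of all leading exponents of elements
  of the ideal, \<open>b \<gamma>\<close> a divisor of \<gamma> among finitely many of them, and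
  \<open>G e\<close> an element with leading exponent \<open>e\<close> and leading coefficient 1.
  Leading means smallest integer, as suits power series. The completeness of \<open>S\<close> is
  recorded only through \<open>coef_eq_0\<close>.\<close>

locale standard_basis =
  fixes I :: "(complex ^ 'n::finite \<Rightarrow> complex) set set"
    and S :: "('n \<Rightarrow> nat) set" and b :: "('n \<Rightarrow> nat) \<Rightarrow> 'n \<Rightarrow> nat"
    and G :: "('n \<Rightarrow> nat) \<Rightarrow> complex ^ 'n \<Rightarrow> complex"
  assumes ideal: "ideal I germ_ring"
    and finite_b: "finite (b ` S)"
    and b_le: "\<gamma> \<in> S \<Longrightarrow> b \<gamma> \<le> \<gamma>"
    and G_I: "e \<in> b ` S \<Longrightarrow> germ (G e) \<in> I"
    and G_lead: "e \<in> b ` S \<Longrightarrow> coef (G e) e = 1"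
    and G_below: "e \<in> b ` S \<Longrightarrow> mono_num \<beta> < mono_num e \<Longrightarrow> coef (G e) \<beta> = 0"
    and coef_eq_0: "germ g \<in> I \<Longrightarrow> (\<And>\<gamma>. \<gamma> \<in> S \<Longrightarrow> coef g \<gamma> = 0) \<Longrightarrow> coef g = (\<lambda>_. 0)"
begin

definition cofactor :: "('n \<Rightarrow> nat) \<Rightarrow> 'n \<Rightarrow> nat" where
  "cofactor \<gamma> = (\<lambda>i. \<gamma> i - b \<gamma> i)"

text \<open>\<open>H \<gamma>\<close> lists the coefficients of the monomial multiple of \<open>G (b \<gamma>)\<close> with leading exponent \<open>\<gamma>\<close>.\<close>

definition H :: "('n \<Rightarrow> nat) \<Rightarrow> ('n \<Rightarrow> nat) \<Rightarrow> complex" where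
  "H \<gamma> \<alpha> = (if cofactor \<gamma> \<le> \<alpha> then coef (G (b \<gamma>)) (\<lambda>i. \<alpha> i - cofactor \<gamma> i) else 0)"

definition remainder :: "(('n \<Rightarrow> nat) \<Rightarrow> complex) \<Rightarrow> ('n \<Rightarrow> nat) \<Rightarrow> complex" where
  "remainder f \<alpha> = (if \<alpha> \<in> S then 0 else solve S H f \<alpha>)"

lemma cofactor_add: "\<gamma> \<in> S \<Longrightarrow> (\<lambda>i. cofactor \<gamma> i + b \<gamma> i) = \<gamma>"
  using b_le[of \<gamma>] by (auto simp: cofactor_def le_fun_def)

lemma split_shift: "cofactor \<gamma> \<le> \<alpha> \<Longrightarrow> (\<lambda>i. cofactor \<gamma> i + (\<alpha> i - cofactor \<gamma> i)) = \<alpha>"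
  by (auto simp: le_fun_def)

lemma H_diag: "\<gamma> \<in> S \<Longrightarrow> H \<gamma> \<gamma> = 1"
  using G_lead[of "b \<gamma>"] b_le[of \<gamma>] cofactor_add[of \<gamma>]
  by (auto simp: H_def cofactor_def le_fun_def)

text \<open>Multiplication by a monomial multiplies all integers by one factor and so preserves the
  order of exponents.\<close>

lemma H_below:
  assumes "\<gamma> \<in> S" "mono_num \<alpha> < mono_num \<gamma>"
  shows "H \<gamma> \<alpha> = 0"
proof (cases "cofactor \<gamma> \<le> \<alpha>")
  case True
  have "mono_num \<alpha> = mono_num (cofactor \<gamma>) * mono_num (\<lambda>i. \<alpha> i - cofactor \<gamma> i)" using mono_num_add split_shift[OF True] by metis
  moreover have "mono_num \<gamma> = mono_num (cofactor \<gamma>) * mono_num (b \<gamma>)" using mono_num_add cofactor_add[OF assms(1)] by metis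
  ultimately have "mono_num (\<lambda>i. \<alpha> i - cofactor \<gamma> i) < mono_num (b \<gamma>)" using assms(2) by simp
  then show ?thesis using G_below[of "b \<gamma>"] assms(1) by (simp add: H_def)
qed (simp add: H_def)

lemma holo0_G: "e \<in> b ` S \<Longrightarrow> holo0 (G e)"
  using ideal_holo0[OF ideal G_I] .

definition dominant :: "nat \<Rightarrow> bool" where
  "dominant s \<longleftrightarrow> (\<forall>\<gamma>\<in>S. \<forall>T. finite T \<longrightarrow> \<gamma> \<notin> T \<longrightarrow>
    (\<Sum>\<alpha>\<in>T. norm (H \<gamma> \<alpha>) * weight s \<alpha>) \<le> 1 / 2 * weight s \<gamma>)"

text \<open>Multiplication by a monomial also scales all weights by one factor, so the tail estimate
  for \<open>G (b \<gamma>)\<close> is the one for \<open>H \<gamma>\<close>. Finitely many basis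
  elements then give one threshold for all \<gamma> in \<open>S\<close>, of which there may be
  infinitely many.\<close>

lemma eventually_dominant: "\<exists>s1. \<forall>s\<ge>s1. dominant s"
proof -
  define P where "P e s1 \<longleftrightarrow> (\<forall>s\<ge>s1. \<forall>T. finite T \<longrightarrow> e \<notin> T \<longrightarrow>
      (\<Sum>\<alpha>\<in>T. norm (coef (G e) \<alpha>) * weight s \<alpha>) \<le> 1 / 2 * weight s e)" for e s1
  have "\<exists>s1. P e s1" if e: "e \<in> b ` S" for e
  proof -
    obtain r where "r > 0" "converges r (coef (G e))" using holo0_expand[OF holo0_G[OF e]] by metis
    then obtain s0 where s0: "wsummable s0 (coef (G e))" using converges_imp_wsummable by metis
    obtain s1 where s1: "\<And>s T. s1 \<le> s \<Longrightarrow> finite T \<Longrightarrow> e \<notin> T \<Longrightarrow>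
      (\<Sum>\<alpha>\<in>T. norm (coef (G e) \<alpha>) * weight s \<alpha>) \<le> 1 / 2 * weight s e"
      by (rule tail_bound[OF s0 G_below[OF e], where \<epsilon> = "1 / 2"]) auto
    show ?thesis unfolding P_def using s1 by blast
  qed
  then obtain s1 where P: "\<And>e. e \<in> b ` S \<Longrightarrow> P e (s1 e)" by metis
  have s1: "\<And>e s T. e \<in> b ` S \<Longrightarrow> s1 e \<le> s \<Longrightarrow> finite T \<Longrightarrow> e \<notin> T \<Longrightarrow>
        (\<Sum>\<alpha>\<in>T. norm (coef (G e) \<alpha>) * weight s \<alpha>) \<le> 1 / 2 * weight s e"
    using P unfolding P_def by blast
  \<comment> \<open>Inserting 0 covers an empty \<open>S\<close>.\<close>
  define m where "m = Max (insert 0 (s1 ` b ` S))"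
  have m: "s1 e \<le> m" if "e \<in> b ` S" for e
    unfolding m_def using finite_b that by (intro Max_ge) auto
  show ?thesis
    unfolding dominant_def
  proof (intro exI[of _ m] ballI allI impI)
    fix s \<gamma> T assume s: "m \<le> s"
    assume \<gamma>: "\<gamma> \<in> S" and T: "finite T" "\<gamma> \<notin> T"
    let ?e = "b \<gamma>" and ?T = "{\<alpha>\<in>T. cofactor \<gamma> \<le> \<alpha>}"
    let ?sub = "\<lambda>\<alpha> i. \<alpha> i - cofactor \<gamma> i"
    have inj: "inj_on ?sub ?T"
      by (rule inj_on_inverseI[where g = "\<lambda>\<beta> i. cofactor \<gamma> i + \<beta> i"]) (simp add: split_shift)
    have "(\<Sum>\<alpha>\<in>T. norm (H \<gamma> \<alpha>) * weight s \<alpha>) = (\<Sum>\<alpha>\<in>?T. norm (H \<gamma> \<alpha>) * weight s \<alpha>)"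
      using T by (intro sum.mono_neutral_right) (auto simp: H_def)
    also have "\<dots> = (\<Sum>\<alpha>\<in>?T. weight s (cofactor \<gamma>) * (norm (coef (G ?e) (?sub \<alpha>)) * weight s (?sub \<alpha>)))"
    proof (rule sum.cong)
      fix \<alpha> assume "\<alpha> \<in> ?T"
      then have "weight s \<alpha> = weight s (cofactor \<gamma>) * weight s (?sub \<alpha>)" using weight_add[of s "cofactor \<gamma>" "?sub \<alpha>"] split_shift[of \<gamma> \<alpha>] by simp
      then show "norm (H \<gamma> \<alpha>) * weight s \<alpha> = weight s (cofactor \<gamma>) * (norm (coef (G ?e) (?sub \<alpha>)) * weight s (?sub \<alpha>))"
        using \<open>\<alpha> \<in> ?T\<close> by (simp add: H_def)
    qed simp
    also have "\<dots> = weight s (cofactor \<gamma>) * (\<Sum>\<beta>\<in>?sub ` ?T. norm (coef (G ?e) \<beta>) * weight s \<beta>)"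
      by (simp only: sum.reindex[OF inj] o_def sum_distrib_left)
    also have "\<dots> \<le> weight s (cofactor \<gamma>) * (1 / 2 * weight s ?e)"
    proof (rule mult_left_mono, rule s1)
      show "s1 ?e \<le> s" using m[of ?e] s \<gamma> by fastforce
      show "?e \<notin> ?sub ` ?T"
      proof
        assume "?e \<in> ?sub ` ?T"
        then obtain \<alpha> where \<alpha>: "\<alpha> \<in> ?T" "?e = ?sub \<alpha>" by blast
        then have "\<alpha> = \<gamma>" using split_shift[of \<gamma> \<alpha>] cofactor_add[OF \<gamma>] by simp
        then show False using \<alpha> T by simp
      qed
    qed (use \<gamma> T in auto)
    also have "\<dots> = 1 / 2 * weight s \<gamma>" using weight_add[of s "cofactor \<gamma>" "b \<gamma>"] cofactor_add[OF \<gamma>] by simp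
    finally show "(\<Sum>\<alpha>\<in>T. norm (H \<gamma> \<alpha>) * weight s \<alpha>) \<le> 1 / 2 * weight s \<gamma>" .
  qed
qed

lemma division:
  assumes f: "holo0 f"
  obtains Q where "germ Q \<in> I" "\<And>\<alpha>. coef f \<alpha> - coef Q \<alpha> = remainder (coef f) \<alpha>"
proof -
  obtain s1 where s1: "\<forall>s\<ge>s1. dominant s" using eventually_dominant by blast
  obtain r where "r > 0" "converges r (coef f)" using holo0_expand[OF f] by metis
  then obtain s0 where s0: "wsummable s0 (coef f)" using converges_imp_wsummable by metis
  define s where "s = max s0 s1"
  define u where "u = solve S H (coef f)"
  have u: "wsummable s u"
    unfolding u_def
  proof (rule solve_wsummable)
    show "wsummable s (coef f)" by (rule wsummable_mono[OF s0]) (simp add: s_def)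
    have "dominant s" using s1 by (simp add: s_def)
    then show "(\<Sum>\<alpha>\<in>T. norm (H \<gamma> \<alpha>) * weight s \<alpha>) \<le> 1 / 2 * weight s \<gamma>"
      if "\<gamma> \<in> S" "finite T" "\<gamma> \<notin> T" for \<gamma> T
      using that unfolding dominant_def by blast
  qed
  \<comment> \<open>The coefficient \<open>u \<gamma>\<close> goes to the single basis element
    \<open>b \<gamma>\<close>, at the exponent \<open>cofactor \<gamma>\<close>. The test
    \<open>b \<gamma> = e\<close> keeps a \<gamma> divisible by several basis exponents from being
    counted more than once.\<close>
  define q where "q e \<beta> = (let \<gamma> = (\<lambda>i. \<beta> i + e i) in if \<gamma> \<in> S \<and> b \<gamma> = e then u \<gamma> else 0)" for e \<beta>
  have q: "wsummable s (q e)" for e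
    unfolding wsummable_def
  proof (rule summable_on_comparison_test)
    have inj: "inj (\<lambda>\<beta> i. \<beta> i + e i)" by (rule injI) (auto simp: fun_eq_iff)
    have "(\<lambda>\<alpha>. norm (u \<alpha>) * weight s \<alpha>) summable_on range (\<lambda>\<beta> i. \<beta> i + e i)"
      by (rule summable_on_subset_banach[OF u[unfolded wsummable_def]]) simp
    then have "(\<lambda>\<beta>. norm (u (\<lambda>i. \<beta> i + e i)) * weight s (\<lambda>i. \<beta> i + e i)) summable_on UNIV"
      by (simp add: summable_on_reindex[OF inj] o_def)
    \<comment> \<open>Shifting exponents by \<open>e\<close> multiplies the weights by a constant,
      so a quotient inherits summability from \<open>u\<close>.\<close>
    then show "(\<lambda>\<beta>. norm (u (\<lambda>i. \<beta> i + e i)) * weight s (\<lambda>i. \<beta> i + e i) * (1 / weight s e)) summable_on UNIV"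
      by (rule summable_on_cmult_left)
    show "norm (q e \<beta>) * weight s \<beta> \<le> norm (u (\<lambda>i. \<beta> i + e i)) * weight s (\<lambda>i. \<beta> i + e i) * (1 / weight s e)" for \<beta>
      using weight_pos[of s e] by (simp add: q_def Let_def weight_add del: weight_pos)
  qed auto
  have hq: "holo0 (pseries (q e))" and cq: "coef (pseries (q e)) = q e" for e
    using wsummable_imp_converges[OF q[of e]] holo0_pseries coef_pseries by metis+
  define Q where "Q z = (\<Sum>e\<in>b ` S. pseries (q e) z * G e z)" for z
  have "germ Q \<in> I"
    unfolding Q_def using G_I by (intro ideal_sum[OF ideal] ideal_mult[OF ideal hq])
  \<comment> \<open>The double sum over basis elements and exponents of their quotients is regrouped
    by \<gamma> = \<beta> + e. The index sets of the two sides differ only where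
    \<open>H \<gamma> \<alpha>\<close> vanishes.\<close>
  moreover have "coef Q \<alpha> = (\<Sum>\<gamma>\<in>{\<gamma>\<in>S. mono_num \<gamma> \<le> mono_num \<alpha>}. u \<gamma> * H \<gamma> \<alpha>)" for \<alpha>
  proof -
    let ?V = "{\<gamma>\<in>S. cofactor \<gamma> \<le> \<alpha>}" and ?M = "{\<gamma>\<in>S. mono_num \<gamma> \<le> mono_num \<alpha>}"
    let ?P = "{(e, \<beta>). e \<in> b ` S \<and> \<beta> \<le> \<alpha> \<and> (\<lambda>i. \<beta> i + e i) \<in> S \<and> b (\<lambda>i. \<beta> i + e i) = e}"
    let ?t = "\<lambda>(e, \<beta>). q e \<beta> * coef (G e) (\<lambda>i. \<alpha> i - \<beta> i)"
    have finP: "finite (b ` S \<times> {..\<alpha>})" using finite_b by simp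
    have "coef Q \<alpha> = (\<Sum>e\<in>b ` S. convolve (q e) (coef (G e)) \<alpha>)"
      unfolding Q_def using coef_sum[of "b ` S" "\<lambda>e z. pseries (q e) z * G e z" \<alpha>] holo0_mult[OF hq holo0_G]
      by (simp add: coef_mult[OF hq holo0_G] cq)
    also have "\<dots> = (\<Sum>x\<in>b ` S \<times> {..\<alpha>}. ?t x)"
      by (simp add: convolve_def sum.cartesian_product)
    also have "\<dots> = (\<Sum>x\<in>?P. ?t x)"
      by (rule sum.mono_neutral_right[OF finP]) (auto simp: q_def Let_def split: if_splits)
    also have "\<dots> = (\<Sum>\<gamma>\<in>?V. u \<gamma> * H \<gamma> \<alpha>)"
    proof (rule sum.reindex_bij_witness[where i = "\<lambda>\<gamma>. (b \<gamma>, cofactor \<gamma>)" and j = "\<lambda>(e, \<beta>) i. \<beta> i + e i"])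
      fix x assume x: "x \<in> ?P"
      obtain e \<beta> where [simp]: "x = (e, \<beta>)" by fastforce
      have e: "b (\<lambda>i. \<beta> i + e i) = e" "(\<lambda>i. \<beta> i + e i) \<in> S" "\<beta> \<le> \<alpha>" using x by auto
      have sf: "cofactor (\<lambda>i. \<beta> i + e i) = \<beta>" by (simp add: cofactor_def e(1))
      show "(b (case x of (e, \<beta>) \<Rightarrow> \<lambda>i. \<beta> i + e i), cofactor (case x of (e, \<beta>) \<Rightarrow> \<lambda>i. \<beta> i + e i)) = x"
        by (simp add: e(1) sf)
      show "(case x of (e, \<beta>) \<Rightarrow> \<lambda>i. \<beta> i + e i) \<in> ?V" using e sf by simp
      show "u (case x of (e, \<beta>) \<Rightarrow> \<lambda>i. \<beta> i + e i) * H (case x of (e, \<beta>) \<Rightarrow> \<lambda>i. \<beta> i + e i) \<alpha> = ?t x"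
        using e sf by (simp add: q_def Let_def H_def)
    next
      fix \<gamma> assume \<gamma>: "\<gamma> \<in> ?V"
      then show "(case (b \<gamma>, cofactor \<gamma>) of (e, \<beta>) \<Rightarrow> \<lambda>i. \<beta> i + e i) = \<gamma>" by (simp add: cofactor_add)
      show "(b \<gamma>, cofactor \<gamma>) \<in> ?P" using \<gamma> by (simp add: cofactor_add)
    qed
    also have "\<dots> = (\<Sum>\<gamma>\<in>?M. u \<gamma> * H \<gamma> \<alpha>)"
    proof (rule sum.mono_neutral_cong)
      show "finite ?M" by (rule finite_subset[OF _ finite_mono_num(2)[of "mono_num \<alpha>"]]) auto
      have "?V \<subseteq> (\<lambda>(e, \<beta>) i. \<beta> i + e i) ` (b ` S \<times> {..\<alpha>})"
      proof
        fix \<gamma> assume "\<gamma> \<in> ?V"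
        then show "\<gamma> \<in> (\<lambda>(e, \<beta>) i. \<beta> i + e i) ` (b ` S \<times> {..\<alpha>})"
          using cofactor_add[of \<gamma>] by (intro image_eqI[of _ _ "(b \<gamma>, cofactor \<gamma>)"]) auto
      qed
      then show "finite ?V" using finP finite_subset by blast
      show "u \<gamma> * H \<gamma> \<alpha> = 0" if "\<gamma> \<in> ?M - ?V" for \<gamma> using that by (auto simp: H_def)
      show "u \<gamma> * H \<gamma> \<alpha> = 0" if "\<gamma> \<in> ?V - ?M" for \<gamma> using that H_below[of \<gamma> \<alpha>] by auto
    qed simp
    finally show ?thesis .
  qed
  then have "coef f \<alpha> - coef Q \<alpha> = remainder (coef f) \<alpha>" for \<alpha>
    using solve_eq[where S = S and h = H and f = "coef f" and \<alpha> = \<alpha>, OF H_diag] by (simp add: u_def remainder_def)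
  ultimately show ?thesis using that by blast
qed

text \<open>The remainder is the coefficient family of g - Q, an element of the ideal, and it
  vanishes on \<open>S\<close> by construction; by completeness of \<open>S\<close> it is
  zero.\<close>

lemma remainder_eq_0:
  assumes g: "germ g \<in> I"
  shows "remainder (coef g) \<alpha> = 0"
proof -
  obtain Q where Q: "germ Q \<in> I" "\<And>\<alpha>. coef g \<alpha> - coef Q \<alpha> = remainder (coef g) \<alpha>"
    using division[OF ideal_holo0[OF ideal g]] by metis
  have c: "coef (\<lambda>z. g z - Q z) \<alpha> = remainder (coef g) \<alpha>" for \<alpha>
    using coef_diff0[OF ideal_holo0[OF ideal g] ideal_holo0[OF ideal Q(1)]] Q(2) by simp
  have "coef (\<lambda>z. g z - Q z) = (\<lambda>_. 0)"
    by (rule coef_eq_0[OF ideal_diff[OF ideal g Q(1)]]) (simp add: c remainder_def)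
  then show ?thesis using c by metis
qed

text \<open>The remainders of the approximants vanish, hence so does their coefficientwise limit,
  the remainder of \<open>f\<close>. Then \<open>f\<close> has the coefficients of an element of the
  ideal, and equality of germs follows by uniqueness.\<close>

lemma closed:
  assumes f: "holo0 f" and g: "\<And>m. germ (g m) \<in> I" and lim: "\<And>\<alpha>. (\<lambda>m. coef (g m) \<alpha>) \<longlonglongrightarrow> coef f \<alpha>"
  shows "germ f \<in> I"
proof -
  have "remainder (coef f) \<alpha> = 0" for \<alpha>
  proof -
    have "(\<lambda>m. remainder (coef (g m)) \<alpha>) \<longlonglongrightarrow> remainder (coef f) \<alpha>"
      using solve_tendsto[OF lim, where S = S and h = H and \<alpha> = \<alpha>] by (simp add: remainder_def)
    then have "(\<lambda>m. 0) \<longlonglongrightarrow> remainder (coef f) \<alpha>" by (simp only: remainder_eq_0[OF g])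
    then show ?thesis by (simp add: LIMSEQ_const_iff)
  qed
  moreover obtain Q where Q: "germ Q \<in> I" "\<And>\<alpha>. coef f \<alpha> - coef Q \<alpha> = remainder (coef f) \<alpha>"
    using division[OF f] by metis
  ultimately have "coef f = coef Q" by (auto simp: fun_eq_iff)
  then show ?thesis using germ_eq_if_coef_eq[OF f ideal_holo0[OF ideal Q(1)]] Q(1) by simp
qed

end

text \<open>The finite basis comes from Dickson's lemma for leading exponents, without an appeal to
  the Noetherian property of the ring of germs.\<close>

theorem ideal_closed:
  fixes I :: "(complex ^ 'n::finite \<Rightarrow> complex) set set"
  assumes I: "ideal I germ_ring" and f: "holo0 f" and g: "\<And>m. germ (g m) \<in> I"
    and lim: "\<And>\<alpha>. (\<lambda>m. coef (g m) \<alpha>) \<longlonglongrightarrow> coef f \<alpha>"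
  shows "germ f \<in> I"
proof -
  define lead where "lead e h \<longleftrightarrow> germ h \<in> I \<and> coef h e = 1 \<and> (\<forall>\<beta>. mono_num \<beta> < mono_num e \<longrightarrow> coef h \<beta> = 0)"
    for e and h :: "complex ^ 'n \<Rightarrow> complex"
  define S where "S = {e. \<exists>h. lead e h}"
  obtain E where E: "finite E" "E \<subseteq> S" "\<And>\<gamma>. \<gamma> \<in> S \<Longrightarrow> \<exists>e\<in>E. e \<le> \<gamma>" using dickson by metis
  define b where "b \<gamma> = (SOME e. e \<in> E \<and> e \<le> \<gamma>)" for \<gamma>
  have b: "b \<gamma> \<in> E \<and> b \<gamma> \<le> \<gamma>" if "\<gamma> \<in> S" for \<gamma>
  proof -
    have "\<exists>e. e \<in> E \<and> e \<le> \<gamma>" using E(3)[OF that] by blast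
    from someI_ex[OF this] show ?thesis by (simp only: b_def)
  qed
  define G where "G e = (SOME h. lead e h)" for e
  have G: "lead e (G e)" if "e \<in> S" for e
  proof -
    have "\<exists>h. lead e h" using that by (simp add: S_def)
    from someI_ex[OF this] show ?thesis by (simp only: G_def)
  qed
  have G': "lead e (G e)" if "e \<in> b ` S" for e
    by (rule G) (use b E(2) that in auto)
  interpret standard_basis I S b G
  proof (rule standard_basis.intro)
    show "ideal I germ_ring" by (rule I)
    show "finite (b ` S)" by (rule finite_subset[OF _ E(1)]) (use b in auto)
    fix h assume h: "germ h \<in> I" and van: "\<And>\<gamma>. \<gamma> \<in> S \<Longrightarrow> coef h \<gamma> = 0"
    show "coef h = (\<lambda>_. 0)"
    proof (rule ccontr)
      assume "coef h \<noteq> (\<lambda>_. 0)"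
      then obtain \<alpha> where \<alpha>: "coef h \<alpha> \<noteq> 0" by auto
      \<comment> \<open>The leading exponent of \<open>h\<close>; dividing by its coefficient puts
        it into \<open>S\<close>, where \<open>h\<close> was assumed to vanish.\<close>
      define e where "e = (ARG_MIN mono_num \<alpha>. coef h \<alpha> \<noteq> 0)"
      have e: "coef h e \<noteq> 0" "\<And>\<beta>. coef h \<beta> \<noteq> 0 \<Longrightarrow> mono_num e \<le> mono_num \<beta>"
        unfolding e_def
        by (rule arg_min_natI[of "\<lambda>\<alpha>. coef h \<alpha> \<noteq> 0", OF \<alpha>])
           (rule arg_min_nat_le[of "\<lambda>\<alpha>. coef h \<alpha> \<noteq> 0"])
      have "lead e (\<lambda>z. inverse (coef h e) * h z)"
        unfolding lead_def coef_cmult[OF ideal_holo0[OF I h]]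
      proof (intro conjI allI impI)
        show "germ (\<lambda>z. inverse (coef h e) * h z) \<in> I" by (rule ideal_mult[OF I holo0_const h])
        show "inverse (coef h e) * coef h e = 1" using e(1) by simp
        show "inverse (coef h e) * coef h \<beta> = 0" if "mono_num \<beta> < mono_num e" for \<beta>
          using e(2)[of \<beta>] that by fastforce
      qed
      then have "e \<in> S" by (auto simp: S_def)
      then show False using van e(1) by blast
    qed
  qed (use b G' in \<open>auto simp: lead_def\<close>)
  show ?thesis by (rule closed[OF f g lim])
qed

section \<open>The sub-mean value property\<close>

lemma nn_integral_lborel_shift:
  fixes f :: "'a::euclidean_space \<Rightarrow> ennreal"
  assumes [measurable]: "f \<in> borel_measurable borel"
  shows "(\<integral>\<^sup>+x. f (c + x) \<partial>lborel) = (\<integral>\<^sup>+x. f x \<partial>lborel)"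
  by (subst (2) lborel_distr_plus[of c, symmetric]) (simp add: nn_integral_distr)

text \<open>Haar uniqueness in miniature: both sides are compared on \<open>E\<close> after averaging against a ball.\<close>

lemma lborel_isometry:
  fixes T :: "'a::euclidean_space \<Rightarrow> 'a"
  assumes T: "linear T" "\<And>x. norm (T x) = norm x"
  shows "distr lborel borel T = lborel"
proof (rule measure_eqI)
  have cT: "continuous_on UNIV T" using T(1) by (simp add: linear_continuous_on linear_conv_bounded_linear)
  then have [measurable]: "T \<in> borel_measurable borel" by (rule borel_measurable_continuous_onI)
  have surj: "surj T"
  proof (rule linear_injective_imp_surjective[OF T(1)])
    have "x = 0" if "T x = 0" for x using T(2)[of x] that by simp
    then show "inj T" by (simp add: linear_injective_0[OF T(1)])
  qed simp
  show "sets (distr lborel borel T) = sets lborel" by simp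
  fix E assume "E \<in> sets (distr lborel borel T)"
  then have [measurable]: "E \<in> sets borel" by simp
  let ?B = "ball (0::'a) 1"
  have [measurable]: "?B \<in> sets borel" by simp
  \<comment> \<open>\<open>y\<close> ranges over the unit ball about \<open>T x\<close> and
    \<open>T x\<close> over \<open>E\<close>. Integrating first in \<open>y\<close> splits off the
    volume of the ball.\<close>
  let ?F = "\<lambda>x y. indicator E (T x) * indicator ?B (y - T x) :: ennreal"
  have m: "(\<lambda>(x, y). ?F x y) \<in> borel_measurable (lborel \<Otimes>\<^sub>M lborel)"
    by measurable
  have m2: "(\<lambda>(x, y). indicator E (T x + y) * indicator ?B x :: ennreal) \<in> borel_measurable (lborel \<Otimes>\<^sub>M lborel)"
    by measurable
  have "emeasure lborel (T -` E) * emeasure lborel ?B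
      = (\<integral>\<^sup>+x. indicator E (T x) * emeasure lborel ?B \<partial>lborel)"
    using measurable_sets[of T borel borel E]
    by (subst nn_integral_multc) (auto simp flip: nn_integral_indicator simp: indicator_def intro!: nn_integral_cong)
  also have "\<dots> = (\<integral>\<^sup>+x. \<integral>\<^sup>+y. ?F x y \<partial>lborel \<partial>lborel)"
  proof (rule nn_integral_cong)
    fix x
    have "(\<integral>\<^sup>+y. indicator ?B (y - T x) \<partial>lborel) = emeasure lborel ?B"
      using nn_integral_lborel_shift[of "indicator ?B" "- T x"] by (simp add: algebra_simps)
    then show "indicator E (T x) * emeasure lborel ?B = (\<integral>\<^sup>+y. ?F x y \<partial>lborel)"
      by (subst nn_integral_cmult) auto
  qed
  also have "\<dots> = (\<integral>\<^sup>+y. \<integral>\<^sup>+x. ?F x y \<partial>lborel \<partial>lborel)"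
    using lborel_pair.Fubini'[OF m] by simp
  \<comment> \<open>With y = T w and x replaced by w + x, the condition on y - T x becomes that
    \<open>T x\<close> lies in the unit ball, equivalently \<open>x\<close> does. Afterwards
    \<open>y\<close> occurs only as a translation of \<open>E\<close>.\<close>
  also have "\<dots> = (\<integral>\<^sup>+y. \<integral>\<^sup>+x. indicator E (T x + y) * indicator ?B x \<partial>lborel \<partial>lborel)"
  proof (rule nn_integral_cong)
    fix y
    obtain w where w: "y = T w" using surj by (metis surjD)
    have "(\<integral>\<^sup>+x. ?F x y \<partial>lborel) = (\<integral>\<^sup>+x. ?F (w + x) y \<partial>lborel)"
      by (rule nn_integral_lborel_shift[symmetric]) measurable
    also have "\<dots> = (\<integral>\<^sup>+x. indicator E (T x + y) * indicator ?B x \<partial>lborel)"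
      by (rule nn_integral_cong) (auto simp: w linear_add[OF T(1)] indicator_def T(2) add.commute)
    finally show "(\<integral>\<^sup>+x. ?F x y \<partial>lborel) = (\<integral>\<^sup>+x. indicator E (T x + y) * indicator ?B x \<partial>lborel)" .
  qed
  also have "\<dots> = (\<integral>\<^sup>+x. \<integral>\<^sup>+y. indicator E (T x + y) * indicator ?B x \<partial>lborel \<partial>lborel)"
    using lborel_pair.Fubini'[OF m2] by simp
  also have "\<dots> = (\<integral>\<^sup>+x. emeasure lborel E * indicator ?B x \<partial>lborel)"
  proof (rule nn_integral_cong)
    fix x
    have "(\<integral>\<^sup>+y. indicator E (T x + y) \<partial>lborel) = emeasure lborel E"
      using nn_integral_lborel_shift[of "indicator E" "T x"] by simp
    then show "(\<integral>\<^sup>+y. indicator E (T x + y) * indicator ?B x \<partial>lborel) = emeasure lborel E * indicator ?B x"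
      by (subst nn_integral_multc) auto
  qed
  also have "\<dots> = emeasure lborel E * emeasure lborel ?B" by (simp add: nn_integral_cmult)
  finally have eq: "emeasure lborel (T -` E) * emeasure lborel ?B = emeasure lborel E * emeasure lborel ?B" .
  have B: "emeasure lborel ?B \<noteq> 0" "emeasure lborel ?B \<noteq> \<infinity>"
    using emeasure_lborel_ball_finite[of "0::'a" 1] content_ball_pos[of 1 "0::'a"]
    by (auto simp: measure_def)
  have "emeasure lborel (T -` E) = emeasure lborel E"
  proof -
    have "emeasure lborel (T -` E) * emeasure lborel ?B / emeasure lborel ?B = emeasure lborel E * emeasure lborel ?B / emeasure lborel ?B"
      by (simp only: eq)
    then show ?thesis using B by (simp add: ennreal_mult_divide_eq)
  qed
  then show "emeasure (distr lborel borel T) E = emeasure lborel E"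
    by (simp add: emeasure_distr)
qed

lemma circle_mean_value:
  assumes "g holomorphic_on cball 0 1"
  shows "ennreal (norm (g 0)) \<le> (\<integral>\<^sup>+\<theta>\<in>{0..1}. ennreal (norm (g (exp (2 * of_real pi * \<i> * of_real \<theta>)))) \<partial>lborel)"
proof -
  let ?e = "\<lambda>\<theta> :: real. exp (2 * of_real pi * \<i> * of_real \<theta>)"
  have "((\<lambda>u. g u / (u - 0)) has_contour_integral (2 * of_real pi * \<i> * g 0)) (circlepath 0 1)"
    by (rule Cauchy_integral_circlepath_simple[OF assms]) simp
  then have "((\<lambda>\<theta>. g (?e \<theta>) / ?e \<theta> * (2 * of_real pi * \<i> * ?e \<theta>)) has_integral (2 * of_real pi * \<i> * g 0)) {0..1}"
    unfolding has_contour_integral_def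
  proof (rule has_integral_eq[rotated])
    fix \<theta> :: real assume "\<theta> \<in> {0..1}"
    then have "vector_derivative (circlepath 0 1) (at \<theta> within {0..1}) = 2 * of_real pi * \<i> * ?e \<theta>"
      using vector_derivative_circlepath01[of \<theta> 0 1] by simp
    then show "g (circlepath 0 1 \<theta>) / (circlepath 0 1 \<theta> - 0) * vector_derivative (circlepath 0 1) (at \<theta> within {0..1}) =
        g (?e \<theta>) / ?e \<theta> * (2 * of_real pi * \<i> * ?e \<theta>)"
      by (simp only:) (simp add: circlepath)
  qed
  then have "((\<lambda>\<theta>. inverse (2 * of_real pi * \<i>) * (g (?e \<theta>) / ?e \<theta> * (2 * of_real pi * \<i> * ?e \<theta>))) has_integral
      inverse (2 * of_real pi * \<i>) * (2 * of_real pi * \<i> * g 0)) {0..1}"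
    by (rule has_integral_mult_right)
  then have int: "((\<lambda>\<theta>. g (?e \<theta>)) has_integral g 0) {0..1}"
    by (simp add: field_simps)
  have cont: "continuous_on {0..1} (\<lambda>\<theta>. g (?e \<theta>))"
    by (rule continuous_on_compose2[OF holomorphic_on_imp_continuous_on[OF assms]])
       (auto intro!: continuous_intros simp: norm_exp_eq_Re)
  have intn: "(\<lambda>\<theta>. norm (g (?e \<theta>))) integrable_on {0..1}"
    by (intro integrable_continuous_interval continuous_on_norm cont)
  have "norm (g 0) \<le> integral {0..1} (\<lambda>\<theta>. norm (g (?e \<theta>)))"
    using integral_norm_bound_integral[OF _ intn, of "\<lambda>\<theta>. g (?e \<theta>)"] int by (auto simp: has_integral_iff)
  then have "ennreal (norm (g 0)) \<le> ennreal (integral {0..1} (\<lambda>\<theta>. norm (g (?e \<theta>))))"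
    by (rule ennreal_leI)
  also have "\<dots> = (\<integral>\<^sup>+\<theta>\<in>{0..1}. ennreal (norm (g (?e \<theta>))) \<partial>lborel)"
    by (rule nn_integral_has_integral_lebesgue'[symmetric]) (use intn in \<open>auto simp: integrable_integral\<close>)
  finally show ?thesis .
qed

lemma norm_vector_scalar_mult: "norm (c *s z) = norm c * norm (z :: complex ^ 'n::finite)"
  by (simp add: norm_vec_def L2_set_def norm_mult power_mult_distrib real_sqrt_mult flip: sum_distrib_left)

lemma holo_on_line:
  assumes f: "holo_on f D"
  shows "(\<lambda>w. f (a + w *s z)) holomorphic_on {w. a + w *s z \<in> D}"
  unfolding holomorphic_on_def
proof
  fix w assume w: "w \<in> {w. a + w *s z \<in> D}"
  then obtain f' where f': "(f has_derivative f') (at (a + w *s z))" "\<And>c v. f' (c *s v) = c * f' v"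
    using f by (auto simp: holo_on_def)
  have bl: "bounded_linear (\<lambda>w. w *s z)"
  proof (rule bounded_linear_intro[where K = "norm z"])
    show "norm (w *s z) \<le> norm w * norm z" for w by (simp add: norm_vector_scalar_mult)
  qed (simp_all add: vec_eq_iff algebra_simps)
  have "((\<lambda>w. a + w *s z) has_derivative (\<lambda>w. w *s z)) (at w)"
    by (auto intro!: derivative_eq_intros bounded_linear.has_derivative[OF bl])
  then have "((\<lambda>w. f (a + w *s z)) has_derivative (\<lambda>w. f' (w *s z))) (at w)"
    using diff_chain_at[of "\<lambda>w. a + w *s z" "\<lambda>w. w *s z" w f f'] f' by (simp add: o_def)
  moreover have "(\<lambda>w. f' (w *s z)) = (*) (f' z)"
    by (rule ext) (simp add: f'(2))
  ultimately have "((\<lambda>w. f (a + w *s z)) has_field_derivative f' z) (at w)"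
    by (simp only: has_field_derivative_def)
  then show "(\<lambda>w. f (a + w *s z)) field_differentiable at w within {w. a + w *s z \<in> D}"
    using field_differentiable_def field_differentiable_at_within by blast
qed

lemma holo_on_imp_continuous_on: "holo_on f D \<Longrightarrow> continuous_on D f"
  using holo_on_imp_sep_holo by (auto simp: sep_holo_def)

text \<open>Averaging over the circle action z \<mapsto> exp(i t) z about \<open>a\<close>, which
  preserves Lebesgue measure, replaces spherical coordinates and iterated integrals. On each complex
  line through \<open>a\<close> the integrand is the modulus of the holomorphic function
  \<open>f\<close> squared, so the one-variable mean value inequality applies to it directly; Fubini
  then exchanges the two averages.\<close>

theorem submean_value:
  fixes f :: "complex ^ 'n::finite \<Rightarrow> complex"
  assumes f: "holo_on f D" and sub: "ball a r \<subseteq> D" and r: "r > 0"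
  shows "ennreal ((norm (f a))\<^sup>2) * emeasure lborel (ball a r) \<le> sqnorm D f"
proof -
  let ?B = "ball (0 :: complex ^ 'n) r"
  let ?e = "\<lambda>\<theta> :: real. exp (2 * of_real pi * \<i> * of_real \<theta>)"
  let ?I = "{0..1::real}"
  \<comment> \<open>The cut-off is inside the norm because \<open>f\<close> is arbitrary outside
    \<open>D\<close>; continuity on the ball makes the truncated function measurable.\<close>
  define \<phi> where "\<phi> z = ennreal ((norm (indicator (ball a r) z *\<^sub>R f z))\<^sup>2)" for z
  define \<psi> where "\<psi> z = \<phi> (a + z)" for z
  have "(\<lambda>z. indicator (ball a r) z *\<^sub>R f z) \<in> borel_measurable borel"
    by (rule borel_measurable_continuous_on_indicator)
       (auto intro: continuous_on_subset[OF holo_on_imp_continuous_on[OF f] sub])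
  then have [measurable]: "\<phi> \<in> borel_measurable borel" unfolding \<phi>_def by measurable
  have [measurable]: "\<psi> \<in> borel_measurable borel" unfolding \<psi>_def by measurable
  have \<psi>: "\<psi> z = ennreal ((norm (f (a + z)))\<^sup>2) * indicator ?B z" for z
    by (auto simp: \<psi>_def \<phi>_def indicator_def dist_norm)
  have [measurable]: "ball a r \<in> sets borel" by simp
  have rot: "(\<integral>\<^sup>+z. \<psi> (?e \<theta> *s z) \<partial>lborel) = (\<integral>\<^sup>+z. \<psi> z \<partial>lborel)" for \<theta>
  proof -
    have lin: "linear (\<lambda>z :: complex ^ 'n. ?e \<theta> *s z)"
      by (rule linearI) (simp_all add: vec_eq_iff algebra_simps)
    have d: "distr lborel borel (\<lambda>z :: complex ^ 'n. ?e \<theta> *s z) = lborel"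
      by (rule lborel_isometry[OF lin]) (simp add: norm_vector_scalar_mult norm_exp_eq_Re)
    have [measurable]: "(\<lambda>z :: complex ^ 'n. ?e \<theta> *s z) \<in> borel_measurable borel"
      using lin by (intro borel_measurable_continuous_onI) (simp add: linear_continuous_on linear_conv_bounded_linear)
    show ?thesis by (subst (2) d[symmetric]) (simp add: nn_integral_distr)
  qed
  have cont: "continuous_on UNIV (\<lambda>x :: real \<times> (complex ^ 'n). ?e (fst x) *s snd x)"
    unfolding vector_scalar_mult_def by (intro continuous_intros)
  then have [measurable]: "(\<lambda>x :: real \<times> (complex ^ 'n). ?e (fst x) *s snd x) \<in> borel_measurable (borel \<Otimes>\<^sub>M borel)"
    unfolding borel_prod by (rule borel_measurable_continuous_onI)
  have m: "(\<lambda>(\<theta>, z). indicator ?I \<theta> * \<psi> (?e \<theta> *s z)) \<in> borel_measurable (lborel \<Otimes>\<^sub>M lborel)"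
  proof -
    have "(\<lambda>x. indicator ?I (fst x) * \<psi> (?e (fst x) *s snd x)) \<in> borel_measurable (borel \<Otimes>\<^sub>M borel)"
      by measurable
    then show ?thesis by (simp add: case_prod_unfold cong: measurable_cong_sets sets_pair_measure_cong)
  qed
  have "ennreal ((norm (f a))\<^sup>2) * emeasure lborel (ball a r) = (\<integral>\<^sup>+z. ennreal ((norm (f a))\<^sup>2) * indicator (ball a r) z \<partial>lborel)"
    by (rule nn_integral_cmult_indicator[symmetric]) simp
  also have "\<dots> = (\<integral>\<^sup>+z. ennreal ((norm (f a))\<^sup>2) * indicator (ball a r) (a + z) \<partial>lborel)"
    by (rule nn_integral_lborel_shift[where f = "\<lambda>z. ennreal ((norm (f a))\<^sup>2) * indicator (ball a r) z", symmetric])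
       measurable
  also have "\<dots> \<le> (\<integral>\<^sup>+z. \<integral>\<^sup>+\<theta>. indicator ?I \<theta> * \<psi> (?e \<theta> *s z) \<partial>lborel \<partial>lborel)"
  proof (rule nn_integral_mono)
    fix z :: "complex ^ 'n"
    show "ennreal ((norm (f a))\<^sup>2) * indicator (ball a r) (a + z) \<le> (\<integral>\<^sup>+\<theta>. indicator ?I \<theta> * \<psi> (?e \<theta> *s z) \<partial>lborel)"
    proof (cases "z \<in> ?B")
      case True
      have "cball 0 1 \<subseteq> {w. a + w *s z \<in> D}"
      proof
        fix w :: complex assume "w \<in> cball 0 1"
        then have "norm (w *s z) \<le> 1 * norm z"
          unfolding norm_vector_scalar_mult by (intro mult_right_mono) auto
        then show "w \<in> {w. a + w *s z \<in> D}" using True sub by (auto simp: subset_iff dist_norm)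
      qed
      then have "(\<lambda>w. (f (a + w *s z))\<^sup>2) holomorphic_on cball 0 1"
        by (intro holomorphic_on_power holomorphic_on_subset[OF holo_on_line[OF f]])
      from circle_mean_value[OF this]
      have "ennreal ((norm (f a))\<^sup>2) \<le> (\<integral>\<^sup>+\<theta>. ennreal ((norm (f (a + ?e \<theta> *s z)))\<^sup>2) * indicator ?I \<theta> \<partial>lborel)"
        by (simp add: norm_power)
      also have "\<dots> = (\<integral>\<^sup>+\<theta>. indicator ?I \<theta> * \<psi> (?e \<theta> *s z) \<partial>lborel)"
        using True by (intro nn_integral_cong) (simp add: \<psi> norm_vector_scalar_mult norm_exp_eq_Re indicator_def)
      finally show ?thesis using True by (simp add: dist_norm)
    qed (simp add: dist_norm)
  qed
  also have "\<dots> = (\<integral>\<^sup>+\<theta>. \<integral>\<^sup>+z. indicator ?I \<theta> * \<psi> (?e \<theta> *s z) \<partial>lborel \<partial>lborel)"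
    using lborel_pair.Fubini'[OF m] by simp
  also have "\<dots> = (\<integral>\<^sup>+\<theta>. indicator ?I \<theta> * (\<integral>\<^sup>+z. \<psi> z \<partial>lborel) \<partial>lborel)"
  proof (rule nn_integral_cong)
    fix \<theta> :: real
    show "(\<integral>\<^sup>+z. indicator ?I \<theta> * \<psi> (?e \<theta> *s z) \<partial>lborel) = indicator ?I \<theta> * (\<integral>\<^sup>+z. \<psi> z \<partial>lborel)"
      using rot[of \<theta>] by (auto simp: indicator_def)
  qed
  also have "\<dots> = (\<integral>\<^sup>+z. \<psi> z \<partial>lborel)"
    by (subst nn_integral_multc) simp_all
  also have "\<dots> = (\<integral>\<^sup>+z. \<phi> z \<partial>lborel)"
    unfolding \<psi>_def by (rule nn_integral_lborel_shift) measurable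
  also have "\<dots> \<le> sqnorm D f"
    unfolding sqnorm_def \<phi>_def using sub by (intro nn_integral_mono) (auto simp: indicator_def)
  finally show ?thesis .
qed

section \<open>The Bergman space\<close>

locale bergman =
  fixes D :: "(complex ^ 'n::finite) set"
  assumes openD: "open D" and zeroD: "0 \<in> D"
begin

text \<open>A real-valued squared norm. An infinite integral would be sent to 0, so the value is
  meaningful only for members of the Bergman space.\<close>

definition N :: "(complex ^ 'n \<Rightarrow> complex) \<Rightarrow> real" where
  "N f = enn2real (sqnorm D f)"

lemma N_nonneg [simp]: "N f \<ge> 0"
  by (simp add: N_def)

lemma A_holo: "f \<in> bergman_space D \<Longrightarrow> holo_on f D"
  by (simp add: bergman_space_def)

lemma sqnorm_eq: "f \<in> bergman_space D \<Longrightarrow> sqnorm D f = ennreal (N f)"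
  by (simp add: N_def bergman_space_def)

lemma A_holo0: "f \<in> bergman_space D \<Longrightarrow> holo0 f"
  using A_holo openD zeroD unfolding holo0_def by blast

lemma measurable_sq:
  assumes "holo_on f D"
  shows "(\<lambda>z. ennreal ((norm (f z))\<^sup>2) * indicator D z) \<in> borel_measurable lborel"
proof -
  have "(\<lambda>z. indicator D z *\<^sub>R f z) \<in> borel_measurable borel"
    using openD holo_on_imp_continuous_on[OF assms] by (intro borel_measurable_continuous_on_indicator) auto
  then have "(\<lambda>z. ennreal ((norm (indicator D z *\<^sub>R f z))\<^sup>2)) \<in> borel_measurable borel" by measurable
  moreover have "(\<lambda>z. ennreal ((norm (indicator D z *\<^sub>R f z))\<^sup>2)) = (\<lambda>z. ennreal ((norm (f z))\<^sup>2) * indicator D z)"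
    by (auto simp: indicator_def)
  ultimately have "(\<lambda>z. ennreal ((norm (f z))\<^sup>2) * indicator D z) \<in> borel_measurable borel" by (simp only:)
  then show ?thesis by simp
qed

text \<open>One pointwise domination serves scalar multiples and perturbations alike. The Hilbert
  space structure enters only through such estimates and the parallelogram law, never through an
  inner product.\<close>

lemma dominated_sq:
  assumes f: "f \<in> bergman_space D" and g: "g \<in> bergman_space D" and h: "holo_on h D"
    and ab: "a \<ge> 0" "b \<ge> 0"
    and le: "\<And>z. (norm (h z))\<^sup>2 \<le> a * (norm (f z))\<^sup>2 + b * (norm (g z))\<^sup>2"
  shows "h \<in> bergman_space D" and "N h \<le> a * N f + b * N g"
proof -
  let ?S = "\<lambda>f z. ennreal ((norm (f z :: complex))\<^sup>2) * indicator D z"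
  note [measurable] = measurable_sq[OF A_holo[OF f]] measurable_sq[OF A_holo[OF g]]
  have "sqnorm D h \<le> (\<integral>\<^sup>+z. ennreal a * ?S f z + ennreal b * ?S g z \<partial>lborel)"
    unfolding sqnorm_def
  proof (rule nn_integral_mono)
    fix z
    have "ennreal ((norm (h z))\<^sup>2) \<le> ennreal a * ennreal ((norm (f z))\<^sup>2) + ennreal b * ennreal ((norm (g z))\<^sup>2)"
      using ennreal_leI[OF le[of z]] ab by (simp add: ennreal_mult ennreal_plus)
    then show "?S h z \<le> ennreal a * ?S f z + ennreal b * ?S g z"
      by (auto simp: indicator_def)
  qed
  also have "\<dots> = ennreal a * sqnorm D f + ennreal b * sqnorm D g"
    unfolding sqnorm_def by (simp add: nn_integral_add nn_integral_cmult)
  also have "\<dots> = ennreal (a * N f + b * N g)"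
    using ab by (simp add: sqnorm_eq[OF f] sqnorm_eq[OF g] ennreal_mult ennreal_plus)
  finally have *: "sqnorm D h \<le> ennreal (a * N f + b * N g)" .
  then show hA: "h \<in> bergman_space D"
    using h le_less_trans[OF * ennreal_less_top] by (simp add: bergman_space_def)
  have "0 \<le> a * N f + b * N g" using ab by simp
  then show "N h \<le> a * N f + b * N g"
    using *[unfolded sqnorm_eq[OF hA]] by (simp only: ennreal_le_iff)
qed

lemma holo_on_cmult: "holo_on f U \<Longrightarrow> holo_on (\<lambda>z. c * f z) U"
  using holo_on_mult[OF holo_on_const] .

lemma cmult:
  assumes f: "f \<in> bergman_space D"
  shows "(\<lambda>z. c * f z) \<in> bergman_space D" and "N (\<lambda>z. c * f z) \<le> (norm c)\<^sup>2 * N f"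
proof -
  have "(norm (c * f z))\<^sup>2 \<le> (norm c)\<^sup>2 * (norm (f z))\<^sup>2 + 0 * (norm (f z))\<^sup>2" for z
    by (simp add: norm_mult power_mult_distrib)
  from dominated_sq[OF f f holo_on_cmult[OF A_holo[OF f]] _ _ this]
  show "(\<lambda>z. c * f z) \<in> bergman_space D" "N (\<lambda>z. c * f z) \<le> (norm c)\<^sup>2 * N f" by auto
qed

text \<open>The cross term is split by 2 |x| |y| \<le> c |x|^2 + |y|^2 / c. The free
  \<open>c\<close> stands in for the Cauchy-Schwarz inequality of the integrals: it is fixed only
  after integration.\<close>

lemma norm_sum_sq_le:
  fixes x y :: complex
  assumes "c > 0" "\<sigma> \<ge> 0" "norm s = \<sigma>"
  shows "(norm (x + s * y))\<^sup>2 \<le> (1 + \<sigma> * c) * (norm x)\<^sup>2 + (\<sigma>\<^sup>2 + \<sigma> / c) * (norm y)\<^sup>2"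
proof -
  let ?a = "norm x" and ?b = "norm y"
  have "norm (x + s * y) \<le> ?a + \<sigma> * ?b"
    using norm_triangle_ineq[of x "s * y"] assms(3) by (simp add: norm_mult)
  then have "(norm (x + s * y))\<^sup>2 \<le> (?a + \<sigma> * ?b)\<^sup>2" by (rule power_mono) simp
  also have "\<dots> = ?a\<^sup>2 + \<sigma> * (2 * ?a * ?b) + \<sigma>\<^sup>2 * ?b\<^sup>2" by (simp add: power2_eq_square algebra_simps)
  finally have 1: "(norm (x + s * y))\<^sup>2 \<le> ?a\<^sup>2 + \<sigma> * (2 * ?a * ?b) + \<sigma>\<^sup>2 * ?b\<^sup>2" .
  have "2 * ?a * ?b \<le> c * ?a\<^sup>2 + ?b\<^sup>2 / c"
  proof -
    have "0 \<le> (c * ?a - ?b)\<^sup>2 / c" using assms(1) by simp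
    also have "\<dots> = c * ?a\<^sup>2 + ?b\<^sup>2 / c - 2 * ?a * ?b"
      using assms(1) by (simp add: field_simps power2_eq_square)
    finally show ?thesis by simp
  qed
  from mult_left_mono[OF this assms(2)] 1
  have "(norm (x + s * y))\<^sup>2 \<le> ?a\<^sup>2 + \<sigma> * (c * ?a\<^sup>2 + ?b\<^sup>2 / c) + \<sigma>\<^sup>2 * ?b\<^sup>2" by linarith
  then show ?thesis by (simp add: algebra_simps)
qed

lemma perturb:
  assumes f: "f \<in> bergman_space D" and g: "g \<in> bergman_space D" and "c > 0" "norm s = \<sigma>"
  shows "(\<lambda>z. f z + s * g z) \<in> bergman_space D"
    and "N (\<lambda>z. f z + s * g z) \<le> (1 + \<sigma> * c) * N f + (\<sigma>\<^sup>2 + \<sigma> / c) * N g"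
proof -
  have \<sigma>: "\<sigma> \<ge> 0" using assms(4) by auto
  have h: "holo_on (\<lambda>z. f z + s * g z) D"
    by (intro holo_on_add holo_on_cmult A_holo f g)
  have "0 \<le> 1 + \<sigma> * c" "0 \<le> \<sigma>\<^sup>2 + \<sigma> / c" using \<sigma> assms(3) by auto
  note * = dominated_sq[OF f g h this norm_sum_sq_le[OF assms(3) \<sigma> assms(4)]]
  show "(\<lambda>z. f z + s * g z) \<in> bergman_space D"
    and "N (\<lambda>z. f z + s * g z) \<le> (1 + \<sigma> * c) * N f + (\<sigma>\<^sup>2 + \<sigma> / c) * N g"
    by (rule *)+
qed

lemma add: "f \<in> bergman_space D \<Longrightarrow> g \<in> bergman_space D \<Longrightarrow> (\<lambda>z. f z + g z) \<in> bergman_space D"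
  using perturb(1)[of f g 1 1 1] by simp

lemma diff: "f \<in> bergman_space D \<Longrightarrow> g \<in> bergman_space D \<Longrightarrow> (\<lambda>z. f z - g z) \<in> bergman_space D"
  using perturb(1)[of f g 1 "-1" 1] by simp

lemma zero: "(\<lambda>_. 0) \<in> bergman_space D"
  by (simp add: bergman_space_def holo_on_const sqnorm_def)

lemma parallelogram:
  assumes f: "f \<in> bergman_space D" and g: "g \<in> bergman_space D"
  shows "N (\<lambda>z. f z + g z) + N (\<lambda>z. f z - g z) = 2 * N f + 2 * N g"
proof -
  let ?S = "\<lambda>f z. ennreal ((norm (f z :: complex))\<^sup>2) * indicator D z"
  note [measurable] = measurable_sq[OF A_holo[OF f]] measurable_sq[OF A_holo[OF g]]
    measurable_sq[OF A_holo[OF add[OF f g]]] measurable_sq[OF A_holo[OF diff[OF f g]]]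
  have pt: "?S (\<lambda>z. f z + g z) z + ?S (\<lambda>z. f z - g z) z = 2 * ?S f z + 2 * ?S g z" for z
  proof -
    have "(norm (f z + g z))\<^sup>2 + (norm (f z - g z))\<^sup>2 = 2 * (norm (f z))\<^sup>2 + 2 * (norm (g z))\<^sup>2"
      by (simp add: cmod_power2) (simp add: power2_eq_square algebra_simps)
    then have "ennreal ((norm (f z + g z))\<^sup>2) + ennreal ((norm (f z - g z))\<^sup>2) =
        ennreal 2 * ennreal ((norm (f z))\<^sup>2) + ennreal 2 * ennreal ((norm (g z))\<^sup>2)"
      using ennreal_plus[of "(norm (f z + g z))\<^sup>2" "(norm (f z - g z))\<^sup>2"]
        ennreal_plus[of "2 * (norm (f z))\<^sup>2" "2 * (norm (g z))\<^sup>2"]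
      by (simp add: ennreal_mult)
    then show ?thesis by (simp add: indicator_def)
  qed
  have "sqnorm D (\<lambda>z. f z + g z) + sqnorm D (\<lambda>z. f z - g z) =
      (\<integral>\<^sup>+z. ?S (\<lambda>z. f z + g z) z + ?S (\<lambda>z. f z - g z) z \<partial>lborel)"
    unfolding sqnorm_def by (rule nn_integral_add[symmetric]) measurable
  also have "\<dots> = 2 * sqnorm D f + 2 * sqnorm D g"
    unfolding pt sqnorm_def by (simp add: nn_integral_add nn_integral_cmult)
  finally have "ennreal (N (\<lambda>z. f z + g z) + N (\<lambda>z. f z - g z)) = ennreal (2 * N f + 2 * N g)"
    by (simp add: sqnorm_eq f g add diff ennreal_plus ennreal_mult)
  then show ?thesis by (subst (asm) ennreal_inj) auto
qed

lemma point_bound: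
  assumes "z0 \<in> D"
  obtains r C where "r > 0" "C \<ge> 0" "ball z0 r \<subseteq> D"
    "\<And>f z. f \<in> bergman_space D \<Longrightarrow> z \<in> ball z0 r \<Longrightarrow> (norm (f z))\<^sup>2 \<le> C * N f"
proof -
  obtain e where e: "e > 0" "ball z0 e \<subseteq> D" using openD assms by (meson openE)
  \<comment> \<open>Balls of radius \<open>r\<close> about points of \<open>ball z0 r\<close> stay
    in \<open>ball z0 e\<close>, and they all have the same volume \<open>v\<close>.\<close>
  define r where "r = e / 2"
  define v where "v = measure lborel (ball (0 :: complex ^ 'n) r)"
  have r: "r > 0" using e by (simp add: r_def)
  have v: "v > 0" unfolding v_def using content_ball_pos[OF r] .
  show ?thesis
  proof (rule that[of r "1 / v"])
    show "ball z0 r \<subseteq> D" using e by (auto simp: r_def)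
    fix f z assume f: "f \<in> bergman_space D" and z: "z \<in> ball z0 r"
    have "ball z r \<subseteq> ball z0 e"
    proof
      fix x assume "x \<in> ball z r"
      then show "x \<in> ball z0 e" using z dist_triangle[of z0 x z] by (simp add: r_def)
    qed
    then have "ennreal ((norm (f z))\<^sup>2) * emeasure lborel (ball z r) \<le> sqnorm D f"
      using submean_value[OF A_holo[OF f] _ r] e by blast
    moreover have "emeasure lborel (ball z r) = ennreal v"
      using emeasure_lborel_ball_finite[of z r] r
      by (simp add: v_def emeasure_eq_ennreal_measure content_ball)
    ultimately have "(norm (f z))\<^sup>2 * v \<le> N f"
      using v by (simp add: sqnorm_eq[OF f] flip: ennreal_mult)
    then show "(norm (f z))\<^sup>2 \<le> 1 / v * N f" using v by (simp add: field_simps)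
  qed (use r v in auto)
qed

lemma coef_bound:
  obtains C where "C \<ge> 0" "\<And>f. f \<in> bergman_space D \<Longrightarrow> (norm (coef f \<alpha>))\<^sup>2 \<le> C * N f"
proof -
  obtain r C where r: "r > 0" "C \<ge> 0" "ball 0 r \<subseteq> D"
    "\<And>f z. f \<in> bergman_space D \<Longrightarrow> z \<in> ball 0 r \<Longrightarrow> (norm (f z))\<^sup>2 \<le> C * N f"
    using point_bound[OF zeroD] by blast
  obtain s K where s: "s > 0" "cpolydisc (2 * s) \<subseteq> K" "K \<subseteq> ball (0 :: complex ^ 'n) r"
    using bounded_polydisc_subset[of "ball 0 r"] r(1) by (metis centre_in_ball open_ball)
  show ?thesis
  proof (rule that[of "C / (s ^ mdeg \<alpha>)\<^sup>2"])
    fix f assume f: "f \<in> bergman_space D"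
    have "cpolydisc (2 * s) \<subseteq> D" using s r by blast
    then have "sep_holo f (cpolydisc (2 * s))" using holo_on_imp_sep_holo[OF A_holo[OF f]] sep_holo_subset by blast
    moreover have "norm (f z) \<le> sqrt (C * N f)" if "z \<in> cpolydisc (2 * s)" for z
      by (rule real_le_rsqrt, rule r(4)[OF f]) (use s that in auto)
    ultimately have "norm (coef f \<alpha>) \<le> sqrt (C * N f) / s ^ mdeg \<alpha>"
      using Cauchy_estimate s(1) by blast
    then have "(norm (coef f \<alpha>))\<^sup>2 \<le> (sqrt (C * N f) / s ^ mdeg \<alpha>)\<^sup>2" by (rule power_mono) simp
    also have "\<dots> = C / (s ^ mdeg \<alpha>)\<^sup>2 * N f"
      using r(2) by (simp add: power_divide)
    finally show "(norm (coef f \<alpha>))\<^sup>2 \<le> C / (s ^ mdeg \<alpha>)\<^sup>2 * N f" .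
  qed (use r in auto)
qed

text \<open>Point bounds turn a Cauchy sequence for the norm into a locally uniformly convergent
  one. Fatou's lemma bounds the norm of the limit by the limit of the bounds, and Cauchy's estimates
  carry the convergence to each coefficient.\<close>

lemma complete:
  assumes G: "\<And>k. G k \<in> bergman_space D"
    and cauchy: "\<And>e. e > 0 \<Longrightarrow> \<exists>M. \<forall>k\<ge>M. \<forall>l\<ge>M. N (\<lambda>z. G k z - G l z) < e"
    and bound: "\<And>k. N (G k) \<le> \<beta> k" "\<beta> \<longlonglongrightarrow> b"
  obtains L where "holo_on L D" "sqnorm D L \<le> ennreal b" "\<And>\<alpha>. (\<lambda>k. coef (G k) \<alpha>) \<longlonglongrightarrow> coef L \<alpha>"
proof -
  define L where "L z = lim (\<lambda>k. G k z)" for z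
  have ul: "\<exists>r>0. ball z0 r \<subseteq> D \<and> uniform_limit (ball z0 r) G L sequentially" if z0: "z0 \<in> D" for z0
  proof -
    obtain r C where r: "r > 0" "C \<ge> 0" "ball z0 r \<subseteq> D"
      "\<And>f z. f \<in> bergman_space D \<Longrightarrow> z \<in> ball z0 r \<Longrightarrow> (norm (f z))\<^sup>2 \<le> C * N f"
      using point_bound[OF z0] by blast
    have "uniformly_Cauchy_on (ball z0 r) G"
      unfolding uniformly_Cauchy_on_def
    proof (intro allI impI)
      fix e :: real assume e: "e > 0"
      then have "e\<^sup>2 / (C + 1) > 0" using r(2) by simp
      then obtain M where M: "\<And>k l. k \<ge> M \<Longrightarrow> l \<ge> M \<Longrightarrow> N (\<lambda>z. G k z - G l z) < e\<^sup>2 / (C + 1)"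
        using cauchy by blast
      have "dist (G k x) (G l x) < e" if "x \<in> ball z0 r" "k \<ge> M" "l \<ge> M" for x k l
      proof -
        have "(norm (G k x - G l x))\<^sup>2 \<le> C * N (\<lambda>z. G k z - G l z)"
          using r(4)[OF diff[OF G G] that(1)] .
        also have "\<dots> \<le> C * (e\<^sup>2 / (C + 1))"
          using M[OF that(2,3)] r(2) by (intro mult_left_mono) auto
        also have "\<dots> < e\<^sup>2" using r(2) e by (simp add: field_simps)
        finally show ?thesis unfolding dist_norm using e by (simp add: power_less_imp_less_base)
      qed
      then show "\<exists>M. \<forall>x\<in>ball z0 r. \<forall>m\<ge>M. \<forall>n\<ge>M. dist (G m x) (G n x) < e" by blast
    qed
    then have "uniformly_convergent_on (ball z0 r) G" by (rule Cauchy_uniformly_convergent)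
    then have "uniform_limit (ball z0 r) G L sequentially"
      unfolding L_def[abs_def] by (simp add: uniformly_convergent_uniform_limit_iff)
    with r show ?thesis by blast
  qed
  have sG: "sep_holo (G k) D" for k by (rule holo_on_imp_sep_holo[OF A_holo[OF G]])
  have sL: "sep_holo L D"
  proof (rule sep_holo_uniform_limit[OF openD sG])
    fix z assume "z \<in> D"
    then obtain r where "r > 0" "uniform_limit (ball z r) G L sequentially" using ul by blast
    then show "\<exists>V. open V \<and> z \<in> V \<and> uniform_limit V G L sequentially"
      by (intro exI[of _ "ball z r"]) auto
  qed
  have "sqnorm D L \<le> ennreal b"
  proof -
    let ?S = "\<lambda>f z. ennreal ((norm (f z :: complex))\<^sup>2) * indicator D z"
    have "sqnorm D L = (\<integral>\<^sup>+z. liminf (\<lambda>k. ?S (G k) z) \<partial>lborel)"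
      unfolding sqnorm_def
    proof (rule nn_integral_cong)
      fix z
      show "?S L z = liminf (\<lambda>k. ?S (G k) z)"
      proof (cases "z \<in> D")
        case True
        then obtain r where "r > 0" "uniform_limit (ball z r) G L sequentially" using ul by blast
        then have "(\<lambda>k. G k z) \<longlonglongrightarrow> L z" using tendsto_uniform_limitI by fastforce
        then have "(\<lambda>k. ennreal ((norm (G k z))\<^sup>2)) \<longlonglongrightarrow> ennreal ((norm (L z))\<^sup>2)"
          by (intro tendsto_ennrealI tendsto_power tendsto_norm)
        from lim_imp_Liminf[OF sequentially_bot this] show ?thesis using True by simp
      qed (simp add: Liminf_const)
    qed
    also have "\<dots> \<le> liminf (\<lambda>k. \<integral>\<^sup>+z. ?S (G k) z \<partial>lborel)"
      by (rule nn_integral_liminf) (rule measurable_sq[OF A_holo[OF G]])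
    also have "\<dots> \<le> liminf (\<lambda>k. ennreal (\<beta> k))"
    proof (rule Liminf_mono, rule always_eventually, rule allI)
      fix k
      show "(\<integral>\<^sup>+z. ?S (G k) z \<partial>lborel) \<le> ennreal (\<beta> k)"
        using sqnorm_eq[OF G[of k]] bound(1)[of k] by (simp add: sqnorm_def ennreal_leI)
    qed
    also have "\<dots> = ennreal b"
      by (intro lim_imp_Liminf tendsto_ennrealI bound) simp
    finally show ?thesis .
  qed
  moreover have "(\<lambda>k. coef (G k) \<alpha>) \<longlonglongrightarrow> coef L \<alpha>" for \<alpha>
  proof -
    obtain r where r: "r > 0" "ball 0 r \<subseteq> D" "uniform_limit (ball 0 r) G L sequentially"
      using ul[OF zeroD] by blast
    obtain s K where s: "s > 0" "cpolydisc (2 * s) \<subseteq> K" "K \<subseteq> ball (0 :: complex ^ 'n) r"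
      using bounded_polydisc_subset[of "ball 0 r"] r(1) by (metis centre_in_ball open_ball)
    have sub: "cpolydisc (2 * s) \<subseteq> ball (0 :: complex ^ 'n) r" "cpolydisc (2 * s) \<subseteq> D" using s r by auto
    show ?thesis
      unfolding tendsto_iff
    proof (intro allI impI)
      fix e :: real assume e: "e > 0"
      \<comment> \<open>Scaled so that Cauchy's estimate, which divides by
        \<open>s ^ mdeg \<alpha>\<close>, returns \<open>e / 2\<close>.\<close>
      then have "e / 2 * s ^ mdeg \<alpha> > 0" using s by simp
      then have "\<forall>\<^sub>F k in sequentially. \<forall>z\<in>ball 0 r. dist (G k z) (L z) < e / 2 * s ^ mdeg \<alpha>"
        using r(3) unfolding uniform_limit_iff by blast
      then show "\<forall>\<^sub>F k in sequentially. dist (coef (G k) \<alpha>) (coef L \<alpha>) < e"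
      proof eventually_elim
        case (elim k)
        have "norm (coef (\<lambda>z. G k z - L z) \<alpha>) \<le> (e / 2 * s ^ mdeg \<alpha>) / s ^ mdeg \<alpha>"
        proof (rule Cauchy_estimate)
          show "sep_holo (\<lambda>z. G k z - L z) (cpolydisc (2 * s))"
            by (rule sep_holo_subset[OF sep_holo_diff[OF sG sL] sub(2)])
          show "norm (G k z - L z) \<le> e / 2 * s ^ mdeg \<alpha>" if "z \<in> cpolydisc (2 * s)" for z
            using elim sub(1) that by (auto simp: dist_norm less_imp_le)
        qed (rule s)
        also have "\<dots> < e" using s e by simp
        finally show ?case
          using coef_diff[OF openD sG sL zeroD] by (simp add: dist_norm)
      qed
    qed
  qed
  ultimately show ?thesis using that sep_holo_imp_holo_on[OF openD sL] by blast
qed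

end

section \<open>The extremal problem and its dual\<close>

lemma pairing_coef: "pairing \<xi> f = (\<Sum>\<^sub>\<infinity>\<alpha>. \<xi> \<alpha> * coef f \<alpha>)"
  by (simp add: pairing_def coef_def)

text \<open>Coefficients of a germ grow at most like s^(-|\<alpha>|) for some s > 0, and the
  condition in \<open>ell1\<close> at the radius 1 / s compensates exactly that growth.\<close>

lemma pairing_summable:
  assumes \<xi>: "\<xi> \<in> ell1" and f: "holo0 f"
  shows "(\<lambda>\<alpha>. \<xi> \<alpha> * coef f \<alpha>) summable_on UNIV"
proof -
  obtain r where r: "r > 0" "converges r (coef f)" using holo0_expand[OF f] by metis
  define s where "s = r / 2"
  have s: "s > 0" "s < r" using r by (auto simp: s_def)
  define B where "B = (\<Sum>\<^sub>\<infinity>\<alpha>. norm (coef f \<alpha>) * s ^ mdeg \<alpha>)"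
  have sm: "(\<lambda>\<alpha>. norm (coef f \<alpha>) * s ^ mdeg \<alpha>) summable_on UNIV" using r(2) s by (auto simp: converges_def)
  have B: "norm (coef f \<alpha>) * s ^ mdeg \<alpha> \<le> B" for \<alpha>
    using finite_sum_le_infsum[OF sm, of "{\<alpha>}"] s by (simp add: B_def)
  have "(\<lambda>\<alpha>. norm (\<xi> \<alpha> * coef f \<alpha>)) summable_on UNIV"
  proof (rule summable_on_comparison_test)
    have "(\<lambda>\<alpha>. norm (\<xi> \<alpha>) * (1 / s) ^ mdeg \<alpha>) summable_on UNIV"
      using \<xi> s unfolding ell1_def by simp
    then show "(\<lambda>\<alpha>. B * (norm (\<xi> \<alpha>) * (1 / s) ^ mdeg \<alpha>)) summable_on UNIV"
      by (rule summable_on_cmult_right)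
    show "norm (\<xi> \<alpha> * coef f \<alpha>) \<le> B * (norm (\<xi> \<alpha>) * (1 / s) ^ mdeg \<alpha>)" for \<alpha>
    proof -
      have "norm (coef f \<alpha>) \<le> B * (1 / s) ^ mdeg \<alpha>"
        using B[of \<alpha>] s by (simp add: field_simps)
      then have "norm (\<xi> \<alpha>) * norm (coef f \<alpha>) \<le> norm (\<xi> \<alpha>) * (B * (1 / s) ^ mdeg \<alpha>)"
        by (rule mult_left_mono) simp
      then show ?thesis by (simp add: norm_mult mult_ac)
    qed
  qed simp
  then show ?thesis by (rule abs_summable_summable)
qed

lemma pairing_diff:
  assumes \<xi>: "\<xi> \<in> ell1" and f: "holo0 f" and g: "holo0 g"
  shows "pairing \<xi> (\<lambda>z. f z - g z) = pairing \<xi> f - pairing \<xi> g"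
proof -
  have "pairing \<xi> (\<lambda>z. f z - g z) = (\<Sum>\<^sub>\<infinity>\<alpha>. \<xi> \<alpha> * coef f \<alpha> + (- (\<xi> \<alpha> * coef g \<alpha>)))"
    by (simp add: pairing_coef coef_diff0[OF f g] algebra_simps)
  also have "\<dots> = pairing \<xi> f + (\<Sum>\<^sub>\<infinity>\<alpha>. - (\<xi> \<alpha> * coef g \<alpha>))"
    unfolding pairing_coef
    by (rule infsum_add) (simp_all add: pairing_summable[OF \<xi> f] pairing_summable[OF \<xi> g] summable_on_uminus)
  also have "(\<Sum>\<^sub>\<infinity>\<alpha>. - (\<xi> \<alpha> * coef g \<alpha>)) = - pairing \<xi> g"
    unfolding pairing_coef by (rule infsum_uminus)
  finally show ?thesis by simp
qed

lemma pairing_cmult: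
  assumes "holo0 f"
  shows "pairing \<xi> (\<lambda>z. a * f z) = a * pairing \<xi> f"
proof -
  have "pairing \<xi> (\<lambda>z. a * f z) = (\<Sum>\<^sub>\<infinity>\<alpha>. a * (\<xi> \<alpha> * coef f \<alpha>))"
    unfolding pairing_coef coef_cmult[OF assms] by (simp only: mult.left_commute)
  then show ?thesis by (simp add: pairing_coef infsum_cmult_right')
qed

text \<open>The product form of the hypothesis covers a vanishing denominator: it forces the
  numerator to vanish, and 0 / 0 is 0. For an infinite denominator the quotient is 0.\<close>

lemma ennreal_quotient_le:
  assumes "a \<ge> 0" "n \<ge> 0" "\<And>\<kappa>. \<kappa> \<ge> 0 \<Longrightarrow> K = ennreal \<kappa> \<Longrightarrow> a \<le> n * \<kappa>"
  shows "ennreal a / K \<le> ennreal n"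
proof (cases K)
  case (real \<kappa>)
  show ?thesis
  proof (cases "\<kappa> = 0")
    case True
    then have "a = 0" using assms real by force
    then show ?thesis by simp
  next
    case False
    then have "ennreal a / K = ennreal (a / \<kappa>)"
      using real assms(1) by (simp add: divide_ennreal)
    moreover have "a / \<kappa> \<le> n" using assms(3)[OF real] real(1) False by (simp add: field_simps)
    ultimately show ?thesis by (simp add: ennreal_leI)
  qed
qed simp

section \<open>Consequences of nonnegative quadratic expressions\<close>

lemma real_quadratic_nonneg:
  fixes a b :: real
  assumes "\<And>s. 0 \<le> 2 * s * a + s\<^sup>2 * b" "b \<ge> 0"
  shows "a = 0"
proof (rule ccontr)
  assume a: "a \<noteq> 0"
  \<comment> \<open>The minimum of the quadratic is at - a / b; the 1 in the denominator guards
    against b = 0.\<close>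
  define s where "s = - a / (b + 1)"
  have a_eq: "a = - ((b + 1) * s)" using assms(2) by (simp add: s_def)
  have "2 * s * - ((b + 1) * s) + s\<^sup>2 * b = - (s\<^sup>2 * (b + 2))"
    by (simp add: power2_eq_square algebra_simps)
  then have "2 * s * a + s\<^sup>2 * b = - (s\<^sup>2 * (b + 2))" by (simp only: a_eq[symmetric])
  moreover have "s \<noteq> 0" using a assms(2) by (simp add: s_def)
  ultimately have "2 * s * a + s\<^sup>2 * b < 0" using assms(2) by simp
  then show False using assms(1)[of s] by simp
qed

text \<open>Along \<open>s = of_real r * cnj w\<close> the linear term is 2 r |w|^2, which reduces
  the claim to the real case.\<close>

lemma complex_quadratic_nonneg:
  fixes w :: complex
  assumes "\<And>s. 0 \<le> 2 * Re (s * w) + (norm s)\<^sup>2 * W" "W \<ge> 0"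
  shows "w = 0"
proof -
  have "(norm w)\<^sup>2 = 0"
  proof (rule real_quadratic_nonneg)
    fix r :: real
    have *: "of_real r * cnj w * w = of_real (r * (norm w)\<^sup>2)"
      unfolding of_real_mult complex_norm_square by (simp only: mult_ac)
    have **: "(norm (of_real r * cnj w))\<^sup>2 = r\<^sup>2 * (norm w)\<^sup>2"
      by (simp add: norm_mult power_mult_distrib)
    show "0 \<le> 2 * r * (norm w)\<^sup>2 + r\<^sup>2 * ((norm w)\<^sup>2 * W)"
      using assms(1)[of "of_real r * cnj w"] unfolding * ** Re_complex_of_real by (simp only: mult.assoc)
  qed (use assms(2) in simp)
  then show ?thesis by simp
qed

text \<open>The one-sided version, for a variation whose estimate is in terms of the modulus of the
  parameter.\<close>

lemma linear_coefficient_nonneg: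
  fixes a b :: real
  assumes "\<And>\<sigma>. \<sigma> > 0 \<Longrightarrow> 0 \<le> \<sigma> * a + \<sigma>\<^sup>2 * b"
  shows "a \<ge> 0"
proof (rule ccontr)
  assume "\<not> a \<ge> 0"
  then have a: "a < 0" by simp
  define \<sigma> where "\<sigma> = - a / (\<bar>b\<bar> + 1)"
  have \<sigma>: "\<sigma> > 0" unfolding \<sigma>_def using a by (intro divide_pos_pos) auto
  have "\<sigma> * (\<bar>b\<bar> + 1) = - a" by (simp add: \<sigma>_def add_nonneg_pos)
  then have "a + \<sigma> * \<bar>b\<bar> = - \<sigma>" by (simp add: algebra_simps)
  moreover have "\<sigma> * b \<le> \<sigma> * \<bar>b\<bar>" using \<sigma> by (intro mult_left_mono) auto
  ultimately have "a + \<sigma> * b < 0" using \<sigma> by linarith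
  then have "\<sigma> * (a + \<sigma> * b) < 0" using \<sigma> by (simp add: mult_pos_neg)
  then show False using assms[OF \<sigma>] by (simp add: power2_eq_square algebra_simps)
qed

lemma norm_add_sq: "(norm (x + s * y))\<^sup>2 = (norm x)\<^sup>2 + 2 * Re (s * (cnj x * y)) + (norm s)\<^sup>2 * (norm y)\<^sup>2"
  for x s y :: complex
proof -
  have "(norm s)\<^sup>2 * (norm y)\<^sup>2 = (norm (s * y))\<^sup>2" by (simp add: norm_mult power_mult_distrib)
  then show ?thesis
    by (simp only: cmod_power2) (simp add: power2_eq_square algebra_simps)
qed

lemma sum_norm_add_sq:
  fixes x y :: "'a \<Rightarrow> complex"
  shows "(\<Sum>\<alpha>\<in>J. (norm (x \<alpha> + s * y \<alpha>))\<^sup>2) =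
    (\<Sum>\<alpha>\<in>J. (norm (x \<alpha>))\<^sup>2) + 2 * Re (s * (\<Sum>\<alpha>\<in>J. cnj (x \<alpha>) * y \<alpha>)) + (norm s)\<^sup>2 * (\<Sum>\<alpha>\<in>J. (norm (y \<alpha>))\<^sup>2)"
  unfolding norm_add_sq sum.distrib sum_distrib_left Re_sum by simp

lemma midpoint_arith:
  fixes a b m n1 n2 p q u v Qm :: real
  assumes "4 * Qm \<le> n1 + u" "4 * m \<le> 4 * Qm" "n1 + n2 = 2 * a + 2 * b" "u + v = 2 * p + 2 * q"
  shows "n2 + v \<le> 2 * (a + p) + 2 * (b + q) - 4 * m"
  using assms by argo

lemma convergent_if_square_bound:
  fixes f :: "nat \<Rightarrow> complex"
  assumes d: "\<And>e. e > 0 \<Longrightarrow> \<exists>M. \<forall>i\<ge>M. \<forall>j\<ge>M. d i j < e" and C: "C \<ge> 0"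
    and f: "\<And>i j. (norm (f i - f j))\<^sup>2 \<le> C * d i j"
  shows "\<exists>l. f \<longlonglongrightarrow> l"
proof -
  have "Cauchy f"
    unfolding Cauchy_def
  proof (intro allI impI)
    fix e :: real assume e: "e > 0"
    \<comment> \<open>\<open>C\<close> itself may be 0.\<close>
    then have "e\<^sup>2 / (C + 1) > 0" using C by simp
    then obtain M where M: "\<And>i j. i \<ge> M \<Longrightarrow> j \<ge> M \<Longrightarrow> d i j < e\<^sup>2 / (C + 1)" using d by blast
    have "dist (f i) (f j) < e" if "i \<ge> M" "j \<ge> M" for i j
    proof -
      have "(norm (f i - f j))\<^sup>2 \<le> C * (e\<^sup>2 / (C + 1))"
        using M[OF that] C by (intro order_trans[OF f] mult_left_mono) auto
      also have "\<dots> < e\<^sup>2" using C e by (simp add: field_simps)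
      finally show ?thesis unfolding dist_norm using e by (simp add: power_less_imp_less_base)
    qed
    then show "\<exists>M. \<forall>m\<ge>M. \<forall>n\<ge>M. dist (f m) (f n) < e" by blast
  qed
  then show ?thesis using Cauchy_convergent by (auto simp: convergent_def)
qed

section \<open>The penalised minimisation problem\<close>

locale min_problem = bergman D for D :: "(complex ^ 'n::finite) set" +
  fixes I :: "(complex ^ 'n \<Rightarrow> complex) set set" and F :: "complex ^ 'n \<Rightarrow> complex"
  assumes I: "ideal I germ_ring" and F: "holo0 F"
begin

definition X :: "((complex ^ 'n \<Rightarrow> complex) \<times> (complex ^ 'n \<Rightarrow> complex)) set" where
  "X = {(G, v). G \<in> bergman_space D \<and> germ v \<in> I}"

definition \<rho> :: "(complex ^ 'n \<Rightarrow> complex) \<times> (complex ^ 'n \<Rightarrow> complex) \<Rightarrow> ('n \<Rightarrow> nat) \<Rightarrow> complex" where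
  "\<rho> x \<alpha> = coef (fst x) \<alpha> - coef F \<alpha> - coef (snd x) \<alpha>"

definition J :: "nat \<Rightarrow> ('n \<Rightarrow> nat) set" where
  "J k = {\<alpha>. mdeg \<alpha> \<le> k}"

abbreviation sumsq :: "nat \<Rightarrow> (('n \<Rightarrow> nat) \<Rightarrow> complex) \<Rightarrow> real" where
  "sumsq k c \<equiv> \<Sum>\<alpha>\<in>J k. (norm (c \<alpha>))\<^sup>2"

text \<open>Both the number of coefficients and their penalty increase with \<open>k\<close>, so the
  functionals increase too. The factor \<open>Suc k\<close> is at least 1 already for
  \<open>k = 0\<close>, so \<open>Q k\<close> always dominates the squared residuals.\<close>

definition Q :: "nat \<Rightarrow> (complex ^ 'n \<Rightarrow> complex) \<times> (complex ^ 'n \<Rightarrow> complex) \<Rightarrow> real" where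
  "Q k x = N (fst x) + real (Suc k) * sumsq k (\<rho> x)"

definition \<mu> :: "nat \<Rightarrow> real" where
  "\<mu> k = Inf (Q k ` X)"

lemma finite_J [simp]: "finite (J k)"
proof (rule finite_subset)
  show "J k \<subseteq> {..\<lambda>_. k}"
  proof
    fix \<alpha> assume "\<alpha> \<in> J k"
    moreover have "\<alpha> i \<le> mdeg \<alpha>" for i by (simp add: mdeg_def member_le_sum)
    ultimately show "\<alpha> \<in> {..\<lambda>_. k}" by (auto simp: J_def le_fun_def intro: order_trans)
  qed
qed simp

lemma X_fst: "x \<in> X \<Longrightarrow> fst x \<in> bergman_space D"
  and X_snd: "x \<in> X \<Longrightarrow> germ (snd x) \<in> I"
  and X_I: "G \<in> bergman_space D \<Longrightarrow> germ v \<in> I \<Longrightarrow> (G, v) \<in> X"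
  by (auto simp: X_def)

lemma X_holo0: "x \<in> X \<Longrightarrow> holo0 (fst x)" "x \<in> X \<Longrightarrow> holo0 (snd x)"
  using A_holo0[OF X_fst] ideal_holo0[OF I X_snd] by auto

lemma X_nonempty: "X \<noteq> {}"
  using zero ideal_zero[OF I] by (auto simp: X_def)

lemma Q_nonneg: "Q k x \<ge> 0"
  by (simp add: Q_def sum_nonneg)

lemma bdd_below_Q: "bdd_below (Q k ` X)"
  by (rule bdd_belowI2[of _ 0]) (rule Q_nonneg)

lemma \<mu>_le: "x \<in> X \<Longrightarrow> \<mu> k \<le> Q k x"
  unfolding \<mu>_def by (rule cINF_lower[OF bdd_below_Q])

lemma near_minimizer:
  assumes "e > 0"
  obtains x where "x \<in> X" "Q k x < \<mu> k + e"
  using cINF_less_iff[OF X_nonempty bdd_below_Q, of k "\<mu> k + e"] assms that by (auto simp: \<mu>_def)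

text \<open>Both parts of \<open>Q k\<close> obey the parallelogram law, and \<rho> is affine. The
  midpoint of two admissible pairs is admissible and costs at least the infimum, so near-minimisers
  are close to each other in both parts.\<close>

lemma midpoint_estimate:
  assumes x: "x \<in> X" and y: "y \<in> X"
  shows "N (\<lambda>z. fst x z - fst y z) + real (Suc k) * sumsq k (\<lambda>\<alpha>. \<rho> x \<alpha> - \<rho> y \<alpha>)
    \<le> 2 * Q k x + 2 * Q k y - 4 * \<mu> k"
proof -
  let ?G = "\<lambda>z. fst x z + fst y z" and ?v = "\<lambda>z. snd x z + snd y z"
  let ?m = "(\<lambda>z. 1 / 2 * ?G z, \<lambda>z. 1 / 2 * ?v z)"
  have G: "?G \<in> bergman_space D" by (rule add[OF X_fst[OF x] X_fst[OF y]])
  have v: "germ ?v \<in> I" by (rule ideal_add[OF I X_snd[OF x] X_snd[OF y]])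
  have m: "?m \<in> X" by (intro X_I cmult(1)[OF G] ideal_mult[OF I holo0_const v])
  have \<rho>: "\<rho> ?m \<alpha> = (\<rho> x \<alpha> + \<rho> y \<alpha>) / 2" for \<alpha>
    using X_holo0[OF x] X_holo0[OF y]
    by (simp add: \<rho>_def coef_cmult holo0_add coef_add add_divide_distrib diff_divide_distrib del: times_divide_eq_left times_divide_eq_right)
       (simp add: field_simps)
  have "N (\<lambda>z. 1 / 2 * ?G z) \<le> 1 / 4 * N ?G"
    using cmult(2)[OF G, of "1 / 2"] by (simp add: power2_eq_square norm_divide)
  moreover have "4 * sumsq k (\<rho> ?m) = sumsq k (\<lambda>\<alpha>. \<rho> x \<alpha> + \<rho> y \<alpha>)"
    unfolding \<rho> sum_distrib_left by (simp add: norm_divide power_divide)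
  ultimately have "4 * Q k ?m \<le> N ?G + real (Suc k) * sumsq k (\<lambda>\<alpha>. \<rho> x \<alpha> + \<rho> y \<alpha>)"
    by (simp add: Q_def algebra_simps del: of_nat_Suc)
  moreover have "4 * \<mu> k \<le> 4 * Q k ?m" using \<mu>_le[OF m] by simp
  moreover have "N ?G + N (\<lambda>z. fst x z - fst y z) = 2 * N (fst x) + 2 * N (fst y)"
    by (rule parallelogram[OF X_fst[OF x] X_fst[OF y]])
  moreover have "sumsq k (\<lambda>\<alpha>. \<rho> x \<alpha> + \<rho> y \<alpha>) + sumsq k (\<lambda>\<alpha>. \<rho> x \<alpha> - \<rho> y \<alpha>) =
      2 * sumsq k (\<rho> x) + 2 * sumsq k (\<rho> y)"
    unfolding sum_distrib_left sum.distrib[symmetric]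
    by (rule sum.cong) (simp_all add: cmod_power2, simp add: power2_eq_square algebra_simps)
  then have "real (Suc k) * sumsq k (\<lambda>\<alpha>. \<rho> x \<alpha> + \<rho> y \<alpha>) + real (Suc k) * sumsq k (\<lambda>\<alpha>. \<rho> x \<alpha> - \<rho> y \<alpha>) =
      2 * (real (Suc k) * sumsq k (\<rho> x)) + 2 * (real (Suc k) * sumsq k (\<rho> y))"
    by (simp only: distrib_left[symmetric] mult.left_commute[of 2])
  note facts = calculation this
  show ?thesis using facts unfolding Q_def by (rule midpoint_arith)
qed

lemma pairing_J:
  "pairing (\<lambda>\<alpha>. if \<alpha> \<in> J k then cnj (r \<alpha>) else 0) f = (\<Sum>\<alpha>\<in>J k. cnj (r \<alpha>) * coef f \<alpha>)"
proof -
  have "pairing (\<lambda>\<alpha>. if \<alpha> \<in> J k then cnj (r \<alpha>) else 0) f = (\<Sum>\<^sub>\<infinity>\<alpha>\<in>J k. cnj (r \<alpha>) * coef f \<alpha>)"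
    unfolding pairing_coef by (rule infsum_cong_neutral) auto
  then show ?thesis by simp
qed

lemma \<mu>_le_if_B_fin_le:
  assumes b: "b \<ge> 0" "B_fin F I D \<le> ennreal b"
  shows "\<mu> k \<le> b"
proof -
  define t where "t = real (Suc k)"
  have t: "t > 0" and t1: "1 \<le> t" by (simp_all add: t_def)
  have Q_t: "Q k x = N (fst x) + t * sumsq k (\<rho> x)" for x
    by (simp only: Q_def t_def)
  have "\<exists>x\<in>X. Q k x < \<mu> k + 1 / real (Suc n)" for n
    by (rule near_minimizer[of "1 / real (Suc n)" k]) auto
  then obtain x where x: "\<And>n. x n \<in> X" "\<And>n. Q k (x n) < \<mu> k + 1 / real (Suc n)" by metis
  define G where "G n = fst (x n)" for n
  define v where "v n = snd (x n)" for n
  have GA: "G n \<in> bergman_space D" for n unfolding G_def by (rule X_fst[OF x(1)])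
  have vI: "germ (v n) \<in> I" for n unfolding v_def by (rule X_snd[OF x(1)])
  have hG: "holo0 (G n)" and hv: "holo0 (v n)" for n unfolding G_def v_def using X_holo0[OF x(1)] by auto
  have x_eq: "x n = (G n, v n)" for n by (simp add: G_def v_def)
  have inv0: "(\<lambda>n. 1 / real (Suc n)) \<longlonglongrightarrow> 0" using lim_inverse_n' LIMSEQ_Suc by blast
  have cau: "\<exists>M. \<forall>i\<ge>M. \<forall>j\<ge>M. N (\<lambda>z. G i z - G j z) + t * sumsq k (\<lambda>\<alpha>. \<rho> (x i) \<alpha> - \<rho> (x j) \<alpha>) < e"
    if e: "e > 0" for e
  proof -
    have "\<forall>\<^sub>F n in sequentially. 1 / real (Suc n) < e / 4"
      by (rule order_tendstoD(2)[OF inv0]) (use e in simp)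
    then obtain M where M: "\<And>n. n \<ge> M \<Longrightarrow> 1 / real (Suc n) < e / 4" by (auto simp: eventually_sequentially)
    have "N (\<lambda>z. G i z - G j z) + t * sumsq k (\<lambda>\<alpha>. \<rho> (x i) \<alpha> - \<rho> (x j) \<alpha>) < e" if "i \<ge> M" "j \<ge> M" for i j
      using midpoint_estimate[OF x(1)[of i] x(1)[of j], of k, folded t_def] x(2)[of i] x(2)[of j] M[OF that(1)] M[OF that(2)]
      unfolding G_def by linarith
    then show ?thesis by blast
  qed
  have "\<exists>l. (\<lambda>n. \<rho> (x n) \<alpha>) \<longlonglongrightarrow> l" if \<alpha>: "\<alpha> \<in> J k" for \<alpha>
  proof (rule convergent_if_square_bound[OF cau, of 1])
    fix i j
    let ?s = "\<Sum>\<alpha>\<in>J k. (norm (\<rho> (x i) \<alpha> - \<rho> (x j) \<alpha>))\<^sup>2"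
    have "(norm (\<rho> (x i) \<alpha> - \<rho> (x j) \<alpha>))\<^sup>2 \<le> ?s" using \<alpha> by (intro member_le_sum) auto
    also have "\<dots> \<le> t * ?s" using mult_right_mono[OF t1, of ?s] by (simp add: sum_nonneg)
    finally show "(norm (\<rho> (x i) \<alpha> - \<rho> (x j) \<alpha>))\<^sup>2 \<le> 1 * (N (\<lambda>z. G i z - G j z) + t * ?s)"
      by (simp add: add_increasing)
  qed auto
  then obtain r where r: "\<And>\<alpha>. \<alpha> \<in> J k \<Longrightarrow> (\<lambda>n. \<rho> (x n) \<alpha>) \<longlonglongrightarrow> r \<alpha>" by metis
  have "\<exists>l. (\<lambda>n. coef (G n) \<alpha>) \<longlonglongrightarrow> l" for \<alpha>
  proof -
    obtain C where C: "C \<ge> 0" "\<And>f. f \<in> bergman_space D \<Longrightarrow> (norm (coef f \<alpha>))\<^sup>2 \<le> C * N f"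
      using coef_bound by blast
    show ?thesis
    proof (rule convergent_if_square_bound[OF cau C(1)])
      fix i j
      have "(norm (coef (G i) \<alpha> - coef (G j) \<alpha>))\<^sup>2 \<le> C * N (\<lambda>z. G i z - G j z)"
        using C(2)[OF diff[OF GA GA]] by (simp add: coef_diff0[OF hG hG])
      then show "(norm (coef (G i) \<alpha> - coef (G j) \<alpha>))\<^sup>2
          \<le> C * (N (\<lambda>z. G i z - G j z) + t * sumsq k (\<lambda>\<alpha>. \<rho> (x i) \<alpha> - \<rho> (x j) \<alpha>))"
        using C(1) t by (elim order_trans) (intro mult_left_mono, auto intro!: mult_nonneg_nonneg sum_nonneg)
    qed
  qed
  then obtain \<gamma> where \<gamma>: "\<And>\<alpha>. (\<lambda>n. coef (G n) \<alpha>) \<longlonglongrightarrow> \<gamma> \<alpha>" by metis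
  define R where "R = sumsq k r"
  define g where "g = \<mu> k - t * R"
  have Qlim: "(\<lambda>n. Q k (x n)) \<longlonglongrightarrow> \<mu> k"
  proof (rule tendsto_sandwich[of "\<lambda>_. \<mu> k" _ _ "\<lambda>n. \<mu> k + 1 / real (Suc n)"])
    show "(\<lambda>n. \<mu> k + 1 / real (Suc n)) \<longlonglongrightarrow> \<mu> k" using tendsto_add[OF tendsto_const inv0] by simp
  qed (use \<mu>_le[OF x(1)] x(2) in \<open>auto intro!: always_eventually less_imp_le\<close>)
  have Rlim: "(\<lambda>n. \<Sum>\<alpha>\<in>J k. (norm (\<rho> (x n) \<alpha>))\<^sup>2) \<longlonglongrightarrow> R"
    unfolding R_def by (intro tendsto_sum tendsto_power tendsto_norm r)
  have glim: "(\<lambda>n. N (G n)) \<longlonglongrightarrow> g"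
  proof -
    have "(\<lambda>n. Q k (x n) - t * sumsq k (\<rho> (x n))) \<longlonglongrightarrow> g"
      unfolding g_def by (intro tendsto_diff tendsto_mult_left Qlim Rlim)
    then show ?thesis by (simp add: Q_t G_def)
  qed
  have R0: "R \<ge> 0" by (simp add: R_def sum_nonneg)
  have g0: "g \<ge> 0" using LIMSEQ_le_const[OF glim] by auto
  define w where "w c = (\<Sum>\<alpha>\<in>J k. cnj (r \<alpha>) * c \<alpha>)" for c
  define W where "W c = sumsq k c" for c
  have W0: "W c \<ge> 0" for c by (simp add: W_def sum_nonneg)
  have expand: "sumsq k (\<lambda>\<alpha>. r \<alpha> + s * c \<alpha>) = R + 2 * Re (s * w c) + (norm s)\<^sup>2 * W c" for s c
    unfolding R_def w_def W_def by (rule sum_norm_add_sq)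

  text \<open>First variations of the minimisation problem, passed to the limit along the minimising sequence.\<close>

  have ideal_var: "w (coef u) = 0" if u: "germ u \<in> I" for u
  proof (rule complex_quadratic_nonneg[OF _ W0[of "coef u"]])
    fix s
    have hu: "holo0 u" by (rule ideal_holo0[OF I u])
    have su: "germ (\<lambda>z. s * u z) \<in> I" by (rule ideal_mult[OF I holo0_const u])
    let ?y = "\<lambda>n. (G n, \<lambda>z. v n z - s * u z)"
    have y: "?y n \<in> X" for n by (intro X_I GA ideal_diff[OF I vI su])
    have "\<rho> (?y n) \<alpha> = \<rho> (x n) \<alpha> + s * coef u \<alpha>" for n \<alpha>
      by (simp add: \<rho>_def x_eq coef_diff0[OF hv ideal_holo0[OF I su]] coef_cmult[OF hu])
    then have "\<mu> k \<le> N (G n) + t * sumsq k (\<lambda>\<alpha>. \<rho> (x n) \<alpha> + s * coef u \<alpha>)" for n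
      using \<mu>_le[OF y[of n], of k] by (simp add: Q_t)
    moreover have "(\<lambda>n. N (G n) + t * sumsq k (\<lambda>\<alpha>. \<rho> (x n) \<alpha> + s * coef u \<alpha>))
        \<longlonglongrightarrow> g + t * sumsq k (\<lambda>\<alpha>. r \<alpha> + s * coef u \<alpha>)"
      by (intro tendsto_intros glim r)
    ultimately have "\<mu> k \<le> g + t * sumsq k (\<lambda>\<alpha>. r \<alpha> + s * coef u \<alpha>)"
      by (intro LIMSEQ_le_const) auto
    \<comment> \<open>The constant terms cancel because \<mu> k = g + t R.\<close>
    then have "0 \<le> t * (2 * Re (s * w (coef u)) + (norm s)\<^sup>2 * W (coef u))"
      unfolding expand g_def by (simp add: algebra_simps)
    then show "0 \<le> 2 * Re (s * w (coef u)) + (norm s)\<^sup>2 * W (coef u)"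
      using t by (simp add: zero_le_mult_iff)
  qed

  \<comment> \<open>Replacing \<open>G n\<close> by its multiple by 1 + s changes the norm by an
    explicit quadratic factor. Since s may have either sign, the linear term 2 s (g + t Re
    w(\<gamma>)) must vanish.\<close>
  have scale_var: "g + t * Re (w \<gamma>) = 0"
  proof (rule real_quadratic_nonneg[of _ "g + t * W \<gamma>"])
    fix s :: real
    let ?y = "\<lambda>n. (\<lambda>z. of_real (1 + s) * G n z, v n)"
    have y: "?y n \<in> X" for n by (intro X_I cmult(1)[OF GA] vI)
    have "\<rho> (?y n) \<alpha> = \<rho> (x n) \<alpha> + of_real s * coef (G n) \<alpha>" for n \<alpha>
      unfolding \<rho>_def fst_conv snd_conv coef_cmult[OF hG] x_eq by (simp add: algebra_simps)
    moreover have "N (\<lambda>z. of_real (1 + s) * G n z) \<le> (1 + s)\<^sup>2 * N (G n)" for n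
      using cmult(2)[OF GA[of n], of "of_real (1 + s)"] by (simp only: norm_of_real power2_abs)
    ultimately have "\<mu> k \<le> (1 + s)\<^sup>2 * N (G n) + t * sumsq k (\<lambda>\<alpha>. \<rho> (x n) \<alpha> + of_real s * coef (G n) \<alpha>)" for n
      using order_trans[OF \<mu>_le[OF y[of n], of k]] unfolding Q_t fst_conv by (simp only: add_right_mono)
    moreover have "(\<lambda>n. (1 + s)\<^sup>2 * N (G n) + t * sumsq k (\<lambda>\<alpha>. \<rho> (x n) \<alpha> + of_real s * coef (G n) \<alpha>))
        \<longlonglongrightarrow> (1 + s)\<^sup>2 * g + t * sumsq k (\<lambda>\<alpha>. r \<alpha> + of_real s * \<gamma> \<alpha>)"
      by (intro tendsto_intros glim r \<gamma>)
    ultimately have "\<mu> k \<le> (1 + s)\<^sup>2 * g + t * sumsq k (\<lambda>\<alpha>. r \<alpha> + of_real s * \<gamma> \<alpha>)"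
      by (intro LIMSEQ_le_const) auto
    then show "0 \<le> 2 * s * (g + t * Re (w \<gamma>)) + s\<^sup>2 * (g + t * W \<gamma>)"
      unfolding expand g_def by (simp add: power2_eq_square algebra_simps)
  qed (use g0 W0[of \<gamma>] t in simp)

  have kernel_var: "(t * norm (w (coef H)))\<^sup>2 \<le> g" if H: "H \<in> bergman_space D" "N H \<le> 1" for H
  proof (cases "w (coef H) = 0")
    case False
    let ?w = "w (coef H)"
    have hH: "holo0 H" by (rule A_holo0[OF H(1)])
    define c where "c = 1 / (t * norm ?w)"
    have c: "c > 0" unfolding c_def using False t by (intro divide_pos_pos mult_pos_pos) auto
    have "0 \<le> c * g + 1 / c - 2 * t * norm ?w"
    proof (rule linear_coefficient_nonneg)
      fix \<sigma> :: real assume \<sigma>: "\<sigma> > 0"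
      \<comment> \<open>Modulus \<sigma>, and phase chosen to make the linear term as negative as
        possible.\<close>
      define s where "s = - of_real (\<sigma> / norm ?w) * cnj ?w"
      have ns: "norm s = \<sigma>" using \<sigma> False by (simp add: s_def norm_mult norm_divide)
      have sw: "Re (s * ?w) = - \<sigma> * norm ?w"
      proof -
        have "s * ?w = - of_real (\<sigma> / norm ?w * (norm ?w)\<^sup>2)"
          unfolding s_def of_real_mult complex_norm_square by (simp add: mult_ac)
        then have "Re (s * ?w) = - (\<sigma> / norm ?w * (norm ?w)\<^sup>2)" by (simp only: Re_complex_of_real uminus_complex.sel)
        then show ?thesis using False by (simp add: power2_eq_square)
      qed
      let ?y = "\<lambda>n. (\<lambda>z. G n z + s * H z, v n)"
      have y: "?y n \<in> X" for n by (intro X_I perturb(1)[OF GA H(1) c ns] vI)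
      have "\<rho> (?y n) \<alpha> = \<rho> (x n) \<alpha> + s * coef H \<alpha>" for n \<alpha>
        by (simp add: \<rho>_def x_eq coef_add[OF hG holo0_mult[OF holo0_const hH]] coef_cmult[OF hH])
      moreover have "N (\<lambda>z. G n z + s * H z) \<le> (1 + \<sigma> * c) * N (G n) + (\<sigma>\<^sup>2 + \<sigma> / c)" for n
      proof -
        have "(\<sigma>\<^sup>2 + \<sigma> / c) * N H \<le> \<sigma>\<^sup>2 + \<sigma> / c"
          using H(2) \<sigma> c by (intro mult_left_le) auto
        then show ?thesis by (intro order_trans[OF perturb(2)[OF GA H(1) c ns]] add_left_mono)
      qed
      ultimately have "\<mu> k \<le> ((1 + \<sigma> * c) * N (G n) + (\<sigma>\<^sup>2 + \<sigma> / c)) + t * sumsq k (\<lambda>\<alpha>. \<rho> (x n) \<alpha> + s * coef H \<alpha>)" for n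
        using order_trans[OF \<mu>_le[OF y[of n], of k]] unfolding Q_t fst_conv by (simp only: add_right_mono)
      moreover have "(\<lambda>n. ((1 + \<sigma> * c) * N (G n) + (\<sigma>\<^sup>2 + \<sigma> / c)) + t * sumsq k (\<lambda>\<alpha>. \<rho> (x n) \<alpha> + s * coef H \<alpha>))
          \<longlonglongrightarrow> ((1 + \<sigma> * c) * g + (\<sigma>\<^sup>2 + \<sigma> / c)) + t * sumsq k (\<lambda>\<alpha>. r \<alpha> + s * coef H \<alpha>)"
        by (intro tendsto_intros glim r)
      ultimately have "\<mu> k \<le> ((1 + \<sigma> * c) * g + (\<sigma>\<^sup>2 + \<sigma> / c)) + t * sumsq k (\<lambda>\<alpha>. r \<alpha> + s * coef H \<alpha>)"
        by (intro LIMSEQ_le_const) auto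
      then show "0 \<le> \<sigma> * (c * g + 1 / c - 2 * t * norm ?w) + \<sigma>\<^sup>2 * (1 + t * W (coef H))"
        unfolding expand sw ns g_def by (simp add: algebra_simps)
    qed
    then have "t * norm ?w \<le> c * g" by (simp add: c_def)
    then have "(t * norm ?w) * (t * norm ?w) \<le> (c * (t * norm ?w)) * g"
      using mult_left_mono[of "t * norm ?w" "c * g" "t * norm ?w"] t by (simp add: mult_ac)
    also have "c * (t * norm ?w) = 1" using False t by (simp add: c_def)
    finally show ?thesis by (simp add: power2_eq_square)
  qed (use g0 in simp)

  define \<eta> where "\<eta> = (\<lambda>\<alpha>. if \<alpha> \<in> J k then cnj (r \<alpha>) else 0)"
  have \<eta>: "pairing \<eta> f = w (coef f)" for f
    unfolding \<eta>_def w_def by (rule pairing_J)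
  \<comment> \<open>Apply \<open>w\<close> to coef F = coef (G n) - \<rho> (x n) - coef (v n) on
    \<open>J k\<close>: the ideal part is annihilated, and w r = R in the limit.\<close>
  have "w (coef F) = w \<gamma> - of_real R"
  proof -
    have "(\<lambda>n. w (coef (G n)) - w (\<rho> (x n))) \<longlonglongrightarrow> w \<gamma> - w r"
      unfolding w_def by (intro tendsto_intros \<gamma> r)
    moreover have "w (coef (G n)) - w (\<rho> (x n)) = w (coef F)" for n
    proof -
      have "w (\<rho> (x n)) = w (coef (G n)) - w (coef F) - w (coef (v n))"
        unfolding w_def \<rho>_def x_eq by (simp add: right_diff_distrib sum_subtractf)
      then show ?thesis using ideal_var[OF vI] by simp
    qed
    ultimately have "w (coef F) = w \<gamma> - w r" by (simp add: LIMSEQ_const_iff)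
    moreover have "w r = of_real R"
      unfolding w_def R_def of_real_sum complex_norm_square by (simp only: mult.commute)
    ultimately show ?thesis by simp
  qed
  then have "Re (w (coef F)) = Re (w \<gamma>) - R" by (simp only: minus_complex.sel Re_complex_of_real)
  then have "t * Re (w (coef F)) = t * Re (w \<gamma>) - t * R" by (simp only: right_diff_distrib)
  then have "t * - Re (w (coef F)) = \<mu> k"
    using scale_var by (simp add: g_def)
  moreover have "t * - Re (w (coef F)) \<le> t * norm (w (coef F))"
    using abs_Re_le_cmod[of "w (coef F)"] t by (intro mult_left_mono) auto
  ultimately have wF: "\<mu> k \<le> t * norm (w (coef F))" by (simp only:)

  show ?thesis
  proof (rule ccontr)
    assume "\<not> \<mu> k \<le> b"
    then have \<mu>b: "\<mu> k > b" by simp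
    then have \<mu>0: "\<mu> k > 0" using b by simp
    have wF0: "w (coef F) \<noteq> 0" using wF \<mu>0 by auto
    have "\<eta> \<noteq> (\<lambda>_. 0)" using wF0 by (auto simp: w_def \<eta>_def fun_eq_iff intro!: sum.neutral)
    moreover have "\<eta> \<in> ell1"
      unfolding ell1_def
    proof (intro CollectI allI impI)
      fix s :: real
      show "(\<lambda>\<alpha>. norm (\<eta> \<alpha>) * s ^ mdeg \<alpha>) summable_on UNIV"
        by (rule finite_nonzero_values_imp_summable_on, rule finite_subset[OF _ finite_J[of k]])
           (auto simp: \<eta>_def)
    qed
    moreover have "\<eta> \<in> ell0" by (auto simp: ell0_def \<eta>_def J_def intro!: exI[of _ k])
    ultimately have mem: "\<eta> \<in> ell I \<inter> ell0"
      using ideal_var by (auto simp: ell_def ell_tilde_def \<eta>)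
    have "ennreal ((norm (pairing \<eta> F))\<^sup>2) / bergman_kernel \<eta> D \<le> B_fin F I D"
      unfolding B_fin_def by (rule SUP_upper[OF mem])
    also have "\<dots> \<le> ennreal b" by (rule b)
    finally have quot: "ennreal ((norm (w (coef F)))\<^sup>2) / bergman_kernel \<eta> D \<le> ennreal b" by (simp add: \<eta>)
    have "bergman_kernel \<eta> D \<le> ennreal (g / t\<^sup>2)"
      unfolding bergman_kernel_def
    proof (rule SUP_least, rule ennreal_leI)
      fix H assume "H \<in> {f \<in> bergman_space D. sqnorm D f \<le> 1}"
      then have H: "H \<in> bergman_space D" "N H \<le> 1"
        using sqnorm_eq[of H] by (auto simp flip: ennreal_1 simp del: ennreal_1)
      show "(norm (pairing \<eta> H))\<^sup>2 \<le> g / t\<^sup>2"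
        using kernel_var[OF H] t by (simp add: \<eta> power_mult_distrib field_simps)
    qed
    then obtain \<kappa> where \<kappa>: "\<kappa> \<ge> 0" "bergman_kernel \<eta> D = ennreal \<kappa>" "\<kappa> \<le> g / t\<^sup>2"
      using g0 by (cases "bergman_kernel \<eta> D") (auto simp: top_unique)
    have "\<kappa> \<noteq> 0"
    proof
      assume "\<kappa> = 0"
      then have "ennreal ((norm (w (coef F)))\<^sup>2) / bergman_kernel \<eta> D = \<infinity>"
        using wF0 \<kappa>(2) ennreal_quotient_convention[of "ennreal ((norm (w (coef F)))\<^sup>2)"] by simp
      then show False using quot by (simp add: top_unique)
    qed
    then have "(norm (w (coef F)))\<^sup>2 / \<kappa> \<le> b"
      using quot \<kappa>(1) b(1) unfolding \<kappa>(2) by (simp add: divide_ennreal)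
    then have "(norm (w (coef F)))\<^sup>2 \<le> b * \<kappa>" using \<kappa>(1) \<open>\<kappa> \<noteq> 0\<close> by (simp add: field_simps)
    also have "\<dots> \<le> b * (g / t\<^sup>2)" by (rule mult_left_mono[OF \<kappa>(3) b(1)])
    \<comment> \<open>The penalty factor cancels between numerator and kernel, so the resulting
      bound is independent of \<open>k\<close>.\<close>
    finally have "(t * norm (w (coef F)))\<^sup>2 \<le> b * g" using t by (simp add: power_mult_distrib field_simps)
    moreover have "(\<mu> k)\<^sup>2 \<le> (t * norm (w (coef F)))\<^sup>2" using wF \<mu>0 by (intro power_mono) auto
    moreover have "g \<le> \<mu> k" unfolding g_def using R0 t by simp
    then have "b * g \<le> b * \<mu> k" using b(1) by (rule mult_left_mono)
    ultimately have "\<mu> k * \<mu> k \<le> b * \<mu> k" by (simp add: power2_eq_square)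
    then show False using \<mu>0 \<mu>b by simp
  qed
qed

section \<open>Letting the number of coefficients grow\<close>

lemma Q_mono:
  assumes "k \<le> l"
  shows "Q k x \<le> Q l x"
proof -
  have "sumsq k (\<rho> x) \<le> (\<Sum>\<alpha>\<in>J l. (norm (\<rho> x \<alpha>))\<^sup>2)"
    using assms by (intro sum_mono2 finite_J) (auto simp: J_def)
  then show ?thesis
    unfolding Q_def using assms by (intro add_left_mono mult_mono) (auto intro: sum_nonneg)
qed

lemma \<mu>_mono: "incseq \<mu>"
proof (rule incseq_SucI)
  fix k
  show "\<mu> k \<le> \<mu> (Suc k)"
    unfolding \<mu>_def[of "Suc k"]
    by (rule cINF_greatest[OF X_nonempty]) (rule order_trans[OF \<mu>_le Q_mono], auto)
qed

lemma minimizer_exists: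
  assumes b: "b \<ge> 0" "B_fin F I D \<le> ennreal b"
  obtains L where "L \<in> bergman_space D" "germ (\<lambda>z. L z - F z) \<in> I" "sqnorm D L \<le> ennreal b"
proof -
  have "\<exists>x\<in>X. Q k x < \<mu> k + 1 / real (Suc k)" for k
    by (rule near_minimizer[of "1 / real (Suc k)" k]) auto
  then obtain x where x: "\<And>k. x k \<in> X" "\<And>k. Q k (x k) < \<mu> k + 1 / real (Suc k)" by metis
  define G where "G k = fst (x k)" for k
  have GA: "G k \<in> bergman_space D" for k unfolding G_def by (rule X_fst[OF x(1)])
  have \<mu>b: "\<mu> k \<le> b" for k by (rule \<mu>_le_if_B_fin_le[OF b])
  have inv0: "(\<lambda>n. 1 / real (Suc n)) \<longlonglongrightarrow> 0" using lim_inverse_n' LIMSEQ_Suc by blast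
  obtain m where m: "\<mu> \<longlonglongrightarrow> m" "\<And>k. \<mu> k \<le> m"
    using incseq_convergent[OF \<mu>_mono, of b] \<mu>b by metis
  \<comment> \<open>For k \<le> l the midpoint estimate at level k gives 2 Q k (x k) + 2 Q k (x l) -
    4 \<mu> k. Here Q k (x l) \<le> Q l (x l) < m + 1 / (l + 1), and both error terms are at most 1
    / (k + 1).\<close>
  define \<delta> where "\<delta> k = 2 * (m - \<mu> k) + 4 * (1 / real (Suc k))" for k
  have \<delta>: "\<delta> \<longlonglongrightarrow> 0"
  proof -
    have "(\<lambda>k. 2 * (m - \<mu> k) + 4 * (1 / real (Suc k))) \<longlonglongrightarrow> 2 * (m - m) + 4 * 0"
      by (intro tendsto_add tendsto_mult_left tendsto_diff tendsto_const m(1) inv0)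
    then show ?thesis by (simp add: \<delta>_def[abs_def])
  qed
  have close: "N (\<lambda>z. G k z - G l z) \<le> \<delta> k" if "k \<le> l" for k l
  proof -
    have 1: "0 \<le> real (Suc k) * sumsq k (\<lambda>\<alpha>. \<rho> (x k) \<alpha> - \<rho> (x l) \<alpha>)"
      by (intro mult_nonneg_nonneg sum_nonneg) auto
    have 2: "Q k (x l) \<le> Q l (x l)" by (rule Q_mono[OF that])
    have 3: "1 / real (Suc l) \<le> 1 / real (Suc k)" using that by (intro divide_left_mono) auto
    have "N (\<lambda>z. G k z - G l z) \<le> 2 * Q k (x k) + 2 * Q k (x l) - 4 * \<mu> k"
      using midpoint_estimate[OF x(1)[of k] x(1)[of l], of k] 1 unfolding G_def by linarith
    then show ?thesis
      using 2 3 x(2)[of k] x(2)[of l] m(2)[of l] unfolding \<delta>_def by argo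
  qed
  have sym: "N (\<lambda>z. G k z - G l z) = N (\<lambda>z. G l z - G k z)" for k l
    by (simp add: N_def sqnorm_def norm_minus_commute)
  have cauchy: "\<exists>M. \<forall>k\<ge>M. \<forall>l\<ge>M. N (\<lambda>z. G k z - G l z) < e" if "e > 0" for e
  proof -
    have "\<forall>\<^sub>F k in sequentially. \<delta> k < e" by (rule order_tendstoD(2)[OF \<delta> that])
    then obtain M where M: "\<And>k. k \<ge> M \<Longrightarrow> \<delta> k < e" by (auto simp: eventually_sequentially)
    have "N (\<lambda>z. G k z - G l z) < e" if "k \<ge> M" "l \<ge> M" for k l
    proof (cases "k \<le> l")
      case True
      then show ?thesis using close[OF True] M[OF that(1)] by linarith
    next
      case False
      then show ?thesis using close[of l k] M[OF that(2)] sym[of k l] by linarith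
    qed
    then show ?thesis by (intro exI[of _ M] allI impI)
  qed
  have Qb: "Q k (x k) \<le> b + 1 / real (Suc k)" for k using x(2)[of k] \<mu>b[of k] by linarith
  have NQ: "N (G k) \<le> b + 1 / real (Suc k)" for k
  proof -
    have "0 \<le> real (Suc k) * sumsq k (\<rho> (x k))"
      by (intro mult_nonneg_nonneg sum_nonneg) auto
    then show ?thesis using Qb[of k] unfolding Q_def G_def by linarith
  qed
  have "(\<lambda>k. b + 1 / real (Suc k)) \<longlonglongrightarrow> b" using tendsto_add[OF tendsto_const inv0] by simp
  from complete[OF GA cauchy NQ this] obtain L where L: "holo_on L D" "sqnorm D L \<le> ennreal b"
    "\<And>\<alpha>. (\<lambda>k. coef (G k) \<alpha>) \<longlonglongrightarrow> coef L \<alpha>" by blast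
  have LA: "L \<in> bergman_space D"
    using L le_less_trans[OF L(2) ennreal_less_top] by (simp add: bergman_space_def)
  have hLF: "holo0 (\<lambda>z. L z - F z)" by (rule holo0_diff[OF A_holo0[OF LA] F])
  have "germ (\<lambda>z. L z - F z) \<in> I"
  proof (rule ideal_closed[OF I hLF, of "\<lambda>k. snd (x k)"])
    show "germ (snd (x k)) \<in> I" for k by (rule X_snd[OF x(1)])
    fix \<alpha>
    have "(\<lambda>k. \<rho> (x k) \<alpha>) \<longlonglongrightarrow> 0"
    proof (rule Lim_null_comparison)
      \<comment> \<open>Only from k = mdeg \<alpha> on does the penalty include this
        coefficient.\<close>
      show "\<forall>\<^sub>F k in sequentially. norm (\<rho> (x k) \<alpha>) \<le> sqrt ((b + 1) * (1 / real (Suc k)))"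
        using eventually_ge_at_top[of "mdeg \<alpha>"]
      proof eventually_elim
        case (elim k)
        then have "(norm (\<rho> (x k) \<alpha>))\<^sup>2 \<le> sumsq k (\<rho> (x k))"
          by (intro member_le_sum finite_J) (auto simp: J_def)
        then have "real (Suc k) * (norm (\<rho> (x k) \<alpha>))\<^sup>2 \<le> real (Suc k) * sumsq k (\<rho> (x k))"
          by (intro mult_left_mono) auto
        also have "\<dots> \<le> Q k (x k)" by (simp add: Q_def)
        also have "\<dots> \<le> b + 1" using Qb[of k] by (rule order_trans) simp
        finally have "(norm (\<rho> (x k) \<alpha>))\<^sup>2 \<le> (b + 1) * (1 / real (Suc k))"
          by (simp add: field_simps)
        then show ?case by (rule real_le_rsqrt)
      qed
      have "(\<lambda>k. sqrt ((b + 1) * (1 / real (Suc k)))) \<longlonglongrightarrow> sqrt ((b + 1) * 0)"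
        by (intro tendsto_real_sqrt tendsto_mult_left inv0)
      then show "(\<lambda>k. sqrt ((b + 1) * (1 / real (Suc k)))) \<longlonglongrightarrow> 0" by simp
    qed
    then have "(\<lambda>k. coef (G k) \<alpha> - coef F \<alpha> - \<rho> (x k) \<alpha>) \<longlonglongrightarrow> coef L \<alpha> - coef F \<alpha> - 0"
      by (intro tendsto_diff L(3) tendsto_const)
    then show "(\<lambda>k. coef (snd (x k)) \<alpha>) \<longlonglongrightarrow> coef (\<lambda>z. L z - F z) \<alpha>"
      by (simp add: \<rho>_def G_def coef_diff0[OF A_holo0[OF LA] F])
  qed
  with LA L(2) that show ?thesis by blast
qed

section \<open>The two inequalities between the suprema and the minimal integral\<close>

lemma min_L2_le_B_fin: "min_L2 F I D \<le> B_fin F I D"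
proof (cases "B_fin F I D")
  case (real b)
  obtain L where L: "L \<in> bergman_space D" "germ (\<lambda>z. L z - F z) \<in> I" "sqnorm D L \<le> ennreal b"
    using minimizer_exists[of b] real by auto
  have "min_L2 F I D \<le> sqnorm D L"
    unfolding min_L2_def by (rule INF_lower) (use L in simp)
  then show ?thesis using L(3) real by simp
qed simp

text \<open>A functional annihilating the ideal takes the same value at \<open>F\<close> and at
  every competitor \<open>G\<close>, and by homogeneity the kernel bounds its squared value at
  \<open>G\<close> by the kernel times the squared norm of \<open>G\<close>.\<close>

lemma B_full_le_min_L2: "B_full F I D \<le> min_L2 F I D"
  unfolding B_full_def min_L2_def
proof (rule SUP_least, rule INF_greatest)
  fix \<xi> G assume \<xi>: "\<xi> \<in> ell I" and G: "G \<in> {G \<in> bergman_space D. germ (\<lambda>z. G z - F z) \<in> I}"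
  have GA: "G \<in> bergman_space D" using G by simp
  have "pairing \<xi> (\<lambda>z. G z - F z) = 0" using \<xi> G by (simp add: ell_def ell_tilde_def)
  moreover have "\<xi> \<in> ell1" using \<xi> by (simp add: ell_def ell_tilde_def)
  ultimately have eq: "pairing \<xi> F = pairing \<xi> G"
    using pairing_diff[of \<xi> G F] A_holo0[OF GA] F by simp
  \<comment> \<open>Stated for all admissible multiples \<open>c * G\<close> instead of the
    normalised function, so that a competitor of norm 0 is covered.\<close>
  have kernel: "c\<^sup>2 * (norm (pairing \<xi> G))\<^sup>2 \<le> \<kappa>"
    if \<kappa>: "\<kappa> \<ge> 0" "bergman_kernel \<xi> D = ennreal \<kappa>" and c: "c\<^sup>2 * N G \<le> 1" for c \<kappa> :: real
  proof -
    let ?H = "\<lambda>z. of_real c * G z"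
    have "N ?H \<le> c\<^sup>2 * N G" using cmult(2)[OF GA, of "of_real c"] by (simp only: norm_of_real power2_abs)
    then have "sqnorm D ?H \<le> 1"
      using c sqnorm_eq[OF cmult(1)[OF GA]] by (simp flip: ennreal_1 add: ennreal_leI del: ennreal_1)
    then have "ennreal ((norm (pairing \<xi> ?H))\<^sup>2) \<le> bergman_kernel \<xi> D"
      unfolding bergman_kernel_def by (intro SUP_upper) (use cmult(1)[OF GA] in auto)
    then have "(norm (pairing \<xi> ?H))\<^sup>2 \<le> \<kappa>" using \<kappa> by simp
    then show ?thesis by (simp add: pairing_cmult[OF A_holo0[OF GA]] norm_mult power_mult_distrib)
  qed
  show "ennreal ((norm (pairing \<xi> F))\<^sup>2) / bergman_kernel \<xi> D \<le> sqnorm D G"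
    unfolding sqnorm_eq[OF GA] eq
  proof (rule ennreal_quotient_le)
    fix \<kappa> assume \<kappa>: "\<kappa> \<ge> 0" "bergman_kernel \<xi> D = ennreal \<kappa>"
    let ?p = "norm (pairing \<xi> G)"
    show "?p\<^sup>2 \<le> N G * \<kappa>"
    proof (cases "N G = 0")
      case True
      have "?p = 0"
      proof (rule ccontr)
        assume p: "?p \<noteq> 0"
        \<comment> \<open>When the norm is 0 every multiple is admissible; this one pairs to the
          squared value \<kappa> + 1, exceeding the kernel.\<close>
        define c where "c = sqrt (\<kappa> + 1) / ?p"
        have "c\<^sup>2 * ?p\<^sup>2 = \<kappa> + 1" using p \<kappa>(1) by (simp add: c_def power_divide)
        then show False using kernel[OF \<kappa>, of c] True by simp
      qed
      then show ?thesis using True by simp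
    next
      case False
      then have n: "N G > 0" using N_nonneg[of G] by linarith
      have "(1 / sqrt (N G))\<^sup>2 * ?p\<^sup>2 \<le> \<kappa>"
        by (rule kernel[OF \<kappa>]) (use n in \<open>simp add: power_divide\<close>)
      then show ?thesis using n by (simp add: power_divide field_simps)
    qed
  qed simp_all
qed

end

theorem theorem1p6:
  fixes D :: "(complex ^ 'n::finite) set"
    and I :: "(complex ^ 'n \<Rightarrow> complex) set set"
    and F :: "complex ^ 'n \<Rightarrow> complex"
  assumes "open D" and "connected D" and "0 \<in> D"
    and "ideal I germ_ring" and "I \<noteq> carrier germ_ring"
    and "germ F \<in> carrier germ_ring"
  shows "B_fin F I D = B_full F I D \<and> B_full F I D = min_L2 F I D"
proof -
  interpret min_problem D I F
    by (intro min_problem.intro bergman.intro min_problem_axioms.intro)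
       (use assms germ_in_carrier_iff in auto)
  have "B_fin F I D \<le> B_full F I D"
    unfolding B_fin_def B_full_def by (rule SUP_subset_mono) auto
  then show ?thesis
    using B_full_le_min_L2 min_L2_le_B_fin by (metis order.antisym order.trans)
qed

end
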